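(* Let $g_{ij}(\mathbf u)$, $c_{ijk}(\mathbf u)$ define a non-degenerate third-order Hamiltonian operator $P^{ij}=\partial_x(g^{ij}\partial_x+c^{ij}_ku^k_x)\partial_x$ in flat coordinates $u^1,\dots,u^n$ (see context). Consider the linear overdetermined system of partial differential equations for the unknown functions $V^1(\mathbf u),\dots,V^n(\mathbf u)$: $$g_{im}V^m_j=g_{jm}V^m_i,$$ $$c_{mkl}V^m_i+c_{mik}V^m_l+c_{mli}V^m_k=0,$$ $$V^k_{ij}=g^{ks}c_{smj}V^m_i+g^{ks}c_{smi}V^m_j,$$ where $V^m_i=\partial V^m/\partial u^i$ and $V^k_{ij}=\partial^2V^k/\partial u^i\partial u^j$. This system is in involution, and its general (local) solution depends on at most $\frac{n(n+3)}{2}$ arbitrary constants (i.e. the vector space of local solutions has dimension $\le \frac{n(n+3)}{2}$).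
   Context: Summation over repeated indices is understood; a comma in a lower index denotes a partial derivative with respect to the corresponding $u^l$. Here $g^{ij}(\mathbf u)$ is a symmetric matrix with $\det g^{ij}\neq0$, $g_{ij}$ is its inverse, and $c_{ijk}=g_{iq}g_{jp}c^{pq}_k$. The operator $P$ is Hamiltonian (the bracket $\{F,G\}=\int\frac{\delta F}{\delta u^i}P^{ij}\frac{\delta G}{\delta u^j}dx$ is skew-symmetric and satisfies the Jacobi identity) if and only if $$g_{mp,k}=-c_{mpk}-c_{pmk},\quad c_{mpk}=-c_{mkp},\quad c_{mpk}+c_{pkm}+c_{kmp}=0,\quad c_{mpk,l}=-g^{sq}c_{sml}c_{qpk}.$$ "In involution" means: (i) differentiating the first-order relations (the first two families of equations) and eliminating the second derivatives of $V$ by means of the third family of equations gives relations that already follow algebraically from the first-order relations, so no new first-order relations arise; and (ii) the compatibility conditions $\partial_{u^k}(V^p_{ij})=\partial_{u^i}(V^p_{kj})$ of the third family hold identically modulo the equations of the system. *)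

theory Defs
  imports "HOL-Analysis.Analysis"
begin

section \<open>Functions of \<open>u\<^sup>1, \<dots>, u\<^sup>n\<close>\<close>

definition partial :: "'n \<Rightarrow> (real^'n \<Rightarrow> real) \<Rightarrow> real^'n \<Rightarrow> real" where
  "partial l f u = frechet_derivative f (at u) (axis l 1)"

primrec partials :: "'n list \<Rightarrow> (real^'n \<Rightarrow> real) \<Rightarrow> real^'n \<Rightarrow> real" where
  "partials [] f = f"
| "partials (l # ls) f = partial l (partials ls f)"

text \<open>\<open>C\<^sup>\<infinity>\<close> on an open set: all iterated partial derivatives exist and are differentiable.\<close>

definition smooth_on :: "(real^'n) set \<Rightarrow> (real^'n \<Rightarrow> real) \<Rightarrow> bool" where
  "smooth_on U f \<longleftrightarrow> (\<forall>ls. \<forall>u\<in>U. partials ls f differentiable (at u))"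


section \<open>Fields and local functionals\<close>

text \<open>
  The integrals over \<open>x\<close> are taken over the circle: a field \<open>u(x)\<close> is a smooth 1-periodic curve
  and the integration is over one period, so that total \<open>x\<close>-derivatives integrate to zero.
\<close>

definition Dx :: "(real \<Rightarrow> 'a::real_normed_vector) \<Rightarrow> real \<Rightarrow> 'a" where
  "Dx f = (\<lambda>x. vector_derivative f (at x))"

definition loops :: "(real \<Rightarrow> 'a::real_normed_vector) set" where
  "loops = {f. (\<forall>k x. (Dx ^^ k) f differentiable (at x)) \<and> (\<forall>x. f (x + 1) = f x)}"

definition fields :: "(real^'n) set \<Rightarrow> (real \<Rightarrow> real^'n) set" where
  "fields U = {u \<in> loops. range u \<subseteq> U}"

text \<open>
  A point of jet space is a pair \<open>(x, w)\<close>, where \<open>w k\<close> stands for the \<open>k\<close>-th \<open>x\<close>-derivative of the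
  field. Densities depend on finitely many of the \<open>w k\<close>, so continuity with respect to the product
  topology on \<open>w\<close> is ordinary continuity in finitely many variables.
\<close>

type_synonym 'n jet = "real \<times> (nat \<Rightarrow> real^'n)"

definition jet_of :: "(real \<Rightarrow> real^'n) \<Rightarrow> real \<Rightarrow> 'n jet" where
  "jet_of u x = (x, \<lambda>k. (Dx ^^ k) u x)"

datatype 'n jet_coord = Indep | Dep nat 'n

fun jet_shift :: "'n::finite jet_coord \<Rightarrow> real \<Rightarrow> 'n jet \<Rightarrow> 'n jet" where
  "jet_shift Indep t (x, w) = (x + t, w)"
| "jet_shift (Dep k i) t (x, w) = (x, w(k := w k + t *\<^sub>R axis i 1))"

primrec jet_partials :: "'n::finite jet_coord list \<Rightarrow> ('n jet \<Rightarrow> real) \<Rightarrow> 'n jet \<Rightarrow> real" where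
  "jet_partials [] f = f"
| "jet_partials (a # as) f = (\<lambda>z. deriv (\<lambda>t. jet_partials as f (jet_shift a t z)) 0)"

definition jet_domain :: "(real^'n) set \<Rightarrow> 'n jet set" where
  "jet_domain U = {(x, w). w 0 \<in> U}"

definition smooth_density :: "(real^'n) set \<Rightarrow> ('n jet \<Rightarrow> real) \<Rightarrow> bool" where
  "smooth_density U f \<longleftrightarrow>
     (\<exists>N. \<forall>x w w'. (\<forall>k\<le>N. w k = w' k) \<longrightarrow> f (x, w) = f (x, w')) \<and>
     (\<forall>x w. f (x + 1, w) = f (x, w)) \<and>
     (\<forall>as. continuous_on (jet_domain U) (jet_partials as f) \<and>
        (\<forall>a. \<forall>z\<in>jet_domain U.
           (\<lambda>t. jet_partials as f (jet_shift a t z)) field_differentiable (at 0)))"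

definition local_functional ::
    "(real^'n) set \<Rightarrow> ((real \<Rightarrow> real^'n) \<Rightarrow> real) \<Rightarrow> bool" where
  "local_functional U F \<longleftrightarrow>
     (\<exists>f. smooth_density U f \<and> (\<forall>u\<in>fields U. F u = integral {0..1} (\<lambda>x. f (jet_of u x))))"

text \<open>
  \<open>e\<close> is the variational derivative \<open>\<delta>F/\<delta>u\<close> at the field \<open>u\<close>. It is unique if it exists. For a
  local functional it is given by the Euler operator, and the brackets of local functionals are
  again local.
\<close>

definition has_var_deriv ::
    "((real \<Rightarrow> real^'n) \<Rightarrow> real) \<Rightarrow> (real \<Rightarrow> real^'n) \<Rightarrow> (real \<Rightarrow> real^'n) \<Rightarrow> bool" where
  "has_var_deriv F u e \<longleftrightarrow> e \<in> loops \<and>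
     (\<forall>v\<in>loops. ((\<lambda>\<epsilon>. F (\<lambda>x. u x + \<epsilon> *\<^sub>R v x)) has_real_derivative
        integral {0..1} (\<lambda>x. e x \<bullet> v x)) (at 0))"

definition var_deriv ::
    "((real \<Rightarrow> real^'n) \<Rightarrow> real) \<Rightarrow> (real \<Rightarrow> real^'n) \<Rightarrow> real \<Rightarrow> real^'n" where
  "var_deriv F u = (THE e. has_var_deriv F u e)"


section \<open>Third-order Hamiltonian operators in flat coordinates\<close>

text \<open>
  \<open>gu u $ i $ j\<close> is the matrix \<open>g\<^sup>i\<^sup>j(u)\<close> with upper indices, \<open>cu u i j k\<close> is \<open>c\<^sup>i\<^sup>j\<^sub>k(u)\<close>.
  The operator is \<open>P\<^sup>i\<^sup>j = \<partial>\<^sub>x (g\<^sup>i\<^sup>j \<partial>\<^sub>x + c\<^sup>i\<^sup>j\<^sub>k u\<^sup>k\<^sub>x) \<partial>\<^sub>x\<close>.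
\<close>

definition P_op ::
    "(real^'n \<Rightarrow> real^'n^'n) \<Rightarrow> (real^'n \<Rightarrow> 'n \<Rightarrow> 'n \<Rightarrow> 'n \<Rightarrow> real) \<Rightarrow>
     (real \<Rightarrow> real^'n) \<Rightarrow> (real \<Rightarrow> real^'n) \<Rightarrow> real \<Rightarrow> real^'n" where
  "P_op gu cu u w = Dx (\<lambda>x. \<chi> i. \<Sum>j\<in>UNIV.
     gu (u x) $ i $ j * (Dx (Dx w) x $ j)
     + (\<Sum>k\<in>UNIV. cu (u x) i j k * (Dx u x $ k)) * (Dx w x $ j))"

definition bracket ::
    "(real^'n \<Rightarrow> real^'n^'n) \<Rightarrow> (real^'n \<Rightarrow> 'n \<Rightarrow> 'n \<Rightarrow> 'n \<Rightarrow> real) \<Rightarrow>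
     ((real \<Rightarrow> real^'n) \<Rightarrow> real) \<Rightarrow> ((real \<Rightarrow> real^'n) \<Rightarrow> real) \<Rightarrow>
     (real \<Rightarrow> real^'n) \<Rightarrow> real" where
  "bracket gu cu F G u =
     integral {0..1} (\<lambda>x. var_deriv F u x \<bullet> P_op gu cu u (var_deriv G u) x)"

definition hamiltonian ::
    "(real^'n) set \<Rightarrow> (real^'n \<Rightarrow> real^'n^'n) \<Rightarrow> (real^'n \<Rightarrow> 'n \<Rightarrow> 'n \<Rightarrow> 'n \<Rightarrow> real) \<Rightarrow> bool" where
  "hamiltonian U gu cu \<longleftrightarrow>
     (\<forall>F G. local_functional U F \<longrightarrow> local_functional U G \<longrightarrow>
        (\<forall>u\<in>fields U. bracket gu cu F G u = - bracket gu cu G F u)) \<and>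
     (\<forall>F G H. local_functional U F \<longrightarrow> local_functional U G \<longrightarrow> local_functional U H \<longrightarrow>
        (\<forall>u\<in>fields U.
           bracket gu cu (bracket gu cu F G) H u
           + bracket gu cu (bracket gu cu G H) F u
           + bracket gu cu (bracket gu cu H F) G u = 0))"

definition nondegenerate_hamiltonian ::
    "(real^'n) set \<Rightarrow> (real^'n \<Rightarrow> real^'n^'n) \<Rightarrow> (real^'n \<Rightarrow> 'n \<Rightarrow> 'n \<Rightarrow> 'n \<Rightarrow> real) \<Rightarrow> bool" where
  "nondegenerate_hamiltonian U gu cu \<longleftrightarrow> open U \<and>
     (\<forall>i j. smooth_on U (\<lambda>u. gu u $ i $ j)) \<and>
     (\<forall>i j k. smooth_on U (\<lambda>u. cu u i j k)) \<and>
     (\<forall>u\<in>U. transpose (gu u) = gu u \<and> det (gu u) \<noteq> 0) \<and>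
     hamiltonian U gu cu"

definition g_low :: "(real^'n \<Rightarrow> real^'n^'n) \<Rightarrow> real^'n \<Rightarrow> 'n \<Rightarrow> 'n \<Rightarrow> real" where
  "g_low gu u i j = matrix_inv (gu u) $ i $ j"

text \<open>\<open>c\<^sub>i\<^sub>j\<^sub>k = g\<^sub>i\<^sub>q g\<^sub>j\<^sub>p c\<^sup>p\<^sup>q\<^sub>k\<close>: the first lower index comes from the second upper one.\<close>

definition c_low ::
    "(real^'n \<Rightarrow> real^'n^'n) \<Rightarrow> (real^'n \<Rightarrow> 'n \<Rightarrow> 'n \<Rightarrow> 'n \<Rightarrow> real) \<Rightarrow>
     real^'n \<Rightarrow> 'n \<Rightarrow> 'n \<Rightarrow> 'n \<Rightarrow> real" where
  "c_low gu cu u i j k =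
     (\<Sum>p\<in>UNIV. \<Sum>q\<in>UNIV. g_low gu u i q * g_low gu u j p * cu u p q k)"


section \<open>Overdetermined systems and involution\<close>

text \<open>
  We consider systems for \<open>V : \<real>\<^sup>n \<rightarrow> \<real>\<^sup>n\<close> consisting of first-order relations
  \<open>R r (u, V\<^sup>m\<^sub>i) = 0\<close> and of equations \<open>V\<^sup>k\<^sub>i\<^sub>j = \<Phi>\<^sup>k\<^sub>i\<^sub>j(u, V\<^sup>m\<^sub>i)\<close> for all second derivatives. The first
  derivatives are collected in a matrix \<open>A\<close>, where \<open>A $ m $ i\<close> stands for \<open>V\<^sup>m\<^sub>i\<close>.
\<close>

definition jacobi_matrix :: "(real^'n \<Rightarrow> real^'n) \<Rightarrow> real^'n \<Rightarrow> real^'n^'n" where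
  "jacobi_matrix V u = (\<chi> m i. partial i (\<lambda>w. V w $ m) u)"

definition solutions ::
    "(real^'n) set \<Rightarrow> ('r \<Rightarrow> real^'n \<Rightarrow> real^'n^'n \<Rightarrow> real) \<Rightarrow>
     (real^'n \<Rightarrow> real^'n^'n \<Rightarrow> 'n \<Rightarrow> 'n \<Rightarrow> 'n \<Rightarrow> real) \<Rightarrow> (real^'n \<Rightarrow> real^'n) set" where
  "solutions W R \<Phi> = {V. \<forall>u\<in>W.
     (\<forall>m. (\<lambda>w. V w $ m) differentiable (at u)) \<and>
     (\<forall>m i. partial i (\<lambda>w. V w $ m) differentiable (at u)) \<and>
     (\<forall>r. R r u (jacobi_matrix V u) = 0) \<and>
     (\<forall>k i j. partial j (partial i (\<lambda>w. V w $ k)) u = \<Phi> u (jacobi_matrix V u) k i j)}"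

text \<open>
  Derivative along \<open>u\<^sup>l\<close> of a function of \<open>u\<close> and of the first derivatives of \<open>V\<close>, the second
  derivatives being eliminated by means of \<open>\<Phi>\<close>.
\<close>

definition total_deriv ::
    "(real^'n \<Rightarrow> real^'n^'n \<Rightarrow> 'n \<Rightarrow> 'n \<Rightarrow> 'n \<Rightarrow> real) \<Rightarrow> 'n \<Rightarrow>
     (real^'n \<Rightarrow> real^'n^'n \<Rightarrow> real) \<Rightarrow> real^'n \<Rightarrow> real^'n^'n \<Rightarrow> real" where
  "total_deriv \<Phi> l F u A =
     partial l (\<lambda>w. F w A) u
     + (\<Sum>m\<in>UNIV. \<Sum>i\<in>UNIV.
          frechet_derivative (F u) (at A) (axis m (axis i 1)) * \<Phi> u A m i l)"

definition in_involution ::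
    "(real^'n) set \<Rightarrow> ('r \<Rightarrow> real^'n \<Rightarrow> real^'n^'n \<Rightarrow> real) \<Rightarrow>
     (real^'n \<Rightarrow> real^'n^'n \<Rightarrow> 'n \<Rightarrow> 'n \<Rightarrow> 'n \<Rightarrow> real) \<Rightarrow> bool" where
  "in_involution U R \<Phi> \<longleftrightarrow>
     (\<forall>u\<in>U. \<forall>A. (\<forall>r. R r u A = 0) \<longrightarrow>
        (\<forall>r l. total_deriv \<Phi> l (R r) u A = 0) \<and>
        (\<forall>p i j k. total_deriv \<Phi> k (\<lambda>w B. \<Phi> w B p i j) u A
                 = total_deriv \<Phi> i (\<lambda>w B. \<Phi> w B p k j) u A))"


section \<open>The system\<close>

datatype 'n rel_index = Symm 'n 'n | Cyc 'n 'n 'n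

fun first_order ::
    "(real^'n \<Rightarrow> real^'n^'n) \<Rightarrow> (real^'n \<Rightarrow> 'n \<Rightarrow> 'n \<Rightarrow> 'n \<Rightarrow> real) \<Rightarrow>
     'n rel_index \<Rightarrow> real^'n \<Rightarrow> real^'n^'n \<Rightarrow> real" where
  "first_order gu cu (Symm i j) u A =
     (\<Sum>m\<in>UNIV. g_low gu u i m * A $ m $ j) - (\<Sum>m\<in>UNIV. g_low gu u j m * A $ m $ i)"
| "first_order gu cu (Cyc i k l) u A =
     (\<Sum>m\<in>UNIV. c_low gu cu u m k l * A $ m $ i + c_low gu cu u m i k * A $ m $ l
               + c_low gu cu u m l i * A $ m $ k)"

definition second_order ::
    "(real^'n \<Rightarrow> real^'n^'n) \<Rightarrow> (real^'n \<Rightarrow> 'n \<Rightarrow> 'n \<Rightarrow> 'n \<Rightarrow> real) \<Rightarrow>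
     real^'n \<Rightarrow> real^'n^'n \<Rightarrow> 'n \<Rightarrow> 'n \<Rightarrow> 'n \<Rightarrow> real" where
  "second_order gu cu u A k i j =
     (\<Sum>s\<in>UNIV. \<Sum>m\<in>UNIV. gu u $ k $ s * c_low gu cu u s m j * A $ m $ i
                           + gu u $ k $ s * c_low gu cu u s m i * A $ m $ j)"

end

theory Submission
  imports Defs
begin

text \<open>
  The Hamiltonian property is only needed for linear functionals \<open>F\<^sub>a(u) = \<integral> a \<bullet> u dx\<close> with a loop
  \<open>a\<close>, because \<open>\<delta>F\<^sub>a/\<delta>u = a\<close> and the variational derivative of \<open>{F\<^sub>a, F\<^sub>b}\<close> can be computed
  explicitly. Skew-symmetry gives \<open>g\<^sup>i\<^sup>j\<^sub>,\<^sub>k = c\<^sup>i\<^sup>j\<^sub>k + c\<^sup>j\<^sup>i\<^sub>k\<close>. In the Jacobi identity for \<open>F\<^sub>a, F\<^sub>b, F\<^sub>d\<close>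
  all derivatives are moved away from \<open>d'\<close>; as \<open>d\<close> is arbitrary, the remaining factor \<open>S\<close> is
  constant in \<open>x\<close>. For \<open>a\<close> flat at \<open>x = 1/2\<close> this constant is \<open>0\<close>, while \<open>S(0)\<close> is a combination of
  three tensors at an arbitrary point; varying the frequency of \<open>b\<close> and the amplitude of the field
  separates them. They yield the two algebraic relations for \<open>c\<close> and a linear equation for its
  derivatives, which can be solved: \<open>N\<^sup>p\<^sub>m\<^sub>j\<^sub>,\<^sub>k = N\<^sup>p\<^sub>b\<^sub>k N\<^sup>b\<^sub>m\<^sub>j\<close> where \<open>N\<^sup>p\<^sub>m\<^sub>j = g\<^sup>p\<^sup>s c\<^sub>s\<^sub>m\<^sub>j\<close>. With
  this equation involution is a direct calculation: the derivative of the first family is the second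
  family, the derivative of the second one vanishes by the differentiated cyclic relation, and the
  compatibility conditions hold identically.

  Along segments a solution and its Jacobi matrix satisfy a homogeneous linear ODE, so on a connected
  set they are determined by their values at one point, where the matrix \<open>g\<^sub>i\<^sub>m V\<^sup>m\<^sub>j\<close> is symmetric; this
  leaves \<open>n + n(n+1)/2\<close> constants.
\<close>

section \<open>Partial derivatives and smooth functions on open sets\<close>

lemma partial_has_derivative:
  fixes f :: "real^'n \<Rightarrow> real"
  assumes "f differentiable (at u)"
  shows "(f has_derivative (\<lambda>h. \<Sum>l\<in>UNIV. partial l f u * h $ l)) (at u)"
proof -
  let ?D = "frechet_derivative f (at u)"
  have D: "(f has_derivative ?D) (at u)"
    using assms frechet_derivative_works by blast
  then have lin: "linear ?D" by (rule has_derivative_linear)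
  have "?D h = (\<Sum>l\<in>UNIV. partial l f u * h $ l)" for h :: "real^'n"
  proof -
    have "?D h = ?D (\<Sum>l\<in>UNIV. (h $ l) *\<^sub>R axis l 1)"
      by (simp add: basis_expansion flip: scalar_mult_eq_scaleR)
    also have "\<dots> = (\<Sum>l\<in>UNIV. h $ l * ?D (axis l 1))"
      by (simp add: linear_sum[OF lin] linear_cmul[OF lin])
    finally show ?thesis by (simp add: partial_def mult.commute)
  qed
  then show ?thesis using D by (metis (no_types, lifting) ext)
qed

lemma partial_eqI:
  assumes "(f has_derivative D) (at u)"
  shows "partial l f u = D (axis l 1)"
  using frechet_derivative_at[OF assms] by (simp add: partial_def)

lemma partials_append: "partials ls (partial l f) = partials (ls @ [l]) f"
  by (induction ls) auto

lemma smooth_on_partial: "smooth_on U f \<Longrightarrow> smooth_on U (partial l f)"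
  unfolding smooth_on_def partials_append by blast

lemma smooth_on_differentiable: "smooth_on U f \<Longrightarrow> u \<in> U \<Longrightarrow> f differentiable (at u)"
  unfolding smooth_on_def by (metis partials.simps(1))

lemma smooth_on_continuous_on: "smooth_on U f \<Longrightarrow> continuous_on U f"
  by (meson continuous_at_imp_continuous_on differentiable_imp_continuous_within smooth_on_differentiable)

section \<open>Loops\<close>

text \<open>Membership in \<open>loops\<close> speaks of all iterates of \<open>Dx\<close>.
  Uniqueness of vector derivatives identifies \<open>Dx f\<close> with the derivative supplied
  inside \<open>S\<close>, so a set of periodic functions closed under differentiation contains all
  these iterates.\<close>

lemma loops_coinduct:
  assumes "f \<in> S"
    and "\<And>f. f \<in> S \<Longrightarrow> (\<forall>x. f (x + 1) = f x) \<and> (\<exists>f'\<in>S. \<forall>x. (f has_vector_derivative f' x) (at x))"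
  shows "f \<in> loops"
proof -
  have step: "Dx f \<in> S \<and> (\<forall>x. f differentiable (at x))" if f: "f \<in> S" for f
  proof -
    obtain f' where f': "f' \<in> S" "\<forall>x. (f has_vector_derivative f' x) (at x)"
      using assms(2)[OF f] by blast
    then have "Dx f = f'" by (auto simp: Dx_def vector_derivative_at)
    with f' show ?thesis
      using differentiableI_vector by blast
  qed
  have "(Dx ^^ k) f \<in> S" for k
    using assms(1) step by (induction k) auto
  then show ?thesis using step assms unfolding loops_def by blast
qed

lemma loops_has_vector_derivative:
  assumes "f \<in> loops" shows "(f has_vector_derivative Dx f x) (at x)"
proof -
  have "(Dx ^^ 0) f differentiable (at x)" using assms unfolding loops_def by blast
  then show ?thesis by (simp add: Dx_def vector_derivative_works)
qed

lemma loops_periodic: "f \<in> loops \<Longrightarrow> f (x + 1) = f x"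
  by (simp add: loops_def)

lemma Dx_loops: 
  assumes "f \<in> loops" shows "Dx f \<in> loops"
proof -
  have "Dx f (x + 1) = Dx f x" for x
  proof -
    have 1: "(f has_vector_derivative Dx f (x + 1)) (at (x + 1))"
      by (rule loops_has_vector_derivative[OF assms])
    have 2: "((\<lambda>x. x + 1) has_vector_derivative 1) (at x)"
      by (auto intro!: derivative_eq_intros)
    have "(f \<circ> (\<lambda>x. x + 1) has_vector_derivative 1 *\<^sub>R Dx f (x + 1)) (at x)"
      using 1 by (intro vector_diff_chain_at 2) simp
    moreover have "f \<circ> (\<lambda>x. x + 1) = f" using loops_periodic[OF assms] by auto
    ultimately show ?thesis
      using vector_derivative_at by (fastforce simp: Dx_def)
  qed
  moreover have "(Dx ^^ k) (Dx f) differentiable (at x)" for k x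
    using assms unfolding loops_def by (metis (mono_tags, lifting) funpow_Suc_right o_apply mem_Collect_eq)
  ultimately show ?thesis by (simp add: loops_def)
qed

lemma Dx_eqI: "(\<And>x. (f has_vector_derivative f' x) (at x)) \<Longrightarrow> Dx f = f'"
  by (auto simp: Dx_def vector_derivative_at)

lemma loops_real_derivative:
  fixes f :: "real \<Rightarrow> real"
  shows "f \<in> loops \<Longrightarrow> (f has_real_derivative Dx f x) (at x)"
  using loops_has_vector_derivative by (simp add: has_real_derivative_iff_has_vector_derivative)

lemma loops_linear:
  assumes "bounded_linear L" "f \<in> loops"
  shows "(\<lambda>x. L (f x)) \<in> loops" and "Dx (\<lambda>x. L (f x)) = (\<lambda>x. L (Dx f x))"
proof -
  show "(\<lambda>x. L (f x)) \<in> loops"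
  proof (rule loops_coinduct[where S="{\<lambda>x. L (f x) |f. f \<in> loops}"])
    show "(\<lambda>x. L (f x)) \<in> {\<lambda>x. L (f x) |f. f \<in> loops}" using assms(2) by blast
  next
    fix h assume "h \<in> {\<lambda>x. L (f x) |f. f \<in> loops}"
    then obtain f where h: "h = (\<lambda>x. L (f x))" and f: "f \<in> loops" by blast
    show "(\<forall>x. h (x + 1) = h x) \<and>
      (\<exists>f'\<in>{\<lambda>x. L (f x) |f. f \<in> loops}. \<forall>x. (h has_vector_derivative f' x) (at x))"
      unfolding h
      by (safe; force simp: loops_periodic[OF f]
            intro!: bexI[of _ "\<lambda>x. L (Dx f x)"] bounded_linear.has_vector_derivative[OF assms(1)]
               loops_has_vector_derivative[OF f] Dx_loops[OF f])
  qed
  show "Dx (\<lambda>x. L (f x)) = (\<lambda>x. L (Dx f x))"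
    by (intro Dx_eqI bounded_linear.has_vector_derivative[OF assms(1)]
               loops_has_vector_derivative[OF assms(2)])
qed

lemma fields_loops: "u \<in> fields U \<Longrightarrow> u \<in> loops"
  and fields_mem: "u \<in> fields U \<Longrightarrow> u x \<in> U"
  by (auto simp: fields_def)

lemma Dx_component: "u \<in> loops \<Longrightarrow> Dx (\<lambda>x. u x $ k) = (\<lambda>x. Dx u x $ k)"
  by (rule loops_linear(2)[OF bounded_linear_vec_nth])

lemma has_real_derivative_compose_field:
  fixes f :: "real^'n \<Rightarrow> real"
  assumes "f differentiable (at (u x))" "(u has_vector_derivative u') (at x)"
  shows "((\<lambda>x. f (u x)) has_real_derivative (\<Sum>k\<in>UNIV. partial k f (u x) * u' $ k)) (at x)"
proof -
  have "((\<lambda>x. f (u x)) has_derivative (\<lambda>h. \<Sum>k\<in>UNIV. partial k f (u x) * (h *\<^sub>R u') $ k)) (at x)"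
    using has_derivative_compose[OF assms(2)[unfolded has_vector_derivative_def] partial_has_derivative[OF assms(1)]]
    by simp
  then show ?thesis
    unfolding has_field_derivative_def
    by (rule has_derivative_eq_rhs) (auto simp: sum_distrib_left mult_ac)
qed

section \<open>Closure of loops under sums, products and smooth composition\<close>

inductive_set loop_exprs :: "(real^'n) set \<Rightarrow> (real \<Rightarrow> real^'n) \<Rightarrow> (real \<Rightarrow> real) set" for U u where
  base: "f \<in> loops \<Longrightarrow> f \<in> loop_exprs U u"
| comp: "smooth_on U f \<Longrightarrow> (\<lambda>x. f (u x)) \<in> loop_exprs U u"
| add: "f \<in> loop_exprs U u \<Longrightarrow> g \<in> loop_exprs U u \<Longrightarrow> (\<lambda>x. f x + g x) \<in> loop_exprs U u"
| mult: "f \<in> loop_exprs U u \<Longrightarrow> g \<in> loop_exprs U u \<Longrightarrow> (\<lambda>x. f x * g x) \<in> loop_exprs U u"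

lemma loops_const [simp]: "(\<lambda>x. c) \<in> loops"
  by (rule loops_coinduct[where S="range (\<lambda>c x. c)"]) (auto intro!: exI[of _ 0])

lemma loop_exprs_sum:
  "finite I \<Longrightarrow> (\<And>i. i \<in> I \<Longrightarrow> f i \<in> loop_exprs U u) \<Longrightarrow> (\<lambda>x. \<Sum>i\<in>I. f i x) \<in> loop_exprs U u"
  by (induction I rule: finite_induct) (auto intro: loop_exprs.intros)

text \<open>These expressions are closed under differentiation: the chain rule turns a composition
  into a sum of products with components of \<open>Dx u\<close>, and the product rule stays inside
  the set. Coinduction then shows all of them to be loops at once; products alone would not be
  closed.\<close>

lemma loop_exprs_loops:
  assumes u: "u \<in> fields U" and f: "f \<in> loop_exprs U u"
  shows "f \<in> loops"
proof (rule loops_coinduct[OF f])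
  fix f assume "f \<in> loop_exprs U u"
  then show "(\<forall>x. f (x + 1) = f x) \<and> (\<exists>f'\<in>loop_exprs U u. \<forall>x. (f has_vector_derivative f' x) (at x))"
  proof induction
    case (base f)
    then show ?case by (meson loops_periodic loops_has_vector_derivative Dx_loops loop_exprs.base)
  next
    case (comp f)
    have "(\<lambda>x. \<Sum>k\<in>UNIV. partial k f (u x) * Dx u x $ k) \<in> loop_exprs U u"
      by (intro loop_exprs_sum finite loop_exprs.mult loop_exprs.comp smooth_on_partial comp
            loop_exprs.base loops_linear(1)[OF bounded_linear_vec_nth] Dx_loops fields_loops[OF u])
    moreover have "((\<lambda>x. f (u x)) has_vector_derivative (\<Sum>k\<in>UNIV. partial k f (u x) * Dx u x $ k)) (at x)" for x
      unfolding has_real_derivative_iff_has_vector_derivative[symmetric]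
      by (intro has_real_derivative_compose_field smooth_on_differentiable[OF comp] fields_mem[OF u]
            loops_has_vector_derivative fields_loops[OF u])
    ultimately show ?case by (intro conjI allI bexI[where x="\<lambda>x. \<Sum>k\<in>UNIV. partial k f (u x) * Dx u x $ k"])
        (simp_all add: loops_periodic[OF fields_loops[OF u]])
  next
    case (add f g)
    then obtain f' g' where fg: "f' \<in> loop_exprs U u" "g' \<in> loop_exprs U u"
        "\<And>x. (f has_vector_derivative f' x) (at x)" "\<And>x. (g has_vector_derivative g' x) (at x)"
      by blast
    show ?case
      using add.IH fg by (auto intro!: bexI[of _ "\<lambda>x. f' x + g' x"] has_vector_derivative_add loop_exprs.add)
  next
    case (mult f g)
    then obtain f' g' where fg: "f' \<in> loop_exprs U u" "g' \<in> loop_exprs U u"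
        "\<And>x. (f has_vector_derivative f' x) (at x)" "\<And>x. (g has_vector_derivative g' x) (at x)"
      by blast
    show ?case
      using mult fg
      by (auto intro!: bexI[of _ "\<lambda>x. f x * g' x + f' x * g x"] has_vector_derivative_mult
          loop_exprs.add loop_exprs.mult)
  qed
qed

lemma loops_smooth_comp:
  "u \<in> fields U \<Longrightarrow> smooth_on U f \<Longrightarrow> (\<lambda>x. f (u x)) \<in> loops"
  by (rule loop_exprs_loops[OF _ loop_exprs.comp])

lemma Dx_smooth_comp:
  assumes "u \<in> fields U" "smooth_on U f"
  shows "Dx (\<lambda>x. f (u x)) = (\<lambda>x. \<Sum>k\<in>UNIV. partial k f (u x) * Dx u x $ k)"
  by (intro Dx_eqI, unfold has_real_derivative_iff_has_vector_derivative[symmetric])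
    (intro has_real_derivative_compose_field smooth_on_differentiable[OF assms(2)] fields_mem[OF assms(1)]
            loops_has_vector_derivative fields_loops[OF assms(1)])

text \<open>A dummy field, so that sums and products of scalar loops are also covered by
  \<open>loop_exprs\<close>.\<close>

lemma zero_fields_UNIV: "(\<lambda>x. 0) \<in> fields UNIV"
  by (simp add: fields_def)

context
  fixes f g :: "real \<Rightarrow> real"
  assumes f: "f \<in> loops" and g: "g \<in> loops"
begin

lemma loops_add: "(\<lambda>x. f x + g x) \<in> loops"
  and loops_mult: "(\<lambda>x. f x * g x) \<in> loops"
  by (rule loop_exprs_loops[OF zero_fields_UNIV], intro loop_exprs.add loop_exprs.mult loop_exprs.base f g)+

lemma Dx_add: "Dx (\<lambda>x. f x + g x) = (\<lambda>x. Dx f x + Dx g x)"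
  by (intro Dx_eqI has_vector_derivative_add loops_has_vector_derivative f g)

lemma Dx_diff: "Dx (\<lambda>x. f x - g x) = (\<lambda>x. Dx f x - Dx g x)"
  by (intro Dx_eqI has_vector_derivative_diff loops_has_vector_derivative f g)

lemma Dx_mult: "Dx (\<lambda>x. f x * g x) = (\<lambda>x. Dx f x * g x + f x * Dx g x)"
  using has_vector_derivative_mult[OF loops_has_vector_derivative[OF f] loops_has_vector_derivative[OF g]]
  by (intro Dx_eqI) (simp add: add.commute)

end

lemma loops_minus: "(f :: real \<Rightarrow> real) \<in> loops \<Longrightarrow> (\<lambda>x. - f x) \<in> loops"
  using loops_mult[OF loops_const[of "- 1"]] by simp

lemma loops_diff: "(f :: real \<Rightarrow> real) \<in> loops \<Longrightarrow> g \<in> loops \<Longrightarrow> (\<lambda>x. f x - g x) \<in> loops"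
  using loops_add[OF _ loops_minus] by simp

lemma loops_sum: 
  "finite I \<Longrightarrow> (\<And>i. i \<in> I \<Longrightarrow> (f i :: real \<Rightarrow> real) \<in> loops) \<Longrightarrow> (\<lambda>x. \<Sum>i\<in>I. f i x) \<in> loops"
  by (induction I rule: finite_induct) (auto intro: loops_add)

lemma loops_component: "u \<in> loops \<Longrightarrow> (\<lambda>x. u x $ k) \<in> loops"
  by (rule loops_linear[OF bounded_linear_vec_nth])

lemma loops_scaleR_const: "f \<in> loops \<Longrightarrow> (\<lambda>x. f x *\<^sub>R v) \<in> loops"
  and Dx_scaleR_const: "f \<in> loops \<Longrightarrow> Dx (\<lambda>x. f x *\<^sub>R v) = (\<lambda>x. Dx f x *\<^sub>R v)"
  by (rule loops_linear[OF bounded_linear_scaleR_left]; assumption)+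

lemmas loops_intros = loops_const loops_add loops_mult loops_minus loops_diff loops_sum loops_component
  Dx_loops finite

lemma vec_has_vector_derivative:
  fixes f :: "real \<Rightarrow> real^'n"
  assumes "\<And>i. ((\<lambda>x. f x $ i) has_vector_derivative f' $ i) (at x)"
  shows "(f has_vector_derivative f') (at x)"
proof -
  have "((\<lambda>x. \<Sum>i\<in>UNIV. (f x $ i) *\<^sub>R (axis i 1 :: real^'n)) has_vector_derivative
      (\<Sum>i\<in>UNIV. (f' $ i) *\<^sub>R (axis i 1 :: real^'n))) (at x)"
    by (intro has_vector_derivative_sum bounded_linear.has_vector_derivative[OF bounded_linear_scaleR_left] assms)
  then show ?thesis
    by (simp add: basis_expansion flip: scalar_mult_eq_scaleR)
qed

lemma loops_vecI:
  fixes f :: "real \<Rightarrow> real^'n"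
  assumes "\<And>i. (\<lambda>x. f x $ i) \<in> loops"
  shows "f \<in> loops"
proof (rule loops_coinduct[where S="{f. \<forall>i. (\<lambda>x. f x $ i) \<in> loops}"])
  show "f \<in> {f. \<forall>i. (\<lambda>x. f x $ i) \<in> loops}" using assms by blast
next
  fix f :: "real \<Rightarrow> real^'n" assume "f \<in> {f. \<forall>i. (\<lambda>x. f x $ i) \<in> loops}"
  then have f: "\<And>i. (\<lambda>x. f x $ i) \<in> loops" by blast
  have "\<forall>x. f (x + 1) = f x"
    using loops_periodic[OF f] by (simp add: vec_eq_iff)
  moreover have "\<forall>x. (f has_vector_derivative (\<chi> i. Dx (\<lambda>x. f x $ i) x)) (at x)"
    by (intro allI vec_has_vector_derivative) (simp add: loops_has_vector_derivative[OF f])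
  moreover have "(\<lambda>x. (\<chi> i. Dx (\<lambda>x. f x $ i) x)) \<in> {f. \<forall>i. (\<lambda>x. f x $ i) \<in> loops}"
    by (simp add: Dx_loops f)
  ultimately show "(\<forall>x. f (x + 1) = f x) \<and>
    (\<exists>f'\<in>{f. \<forall>i. (\<lambda>x. f x $ i) \<in> loops}. \<forall>x. (f has_vector_derivative f' x) (at x))"
    by (rule conjI[OF _ bexI])
qed

lemma loops_vec_add: "(u :: real \<Rightarrow> real^'n) \<in> loops \<Longrightarrow> v \<in> loops \<Longrightarrow> (\<lambda>x. u x + v x) \<in> loops"
  by (rule loops_vecI) (auto intro!: loops_intros)

lemma loops_vec_scaleR: "(u :: real \<Rightarrow> real^'n) \<in> loops \<Longrightarrow> (\<lambda>x. c *\<^sub>R u x) \<in> loops"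
  by (rule loops_linear[OF bounded_linear_scaleR_right])

lemma loops_inner: "(u :: real \<Rightarrow> real^'n) \<in> loops \<Longrightarrow> v \<in> loops \<Longrightarrow> (\<lambda>x. u x \<bullet> v x) \<in> loops"
  unfolding inner_vec_def inner_real_def by (intro loops_intros)

section \<open>Integration over one period\<close>

lemma loops_continuous: "f \<in> loops \<Longrightarrow> continuous_on S f"
  by (meson continuous_at_imp_continuous_on loops_has_vector_derivative has_vector_derivative_continuous)

lemma loops_integrable: "(f :: real \<Rightarrow> real) \<in> loops \<Longrightarrow> f integrable_on {0..1}"
  by (intro integrable_continuous_interval loops_continuous)

lemma loops_int_shift:
  assumes "f \<in> loops" shows "f (x + of_int k :: real) = f x"
proof (induction k rule: int_induct[where k=0])
  case (step1 i)
  then show ?case using loops_periodic[OF assms, of "x + of_int i"] by (simp add: algebra_simps)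
next
  case (step2 i)
  then show ?case using loops_periodic[OF assms, of "x + of_int (i - 1)"] by (simp add: algebra_simps)
qed simp

lemma loops_frac: "f \<in> loops \<Longrightarrow> f (frac x) = f x"
  using loops_int_shift[of f "frac x" "\<lfloor>x\<rfloor>"] by (simp add: frac_def)

lemma loops_eqI:
  assumes "f \<in> loops" "g \<in> loops" "\<And>x. x \<in> {0..1} \<Longrightarrow> f x = g x"
  shows "f = g"
proof
  fix x :: real
  have "frac x \<in> {0..1}" by (simp add: less_imp_le frac_lt_1)
  then show "f x = g x" using assms(3)[of "frac x"] by (simp only: loops_frac[OF assms(1)] loops_frac[OF assms(2)])
qed

lemma integral_Dx:
  fixes f :: "real \<Rightarrow> real"
  assumes "f \<in> loops" shows "integral {0..1} (Dx f) = 0"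
proof -
  have "(Dx f has_integral (f 1 - f 0)) {0..1}"
    by (rule fundamental_theorem_of_calculus)
      (auto intro: has_vector_derivative_at_within loops_has_vector_derivative[OF assms])
  moreover have "f 1 = f 0" using loops_periodic[OF assms, of 0] by simp
  ultimately show ?thesis by (simp add: integral_unique)
qed

lemma integral_by_parts:
  fixes f :: "real \<Rightarrow> real"
  assumes "f \<in> loops" "g \<in> loops"
  shows "integral {0..1} (\<lambda>x. f x * Dx g x) = - integral {0..1} (\<lambda>x. Dx f x * g x)"
proof -
  have "0 = integral {0..1} (\<lambda>x. Dx f x * g x + f x * Dx g x)"
    using integral_Dx[OF loops_mult[OF assms]] by (simp add: Dx_mult[OF assms])
  also have "\<dots> = integral {0..1} (\<lambda>x. Dx f x * g x) + integral {0..1} (\<lambda>x. f x * Dx g x)"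
    by (intro integral_add loops_integrable loops_intros assms)
  finally show ?thesis by simp
qed

lemma nonneg_loop_integral_zero:
  fixes f :: "real \<Rightarrow> real"
  assumes f: "f \<in> loops" and "\<And>x. f x \<ge> 0" "integral {0..1} f = 0"
  shows "f = (\<lambda>x. 0)"
proof (rule loops_eqI[OF f loops_const])
  fix x :: real assume x: "x \<in> {0..1}"
  have "\<forall>x\<in>{0..1}. f x = 0"
    using integral_eq_0_iff[OF loops_continuous[OF f], of 0 1] assms(2,3) by simp
  with x show "f x = 0" by blast
qed

lemma du_Bois_Reymond:
  fixes f :: "real \<Rightarrow> real"
  assumes f: "f \<in> loops" and 0: "\<And>p. p \<in> loops \<Longrightarrow> integral {0..1} (\<lambda>x. Dx p x * f x) = 0"
  shows "f x = f y"
proof -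
  have Df: "Dx f \<in> loops" by (rule Dx_loops[OF f])
  have "integral {0..1} (\<lambda>x. Dx f x * Dx f x) = 0"
    using 0[OF Df] integral_by_parts[OF Df f] by simp
  then have "(\<lambda>x. Dx f x * Dx f x) = (\<lambda>x. 0)"
    by (intro nonneg_loop_integral_zero loops_mult Df) auto
  then have "Dx f x = 0" for x by (metis mult_eq_0_iff)
  then have "\<forall>x. (f has_real_derivative 0) (at x)"
    using loops_real_derivative[OF f] by metis
  then show ?thesis by (rule DERIV_isconst_all)
qed

section \<open>Brackets of linear functionals\<close>

text \<open>Two candidates differ by a loop \<open>d\<close>, which is itself an admissible
  variation. Testing both with \<open>d\<close> makes the integral of \<open>d \<bullet> d\<close>
  vanish, so the definite description in \<open>var_deriv\<close> is resolved.\<close>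

lemma var_deriv_eqI:
  fixes u :: "real \<Rightarrow> real^'n"
  assumes e: "has_var_deriv F u e"
  shows "var_deriv F u = e"
  unfolding var_deriv_def
proof (rule the_equality)
  show "has_var_deriv F u e" by (fact e)
next
  fix e' assume e': "has_var_deriv F u e'"
  define d where "d = (\<lambda>x. e' x + (-1) *\<^sub>R e x)"
  have loops: "e \<in> loops" "e' \<in> loops" using e e' by (auto simp: has_var_deriv_def)
  then have d: "d \<in> loops" unfolding d_def by (intro loops_vec_add loops_vec_scaleR)
  have "integral {0..1} (\<lambda>x. e' x \<bullet> d x) = integral {0..1} (\<lambda>x. e x \<bullet> d x)"
    using e e' d unfolding has_var_deriv_def by (blast intro: DERIV_unique)
  then have "integral {0..1} (\<lambda>x. e' x \<bullet> d x - e x \<bullet> d x) = 0"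
    by (subst integral_diff) (auto intro!: loops_integrable loops_inner loops d)
  then have "integral {0..1} (\<lambda>x. d x \<bullet> d x) = 0"
    by (simp add: d_def inner_diff_left)
  then have "(\<lambda>x. d x \<bullet> d x) = (\<lambda>x. 0)"
    by (intro nonneg_loop_integral_zero loops_inner d) auto
  then have "d x = 0" for x by (metis inner_eq_zero_iff)
  then show "e' = e" by (auto simp: d_def)
qed

section \<open>Linear functionals and their locality\<close>

definition lin_fun :: "(real \<Rightarrow> real^'n) \<Rightarrow> (real \<Rightarrow> real^'n) \<Rightarrow> real" where
  "lin_fun a u = integral {0..1} (\<lambda>x. a x \<bullet> u x)"

lemma var_deriv_lin_fun:
  assumes a: "a \<in> loops" and u: "u \<in> loops"
  shows "var_deriv (lin_fun a) u = a"
proof (rule var_deriv_eqI)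
  have "((\<lambda>\<epsilon>. lin_fun a (\<lambda>x. u x + \<epsilon> *\<^sub>R v x)) has_real_derivative
      integral {0..1} (\<lambda>x. a x \<bullet> v x)) (at 0)" if v: "v \<in> loops" for v
  proof -
    have "lin_fun a (\<lambda>x. u x + \<epsilon> *\<^sub>R v x)
        = integral {0..1} (\<lambda>x. a x \<bullet> u x) + \<epsilon> * integral {0..1} (\<lambda>x. a x \<bullet> v x)" for \<epsilon>
    proof -
      have "integral {0..1} (\<lambda>x. a x \<bullet> u x + \<epsilon> * (a x \<bullet> v x))
          = integral {0..1} (\<lambda>x. a x \<bullet> u x) + integral {0..1} (\<lambda>x. \<epsilon> * (a x \<bullet> v x))"
        by (intro integral_add loops_integrable loops_mult loops_const loops_inner a u v)
      then show ?thesis by (simp add: lin_fun_def inner_add_right)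
    qed
    then show ?thesis by (auto intro!: derivative_eq_intros)
  qed
  then show "has_var_deriv (lin_fun a) u a"
    using a by (auto simp: has_var_deriv_def)
qed

text \<open>A class of densities that contains the integrand of \<open>lin_fun a\<close> and is
  closed under all jet derivatives, so that smoothness can be proved by induction over the list of
  derivatives.\<close>

definition affine_density :: "(real \<Rightarrow> real) \<Rightarrow> (real \<Rightarrow> real^'n) \<Rightarrow> 'n jet \<Rightarrow> real" where
  "affine_density p q z = p (fst z) + q (fst z) \<bullet> snd z 0"

text \<open>Differentiation in \<open>x\<close> differentiates both coefficients, differentiation in
  a component of \<open>w 0\<close> leaves that component of \<open>q\<close> as the constant part,
  and all higher jet coordinates give zero.\<close>

lemma affine_density_shift:
  fixes q :: "real \<Rightarrow> real^'n"
  assumes p: "p \<in> loops" and q: "q \<in> loops"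
  shows "\<exists>p'\<in>loops. \<exists>q'\<in>loops. \<forall>z.
    ((\<lambda>t. affine_density p q (jet_shift a t z)) has_real_derivative affine_density p' q' z) (at 0)"
proof (cases a)
  case Indep
  have "((\<lambda>t. p (x + t) + q (x + t) \<bullet> w) has_real_derivative Dx p x + Dx q x \<bullet> w) (at 0)" for x w
  proof -
    have "((\<lambda>x. p x + q x \<bullet> w) has_vector_derivative Dx p x + Dx q x \<bullet> w) (at x)"
      by (intro has_vector_derivative_add loops_has_vector_derivative p q
          bounded_linear.has_vector_derivative[OF bounded_linear_inner_left])
    then have "((\<lambda>x. p x + q x \<bullet> w) has_real_derivative Dx p x + Dx q x \<bullet> w) (at (0 + x))"
      by (simp add: has_real_derivative_iff_has_vector_derivative)
    then show ?thesis
      by (subst (asm) DERIV_shift) (simp add: add.commute)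
  qed
  then show ?thesis
    using Indep Dx_loops[OF p] Dx_loops[OF q]
    by (intro bexI[of _ "Dx p"] bexI[of _ "Dx q"]) (auto simp: affine_density_def)
next
  case (Dep k i)
  show ?thesis
  proof (cases k)
    case 0
    have "((\<lambda>t. p x + q x \<bullet> (w + t *\<^sub>R axis i 1)) has_real_derivative q x $ i) (at 0)" for x w
      by (simp add: inner_add_right inner_axis) (auto intro!: derivative_eq_intros)
    then show ?thesis
      using Dep 0 q
      by (intro bexI[of _ "\<lambda>x. q x $ i"] bexI[of _ "\<lambda>x. 0"])
        (auto simp: affine_density_def intro: loops_intros)
  next
    case (Suc k)
    then show ?thesis
      using Dep by (intro bexI[of _ "\<lambda>x. 0"]) (auto simp: affine_density_def)
  qed
qed

lemma jet_partials_affine: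
  fixes q :: "real \<Rightarrow> real^'n"
  assumes "p \<in> loops" "q \<in> loops"
  shows "\<exists>p'\<in>loops. \<exists>q'\<in>loops. jet_partials as (affine_density p q) = affine_density p' q'"
proof (induction as)
  case Nil
  then show ?case using assms by auto
next
  case (Cons a as)
  then obtain p' q' where pq: "p' \<in> loops" "q' \<in> loops"
    "jet_partials as (affine_density p q) = affine_density p' q'" by blast
  obtain p'' q'' where "p'' \<in> loops" "q'' \<in> loops"
    "\<forall>z. ((\<lambda>t. affine_density p' q' (jet_shift a t z)) has_real_derivative affine_density p'' q'' z) (at 0)"
    using affine_density_shift[OF pq(1,2)] by blast
  then show ?case using pq(3) by (auto simp: DERIV_imp_deriv intro!: bexI[of _ p''] bexI[of _ q''])
qed

lemma continuous_on_affine_density: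
  fixes q :: "real \<Rightarrow> real^'n"
  assumes "p \<in> loops" "q \<in> loops"
  shows "continuous_on S (affine_density p q)"
proof -
  have "continuous_on S (\<lambda>z::'n jet. snd z 0)"
    by (rule continuous_on_product_then_coordinatewise) (intro continuous_intros)
  then show ?thesis
    unfolding affine_density_def
    by (intro continuous_intros continuous_on_compose2[OF loops_continuous[OF assms(1)]]
          continuous_on_compose2[OF loops_continuous[OF assms(2)]]) auto
qed

lemma local_functional_lin_fun:
  fixes a :: "real \<Rightarrow> real^'n"
  assumes a: "a \<in> loops"
  shows "local_functional U (lin_fun a)"
proof -
  let ?f = "affine_density (\<lambda>x. 0) a"
  have "smooth_density U ?f"
    unfolding smooth_density_def
  proof (intro conjI exI[of _ 0] allI ballI impI)
    fix x :: real and w w' :: "nat \<Rightarrow> real^'n" assume "\<forall>k\<le>0. w k = w' k"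
    then show "?f (x, w) = ?f (x, w')" by (simp add: affine_density_def)
  next
    fix x :: real and w :: "nat \<Rightarrow> real^'n"
    show "?f (x + 1, w) = ?f (x, w)" by (simp add: affine_density_def loops_periodic[OF a])
  next
    fix as :: "'n jet_coord list"
    obtain p q where pq: "p \<in> loops" "q \<in> loops" "jet_partials as ?f = affine_density p q"
      using jet_partials_affine[OF loops_const a] by blast
    show "continuous_on (jet_domain U) (jet_partials as ?f)"
      unfolding pq(3) by (rule continuous_on_affine_density[OF pq(1,2)])
    fix b z
    show "(\<lambda>t. jet_partials as ?f (jet_shift b t z)) field_differentiable (at 0)"
      using affine_density_shift[OF pq(1,2), of b] unfolding pq(3) field_differentiable_def by blast
  qed
  then show ?thesis
    unfolding local_functional_def
    by (intro exI[of _ ?f]) (auto simp: lin_fun_def affine_density_def jet_of_def)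
qed

text \<open>The image of one period is compact in the open set \<open>U\<close>, hence has a uniform
  margin \<open>e\<close>, and \<open>v\<close> is bounded by some \<open>M\<close> on one period.
  Periodicity carries the bound \<open>e / M\<close> for \<epsilon> over to the whole line.\<close>

lemma fields_perturb:
  fixes u v :: "real \<Rightarrow> real^'n"
  assumes U: "open U" and u: "u \<in> fields U" and v: "v \<in> loops"
  obtains \<delta> where "\<delta> > 0" "\<And>\<epsilon>. \<bar>\<epsilon>\<bar> < \<delta> \<Longrightarrow> (\<lambda>x. u x + \<epsilon> *\<^sub>R v x) \<in> fields U"
proof -
  have ul: "u \<in> loops" by (rule fields_loops[OF u])
  have "compact (u ` {0..1})" "u ` {0..1} \<subseteq> U"
    using fields_mem[OF u] by (auto intro!: compact_continuous_image loops_continuous[OF ul])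
  then obtain e where e: "e > 0" "(\<Union>x\<in>u ` {0..1}. ball x e) \<subseteq> U"
    using compact_subset_open_imp_ball_epsilon_subset[OF _ U] by blast
  have "bounded (v ` {0..1})"
    by (intro compact_imp_bounded compact_continuous_image loops_continuous[OF v]) simp
  then obtain M where M: "M > 0" "\<And>x. x \<in> {0..1} \<Longrightarrow> norm (v x) \<le> M"
    unfolding bounded_pos by auto
  have "(\<lambda>x. u x + \<epsilon> *\<^sub>R v x) \<in> fields U" if "\<bar>\<epsilon>\<bar> < e / M" for \<epsilon>
  proof -
    have l: "(\<lambda>x. u x + \<epsilon> *\<^sub>R v x) \<in> loops"
      by (intro loops_vec_add loops_vec_scaleR ul v)
    have "u x + \<epsilon> *\<^sub>R v x \<in> U" for x
    proof -
      have fr: "frac x \<in> {0..1}" by (simp add: less_imp_le frac_lt_1)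
      have "\<bar>\<epsilon>\<bar> * norm (v (frac x)) \<le> \<bar>\<epsilon>\<bar> * M" using M(2)[OF fr] by (simp add: mult_left_mono)
      also have "\<dots> < e" using that M(1) by (simp add: field_simps)
      finally have "u (frac x) + \<epsilon> *\<^sub>R v (frac x) \<in> ball (u (frac x)) e"
        by (simp add: dist_norm)
      then have "u (frac x) + \<epsilon> *\<^sub>R v (frac x) \<in> U" using e(2) fr by blast
      then show ?thesis by (simp only: loops_frac[OF ul] loops_frac[OF v])
    qed
    then show ?thesis using l by (auto simp: fields_def)
  qed
  then show ?thesis using that[of "e / M"] e(1) M(1) by simp
qed

lemma loops_continuous_on_snd:
  assumes "h \<in> loops"
  shows "continuous_on S (\<lambda>z::'a::topological_space \<times> real. h (snd z))"
  by (rule continuous_on_compose2[OF loops_continuous[OF assms, of UNIV]])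
    (intro continuous_intros subset_UNIV)+

text \<open>Differentiation under the integral sign, on an interval of parameters for which the
  varied curve stays in \<open>U\<close>. The shape of the integrand covers both terms of a bracket:
  \<open>r = 1\<close>, \<open>s = 0\<close> for the metric term, and components of
  \<open>Dx u\<close> and \<open>Dx v\<close> for the term with the velocity.\<close>

lemma integral_field_derivative:
  fixes u v :: "real \<Rightarrow> real^'n"
  assumes U: "open U" and f: "smooth_on U f" and u: "u \<in> fields U" and v: "v \<in> loops"
    and A: "A \<in> loops" and r: "r \<in> loops" and s: "s \<in> loops"
  shows "((\<lambda>\<epsilon>. integral {0..1} (\<lambda>x. A x * f (u x + \<epsilon> *\<^sub>R v x) * (r x + \<epsilon> * s x)))
    has_real_derivative
      integral {0..1} (\<lambda>x. A x * ((\<Sum>l\<in>UNIV. partial l f (u x) * v x $ l) * r x + f (u x) * s x))) (at 0)"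
proof -
  obtain \<delta> where \<delta>: "\<delta> > 0" "\<And>\<epsilon>. \<bar>\<epsilon>\<bar> < \<delta> \<Longrightarrow> (\<lambda>x. u x + \<epsilon> *\<^sub>R v x) \<in> fields U"
    using fields_perturb[OF U u v] by blast
  define F where "F = (\<lambda>\<epsilon> x. A x * f (u x + \<epsilon> *\<^sub>R v x) * (r x + \<epsilon> * s x))"
  define F' where "F' = (\<lambda>\<epsilon> x. A x * ((\<Sum>l\<in>UNIV. partial l f (u x + \<epsilon> *\<^sub>R v x) * v x $ l) * (r x + \<epsilon> * s x)
      + f (u x + \<epsilon> *\<^sub>R v x) * s x))"
  define J where "J = {-\<delta><..<\<delta>}"
  have mem: "u x + \<epsilon> *\<^sub>R v x \<in> U" if "\<epsilon> \<in> J" for \<epsilon> x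
    using \<delta>(2)[of \<epsilon>] that fields_mem by (fastforce simp: J_def)
  have "((\<lambda>\<epsilon>. integral (cbox 0 1) (F \<epsilon>)) has_field_derivative integral (cbox 0 1) (F' 0)) (at 0 within J)"
  proof (rule leibniz_rule_field_derivative)
    show "((\<lambda>\<epsilon>. F \<epsilon> x) has_field_derivative F' \<epsilon> x) (at \<epsilon> within J)"
      if "\<epsilon> \<in> J" for \<epsilon> x
    proof -
      have "((\<lambda>\<epsilon>. f (u x + \<epsilon> *\<^sub>R v x)) has_real_derivative
          (\<Sum>l\<in>UNIV. partial l f (u x + \<epsilon> *\<^sub>R v x) * v x $ l)) (at \<epsilon>)"
        by (rule has_real_derivative_compose_field[where u="\<lambda>\<epsilon>. u x + \<epsilon> *\<^sub>R v x"])
          (auto intro!: derivative_eq_intros smooth_on_differentiable[OF f mem[OF that]])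
      then have "((\<lambda>\<epsilon>. F \<epsilon> x) has_field_derivative F' \<epsilon> x) (at \<epsilon>)"
        unfolding F_def F'_def
        by (auto intro!: derivative_eq_intros simp: algebra_simps)
      then show ?thesis by (rule has_field_derivative_at_within)
    qed
    show "F \<epsilon> integrable_on cbox 0 1" if "\<epsilon> \<in> J" for \<epsilon>
    proof -
      have "\<bar>\<epsilon>\<bar> < \<delta>" using that by (auto simp: J_def)
      then have "F \<epsilon> \<in> loops"
        unfolding F_def
        by (intro loops_mult loops_add loops_const loops_smooth_comp[OF \<delta>(2) f] A r s)
      then show ?thesis using loops_integrable by simp
    qed
    have cont: "continuous_on (J \<times> cbox 0 1) (\<lambda>(\<epsilon>, x). h (u x + \<epsilon> *\<^sub>R v x))" if h: "smooth_on U h" for h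
      unfolding case_prod_unfold
      by (rule continuous_on_compose2[OF smooth_on_continuous_on[OF h]])
        (use mem in \<open>auto intro!: continuous_intros loops_continuous_on_snd fields_loops[OF u] v\<close>)
    show "continuous_on (J \<times> cbox 0 1) (\<lambda>(\<epsilon>, x). F' \<epsilon> x)"
      using cont[OF f] cont[OF smooth_on_partial[OF f]] loops_continuous_on_snd[OF A] loops_continuous_on_snd[OF r] loops_continuous_on_snd[OF s] loops_continuous_on_snd[OF v]
      unfolding F'_def case_prod_unfold by (intro continuous_intros)
    show "0 \<in> J" "convex J" using \<delta>(1) by (auto simp: J_def)
  qed
  moreover have "at 0 within J = at 0" 
    by (rule at_within_open) (use \<delta>(1) in \<open>auto simp: J_def\<close>)
  ultimately show ?thesis unfolding F_def F'_def by simp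
qed

section \<open>Brackets of linear functionals with a single component\<close>

locale hamiltonian_operator =
  fixes U :: "(real^'n) set"
    and gu :: "real^'n \<Rightarrow> real^'n^'n"
    and cu :: "real^'n \<Rightarrow> 'n \<Rightarrow> 'n \<Rightarrow> 'n \<Rightarrow> real"
  assumes nondegenerate: "nondegenerate_hamiltonian U gu cu"
begin

definition G :: "'n \<Rightarrow> 'n \<Rightarrow> real^'n \<Rightarrow> real" where "G i j u = gu u $ i $ j"
definition C :: "'n \<Rightarrow> 'n \<Rightarrow> 'n \<Rightarrow> real^'n \<Rightarrow> real" where "C i j k u = cu u i j k"

lemma open_U: "open U"
  and smooth_G: "smooth_on U (G i j)"
  and smooth_C: "smooth_on U (C i j k)"
  and det_gu: "u \<in> U \<Longrightarrow> det (gu u) \<noteq> 0"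
  using nondegenerate by (auto simp: nondegenerate_hamiltonian_def G_def[abs_def] C_def[abs_def])

lemma G_sym: "u \<in> U \<Longrightarrow> G i j u = G j i u"
  using nondegenerate unfolding nondegenerate_hamiltonian_def G_def transpose_def
  by (metis (no_types, lifting) vec_lambda_beta)

lemma ham_skew:
  "local_functional U F \<Longrightarrow> local_functional U H \<Longrightarrow> u \<in> fields U \<Longrightarrow>
    bracket gu cu F H u = - bracket gu cu H F u"
  and ham_jacobi:
  "local_functional U F \<Longrightarrow> local_functional U H \<Longrightarrow> local_functional U K \<Longrightarrow> u \<in> fields U \<Longrightarrow>
    bracket gu cu (bracket gu cu F H) K u
           + bracket gu cu (bracket gu cu H K) F u
           + bracket gu cu (bracket gu cu K F) H u = 0"
  using nondegenerate unfolding nondegenerate_hamiltonian_def hamiltonian_def by blast+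

abbreviation single :: "(real \<Rightarrow> real) \<Rightarrow> 'n \<Rightarrow> real \<Rightarrow> real^'n" where
  "single p i \<equiv> (\<lambda>x. p x *\<^sub>R axis i 1)"

text \<open>The \<open>i\<close>-th component of the expression under the outer derivative of the
  operator, when the operator is applied to a covector whose only component is \<open>q\<close> in
  place \<open>j\<close>.\<close>

definition flux :: "'n \<Rightarrow> 'n \<Rightarrow> (real \<Rightarrow> real) \<Rightarrow> (real \<Rightarrow> real^'n) \<Rightarrow> real \<Rightarrow> real" where
  "flux i j q u = (\<lambda>x. G i j (u x) * Dx (Dx q) x + (\<Sum>k\<in>UNIV. C i j k (u x) * Dx u x $ k) * Dx q x)"

lemmas loops_G = loops_smooth_comp[OF _ smooth_G]
  and loops_C = loops_smooth_comp[OF _ smooth_C]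
  and loops_DG = loops_smooth_comp[OF _ smooth_on_partial[OF smooth_G]]
  and loops_DC = loops_smooth_comp[OF _ smooth_on_partial[OF smooth_C]]

lemma flux_loops: "u \<in> fields U \<Longrightarrow> q \<in> loops \<Longrightarrow> flux i j q u \<in> loops"
  unfolding flux_def by (intro loops_intros loops_G loops_C fields_loops)

lemma P_op_single:
  assumes u: "u \<in> fields U" and q: "q \<in> loops"
  shows "P_op gu cu u (single q j) x $ i = Dx (flux i j q u) x"
proof -
  have D: "Dx (single q j) = single (Dx q) j" "Dx (single (Dx q) j) = single (Dx (Dx q)) j"
    by (intro Dx_scaleR_const q Dx_loops)+
  have "(\<lambda>x. \<chi> i. \<Sum>j'\<in>UNIV. gu (u x) $ i $ j' * (Dx (Dx (single q j)) x $ j')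
     + (\<Sum>k\<in>UNIV. cu (u x) i j' k * (Dx u x $ k)) * (Dx (single q j) x $ j'))
     = (\<lambda>x. \<chi> i. flux i j q u x)"
    unfolding D
    by (auto simp: fun_eq_iff vec_eq_iff flux_def G_def C_def sum.distrib axis_def if_distrib cong: if_cong)
  then have P: "P_op gu cu u (single q j) = Dx (\<lambda>x. \<chi> i. flux i j q u x)"
    unfolding P_op_def by simp
  have "(\<lambda>x. \<chi> i. flux i j q u x) \<in> loops"
    by (rule loops_vecI) (simp add: flux_loops[OF u q] eta_contract_eq)
  from fun_cong[OF Dx_component[OF this, of i], of x] show ?thesis
    unfolding P by simp
qed

lemma bracket_single:
  assumes u: "u \<in> fields U" and q: "q \<in> loops" and e: "var_deriv F u = e" "e \<in> loops"
  shows "bracket gu cu F (lin_fun (single q j)) u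
    = (\<Sum>i\<in>UNIV. integral {0..1} (\<lambda>x. e x $ i * Dx (flux i j q u) x))"
proof -
  have "var_deriv (lin_fun (single q j)) u = single q j"
    by (intro var_deriv_lin_fun loops_scaleR_const q fields_loops[OF u])
  then have "bracket gu cu F (lin_fun (single q j)) u
      = integral {0..1} (\<lambda>x. \<Sum>i\<in>UNIV. e x $ i * Dx (flux i j q u) x)"
    by (simp add: bracket_def e inner_vec_def P_op_single[OF u q])
  also have "\<dots> = (\<Sum>i\<in>UNIV. integral {0..1} (\<lambda>x. e x $ i * Dx (flux i j q u) x))"
    by (intro integral_sum finite loops_integrable loops_intros flux_loops u q e)
  finally show ?thesis .
qed

lemma bracket_single_single:
  assumes u: "u \<in> fields U" and p: "p \<in> loops" and q: "q \<in> loops"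
  shows "bracket gu cu (lin_fun (single p i)) (lin_fun (single q j)) u
    = - integral {0..1} (\<lambda>x. Dx p x * flux i j q u x)"
proof -
  have "bracket gu cu (lin_fun (single p i)) (lin_fun (single q j)) u
      = (\<Sum>k\<in>UNIV. integral {0..1} (\<lambda>x. single p i x $ k * Dx (flux k j q u) x))"
    by (intro bracket_single u q var_deriv_lin_fun loops_scaleR_const p fields_loops[OF u])
  also have "\<dots> = (\<Sum>k\<in>UNIV. if k = i then integral {0..1} (\<lambda>x. p x * Dx (flux k j q u) x) else 0)"
    by (rule sum.cong) (auto simp: axis_def)
  also have "\<dots> = integral {0..1} (\<lambda>x. p x * Dx (flux i j q u) x)" by simp
  finally show ?thesis using integral_by_parts[OF p flux_loops[OF u q]] by simp
qed

lemma flux_skew: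
  assumes "u \<in> fields U" "p \<in> loops" "q \<in> loops"
  shows "integral {0..1} (\<lambda>x. Dx p x * flux i j q u x) = - integral {0..1} (\<lambda>x. Dx q x * flux j i p u x)"
  using ham_skew[OF local_functional_lin_fun local_functional_lin_fun assms(1), of "single p i" "single q j"]
  by (simp add: bracket_single_single assms loops_scaleR_const)

text \<open>The Euler operator applied to the density \<open>- Dx p x * flux i j q u x\<close>: the
  derivative with respect to the field enters directly, the one with respect to the velocity under a
  further \<open>Dx\<close> with the opposite sign.\<close>

definition var_bracket :: "'n \<Rightarrow> 'n \<Rightarrow> (real \<Rightarrow> real) \<Rightarrow> (real \<Rightarrow> real) \<Rightarrow> (real \<Rightarrow> real^'n) \<Rightarrow> 'n \<Rightarrow> real \<Rightarrow> real" where
  "var_bracket i j p q u l = (\<lambda>x. Dx (\<lambda>x. Dx p x * Dx q x * C i j l (u x)) x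
     - (Dx p x * Dx (Dx q) x * partial l (G i j) (u x)
        + (\<Sum>k\<in>UNIV. Dx p x * Dx q x * partial l (C i j k) (u x) * Dx u x $ k)))"

lemma var_bracket_loops:
  "u \<in> fields U \<Longrightarrow> p \<in> loops \<Longrightarrow> q \<in> loops \<Longrightarrow> var_bracket i j p q u l \<in> loops"
  unfolding var_bracket_def by (intro loops_intros loops_C loops_DG loops_DC fields_loops)

lemma var_deriv_bracket:
  assumes u: "u \<in> fields U" and p: "p \<in> loops" and q: "q \<in> loops"
  shows "var_deriv (bracket gu cu (lin_fun (single p i)) (lin_fun (single q j))) u
    = (\<lambda>x. \<chi> l. var_bracket i j p q u l x)" (is "var_deriv ?K u = ?e")
proof (rule var_deriv_eqI)
  have ul: "u \<in> loops" by (rule fields_loops[OF u])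
  have e: "?e \<in> loops" by (rule loops_vecI) (simp add: var_bracket_loops[OF u p q] eta_contract_eq)
  have "((\<lambda>\<epsilon>. ?K (\<lambda>x. u x + \<epsilon> *\<^sub>R v x)) has_real_derivative integral {0..1} (\<lambda>x. ?e x \<bullet> v x)) (at 0)"
    if v: "v \<in> loops" for v
  proof -
    define w where "w \<epsilon> = (\<lambda>x. u x + \<epsilon> *\<^sub>R v x)" for \<epsilon>
    obtain \<delta> where \<delta>: "\<delta> > 0" "\<And>\<epsilon>. \<bar>\<epsilon>\<bar> < \<delta> \<Longrightarrow> w \<epsilon> \<in> fields U"
      unfolding w_def using fields_perturb[OF open_U u v] by blast
    note lps = loops_intros loops_G loops_C loops_DG loops_DC p q v ul u
    \<comment> \<open>The factor \<open>1 + \<epsilon> * 0\<close> brings the metric term into the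
      shape of \<open>integral_field_derivative\<close>.\<close>
    define A where "A \<epsilon> = integral {0..1} (\<lambda>x. (Dx p x * Dx (Dx q) x) * G i j (w \<epsilon> x) * (1 + \<epsilon> * 0))" for \<epsilon>
    define B where "B k \<epsilon> = integral {0..1} (\<lambda>x. (Dx p x * Dx q x) * C i j k (w \<epsilon> x) * (Dx u x $ k + \<epsilon> * Dx v x $ k))" for k \<epsilon>
    have K: "?K (w \<epsilon>) = - (A \<epsilon> + (\<Sum>k\<in>UNIV. B k \<epsilon>))" if "\<bar>\<epsilon>\<bar> < \<delta>" for \<epsilon>
    proof -
      note w = \<delta>(2)[OF that]
      have Dw: "Dx (w \<epsilon>) x $ k = Dx u x $ k + \<epsilon> * Dx v x $ k" for x k
      proof -
        have "(w \<epsilon> has_vector_derivative Dx u x + \<epsilon> *\<^sub>R Dx v x) (at x)"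
          unfolding w_def
          by (intro has_vector_derivative_add loops_has_vector_derivative ul v
             bounded_linear.has_vector_derivative[OF bounded_linear_scaleR_right])
        then show ?thesis by (simp add: Dx_def vector_derivative_at)
      qed
      have "?K (w \<epsilon>) = - integral {0..1} (\<lambda>x. (Dx p x * Dx (Dx q) x) * G i j (w \<epsilon> x) * (1 + \<epsilon> * 0)
            + (\<Sum>k\<in>UNIV. (Dx p x * Dx q x) * C i j k (w \<epsilon> x) * (Dx u x $ k + \<epsilon> * Dx v x $ k)))"
        unfolding bracket_single_single[OF w p q] flux_def Dw
        by (simp add: algebra_simps sum_distrib_left sum_distrib_right)
      also have "\<dots> = - (A \<epsilon> + integral {0..1} (\<lambda>x. \<Sum>k\<in>UNIV. (Dx p x * Dx q x) * C i j k (w \<epsilon> x) * (Dx u x $ k + \<epsilon> * Dx v x $ k)))"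
        unfolding A_def by (subst integral_add) (intro loops_integrable lps w refl)+
      also have "\<dots> = - (A \<epsilon> + (\<Sum>k\<in>UNIV. B k \<epsilon>))"
        unfolding B_def by (subst integral_sum) (intro loops_integrable lps w refl)+
      finally show ?thesis .
    qed
    have "(A has_real_derivative integral {0..1} (\<lambda>x. Dx p x * Dx (Dx q) x * ((\<Sum>l\<in>UNIV. partial l (G i j) (u x) * v x $ l) * 1 + G i j (u x) * 0))) (at 0)"
      unfolding A_def w_def by (rule integral_field_derivative[OF open_U smooth_G u v]) (intro lps)+
    moreover have "(B k has_real_derivative integral {0..1} (\<lambda>x. Dx p x * Dx q x * ((\<Sum>l\<in>UNIV. partial l (C i j k) (u x) * v x $ l) * Dx u x $ k + C i j k (u x) * Dx v x $ k))) (at 0)" for k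
      unfolding B_def w_def by (rule integral_field_derivative[OF open_U smooth_C u v]) (intro lps)+
    ultimately have D: "((\<lambda>\<epsilon>. - (A \<epsilon> + (\<Sum>k\<in>UNIV. B k \<epsilon>))) has_real_derivative
       - (integral {0..1} (\<lambda>x. Dx p x * Dx (Dx q) x * ((\<Sum>l\<in>UNIV. partial l (G i j) (u x) * v x $ l) * 1 + G i j (u x) * 0))
        + (\<Sum>k\<in>UNIV. integral {0..1} (\<lambda>x. Dx p x * Dx q x * ((\<Sum>l\<in>UNIV. partial l (C i j k) (u x) * v x $ l) * Dx u x $ k + C i j k (u x) * Dx v x $ k))))) (at 0)"
      (is "(_ has_real_derivative - (?DA + (\<Sum>k\<in>UNIV. ?DB k))) _")
      by (intro DERIV_minus DERIV_add DERIV_sum)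
    \<comment> \<open>The variation of the velocity produces \<open>Dx v\<close>; partial
      integration frees \<open>v\<close> from the derivative, as the pairing with the variational
      derivative requires.\<close>
    have DB: "?DB k = integral {0..1} (\<lambda>x. \<Sum>l\<in>UNIV. Dx p x * Dx q x * partial l (C i j k) (u x) * Dx u x $ k * v x $ l)
       - integral {0..1} (\<lambda>x. Dx (\<lambda>x. Dx p x * Dx q x * C i j k (u x)) x * v x $ k)" for k
    proof -
      have "?DB k = integral {0..1} (\<lambda>x. (\<Sum>l\<in>UNIV. Dx p x * Dx q x * partial l (C i j k) (u x) * Dx u x $ k * v x $ l)
          + Dx p x * Dx q x * C i j k (u x) * Dx (\<lambda>x. v x $ k) x)"
        by (simp add: Dx_component[OF v] algebra_simps sum_distrib_left sum_distrib_right)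
      also have "\<dots> = integral {0..1} (\<lambda>x. \<Sum>l\<in>UNIV. Dx p x * Dx q x * partial l (C i j k) (u x) * Dx u x $ k * v x $ l)
         + integral {0..1} (\<lambda>x. Dx p x * Dx q x * C i j k (u x) * Dx (\<lambda>x. v x $ k) x)"
        by (intro integral_add loops_integrable lps)
      also have "integral {0..1} (\<lambda>x. Dx p x * Dx q x * C i j k (u x) * Dx (\<lambda>x. v x $ k) x)
          = - integral {0..1} (\<lambda>x. Dx (\<lambda>x. Dx p x * Dx q x * C i j k (u x)) x * v x $ k)"
        by (intro integral_by_parts lps)
      finally show ?thesis by simp
    qed
    have "- (?DA + (\<Sum>k\<in>UNIV. ?DB k)) = integral {0..1} (\<lambda>x. ?e x \<bullet> v x)"
    proof -
      have 1: "(\<lambda>x. Dx (\<lambda>x. Dx p x * Dx q x * C i j k (u x)) x * v x $ k) \<in> loops"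
        and 2: "(\<lambda>x. \<Sum>l\<in>UNIV. Dx p x * Dx q x * partial l (C i j k) (u x) * Dx u x $ k * v x $ l) \<in> loops" for k
        by (intro lps)+
      have "integral {0..1} (\<lambda>x. ?e x \<bullet> v x) = integral {0..1} (\<lambda>x.
          (\<Sum>k\<in>UNIV. Dx (\<lambda>x. Dx p x * Dx q x * C i j k (u x)) x * v x $ k)
          - (Dx p x * Dx (Dx q) x * (\<Sum>l\<in>UNIV. partial l (G i j) (u x) * v x $ l)
          + (\<Sum>k\<in>UNIV. \<Sum>l\<in>UNIV. Dx p x * Dx q x * partial l (C i j k) (u x) * Dx u x $ k * v x $ l)))"
        (is "_ = integral _ ?f")
      proof (rule arg_cong[where f="integral {0..1}"], rule ext)
        fix x
        have "(\<Sum>k\<in>UNIV. \<Sum>l\<in>UNIV. Dx p x * Dx q x * partial l (C i j k) (u x) * Dx u x $ k * v x $ l)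
            = (\<Sum>l\<in>UNIV. (\<Sum>k\<in>UNIV. Dx p x * Dx q x * partial l (C i j k) (u x) * Dx u x $ k) * v x $ l)"
          unfolding sum_distrib_right by (rule sum.swap)
        then show "?e x \<bullet> v x = ?f x"
          by (simp add: inner_vec_def var_bracket_def algebra_simps sum_subtractf sum.distrib sum_distrib_left)
      qed
      also have "\<dots> = integral {0..1} (\<lambda>x. \<Sum>k\<in>UNIV. Dx (\<lambda>x. Dx p x * Dx q x * C i j k (u x)) x * v x $ k)
          - (integral {0..1} (\<lambda>x. Dx p x * Dx (Dx q) x * (\<Sum>l\<in>UNIV. partial l (G i j) (u x) * v x $ l))
          + integral {0..1} (\<lambda>x. \<Sum>k\<in>UNIV. \<Sum>l\<in>UNIV. Dx p x * Dx q x * partial l (C i j k) (u x) * Dx u x $ k * v x $ l))"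
        by (subst integral_diff, (intro loops_integrable lps)+, subst integral_add, (intro loops_integrable lps)+) simp
      also have "\<dots> = - (?DA + (\<Sum>k\<in>UNIV. ?DB k))"
        unfolding DB sum_subtractf
          integral_sum[of UNIV "\<lambda>k x. Dx (\<lambda>x. Dx p x * Dx q x * C i j k (u x)) x * v x $ k", OF finite loops_integrable[OF 1]]
          integral_sum[of UNIV "\<lambda>k x. \<Sum>l\<in>UNIV. Dx p x * Dx q x * partial l (C i j k) (u x) * Dx u x $ k * v x $ l", OF finite loops_integrable[OF 2]]
        by simp
      finally show ?thesis by simp
    qed
    with D have "((\<lambda>\<epsilon>. - (A \<epsilon> + (\<Sum>k\<in>UNIV. B k \<epsilon>))) has_real_derivative integral {0..1} (\<lambda>x. ?e x \<bullet> v x)) (at 0)"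
      by simp
    \<comment> \<open>The formula \<open>K\<close> for the bracket holds only while the varied curve
      is a field, which is enough for a derivative at zero.\<close>
    then show ?thesis
      unfolding w_def[symmetric]
      by (rule has_field_derivative_transform_within_open[where S="{-\<delta><..<\<delta>}"])
        (use \<delta>(1) K in auto)
  qed
  then show "has_var_deriv ?K u ?e" using e by (auto simp: has_var_deriv_def)
qed

end

section \<open>Trigonometric test functions\<close>

text \<open>An integer frequency makes the function 1-periodic. Differentiation only changes the two
  amplitudes, so values of higher derivatives at \<open>0\<close> and \<open>1/2\<close> are
  obtained by rewriting.\<close>

definition osc :: "nat \<Rightarrow> real \<Rightarrow> real \<Rightarrow> real \<Rightarrow> real" where
  "osc n a b = (\<lambda>x. a * cos (2 * pi * n * x) + b * sin (2 * pi * n * x))"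

lemma osc_has_vector_derivative:
  "(osc n a b has_vector_derivative osc n (2 * pi * n * b) (- (2 * pi * n * a)) x) (at x)"
  unfolding osc_def has_real_derivative_iff_has_vector_derivative[symmetric]
  by (auto intro!: derivative_eq_intros simp: algebra_simps)

lemma Dx_osc: "Dx (osc n a b) = osc n (2 * pi * n * b) (- (2 * pi * n * a))"
  by (intro Dx_eqI osc_has_vector_derivative)

lemma osc_loops: "osc n a b \<in> loops"
proof (rule loops_coinduct[where S="{osc n a b |a b. True}"])
  fix f assume "f \<in> {osc n a b |a b. True}"
  then obtain a b where f: "f = osc n a b" by blast
  have "osc n a b (x + 1) = osc n a b x" for x
  proof -
    have "2 * pi * real n * (x + 1) = 2 * pi * real n * x + 2 * pi * real n"
      by (simp add: algebra_simps)
    moreover have "cos (2 * pi * real n) = 1" "sin (2 * pi * real n) = 0"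
      using cos_2npi[of n] sin_2npi[of n] by (simp_all add: mult_ac)
    ultimately show ?thesis by (simp add: osc_def cos_add sin_add)
  qed
  then show "(\<forall>x. f (x + 1) = f x) \<and> (\<exists>f'\<in>{osc n a b |a b. True}. \<forall>x. (f has_vector_derivative f' x) (at x))"
    unfolding f using osc_has_vector_derivative[of n a b] by blast
qed auto

lemma osc_0: "osc n a b 0 = a"
  by (simp add: osc_def)

lemma osc_half: "osc n a b (1/2) = (-1) ^ n * a"
  using sin_npi[of n] cos_npi[of n] by (simp add: osc_def mult_ac)

text \<open>
  The test function of the Jacobi identity: it is even, so its odd derivatives vanish at \<open>0\<close> and
  \<open>1/2\<close>, and up to a constant it is \<open>8 (1 + cos t)\<^sup>3 (1 - cos t)\<close> with \<open>t = 2\<pi>x\<close>, so that all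
  derivatives up to the fifth vanish at \<open>1/2\<close>.
\<close>

definition flat_test :: "real \<Rightarrow> real" where
  "flat_test = (\<lambda>x. osc 1 4 0 x + (osc 2 (-4) 0 x + (osc 3 (-4) 0 x + osc 4 (-1) 0 x)))"

lemma flat_test_loops: "flat_test \<in> loops"
  unfolding flat_test_def by (intro loops_add osc_loops)

lemma Dx_osc_sum4:
  "Dx (\<lambda>x. osc 1 a1 b1 x + (osc 2 a2 b2 x + (osc 3 a3 b3 x + osc 4 a4 b4 x))) =
    (\<lambda>x. osc 1 (2 * pi * b1) (- (2 * pi * a1)) x + (osc 2 (4 * pi * b2) (- (4 * pi * a2)) x
      + (osc 3 (6 * pi * b3) (- (6 * pi * a3)) x + osc 4 (8 * pi * b4) (- (8 * pi * a4)) x)))"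
  by (simp add: Dx_add loops_add osc_loops Dx_osc)

lemma flat_test_derivs:
  "Dx flat_test 0 = 0" "Dx (Dx (Dx flat_test)) 0 = 0"
  "Dx (Dx flat_test) 0 = 256 * pi^2" "Dx (Dx (Dx (Dx flat_test))) 0 = - 10240 * pi^4"
  "Dx flat_test (1/2) = 0" "Dx (Dx flat_test) (1/2) = 0"
  "Dx (Dx (Dx flat_test)) (1/2) = 0" "Dx (Dx (Dx (Dx flat_test))) (1/2) = 0"
  unfolding flat_test_def Dx_osc_sum4
  by (simp_all add: osc_0 osc_half power_numeral_reduce)

section \<open>The integrand of the Jacobi identity\<close>

text \<open>
  Here \<open>\<phi>, \<psi>, \<omega>\<close> are the derivatives of the covectors of three linear functionals, \<open>h\<close> is the
  velocity of the field along a coordinate line, and the remaining functions are the coefficients of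
  the operator and of its derivatives along the field. Partial integration removes all derivatives
  from \<open>\<omega>\<close>.
\<close>

definition jacobi_density where
  "jacobi_density c1 c2 d1 gm cm e1 e2 d2 f1 f2 d3 Y Z h \<phi> \<psi> = (\<lambda>x::real.
     Dx (\<lambda>x. Dx (\<lambda>x. c1 x * Dx \<phi> x * \<psi> x - c2 x * \<phi> x * Dx \<psi> x - d1 x * h x * \<phi> x * \<psi> x) x * gm x) x
     - Dx (\<lambda>x. c1 x * Dx \<phi> x * \<psi> x - c2 x * \<phi> x * Dx \<psi> x - d1 x * h x * \<phi> x * \<psi> x) x * cm x * h x
     + (e1 x * Dx \<psi> x * Y x + Dx (\<lambda>x. e2 x * \<psi> x * Y x) x - d2 x * h x * \<psi> x * Y x)
     - (Dx (\<lambda>x. f1 x * \<phi> x * Z x) x + f2 x * Dx \<phi> x * Z x + d3 x * h x * \<phi> x * Z x) :: real)"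

context
  fixes c1 c2 d1 gm cm e1 e2 d2 f1 f2 d3 h \<phi> \<psi> :: "real \<Rightarrow> real"
  assumes loops: "c1 \<in> loops" "c2 \<in> loops" "d1 \<in> loops" "gm \<in> loops" "cm \<in> loops" "e1 \<in> loops" "e2 \<in> loops"
    "d2 \<in> loops" "f1 \<in> loops" "f2 \<in> loops" "d3 \<in> loops" "h \<in> loops" "\<phi> \<in> loops" "\<psi> \<in> loops"
begin

lemma jacobi_density_loops:
  assumes "Y \<in> loops" "Z \<in> loops"
  shows "jacobi_density c1 c2 d1 gm cm e1 e2 d2 f1 f2 d3 Y Z h \<phi> \<psi> \<in> loops"
  unfolding jacobi_density_def by (intro loops_intros loops assms)

lemma integral_jacobi_density:
  assumes Y: "Y \<in> loops" and Z: "Z \<in> loops" and \<omega>: "\<omega> \<in> loops"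
  shows "integral {0..1} (\<lambda>x. (c1 x * Dx \<phi> x * \<psi> x - c2 x * \<phi> x * Dx \<psi> x - d1 x * h x * \<phi> x * \<psi> x)
        * Dx (\<lambda>x. gm x * Dx \<omega> x + cm x * h x * \<omega> x) x)
     + integral {0..1} (\<lambda>x. (e1 x * Dx \<psi> x * \<omega> x - e2 x * \<psi> x * Dx \<omega> x - d2 x * h x * \<psi> x * \<omega> x) * Y x)
     + integral {0..1} (\<lambda>x. (f1 x * Dx \<omega> x * \<phi> x - f2 x * \<omega> x * Dx \<phi> x - d3 x * h x * \<omega> x * \<phi> x) * Z x)
     = integral {0..1} (\<lambda>x. \<omega> x * jacobi_density c1 c2 d1 gm cm e1 e2 d2 f1 f2 d3 Y Z h \<phi> \<psi> x)"
    (is "?I1 + ?I2 + ?I3 = _")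
proof -
  note lps = loops_intros loops Y Z \<omega>
  define E where "E = (\<lambda>x. c1 x * Dx \<phi> x * \<psi> x - c2 x * \<phi> x * Dx \<psi> x - d1 x * h x * \<phi> x * \<psi> x)"
  have E: "E \<in> loops" unfolding E_def by (intro lps)
  \<comment> \<open>Common normal form: an integrand linear in \<omega> and its first derivative
    becomes \<omega> times a single factor.\<close>
  have parts: "integral {0..1} (\<lambda>x. a x * Dx \<omega> x + \<omega> x * b x) = integral {0..1} (\<lambda>x. \<omega> x * (b x - Dx a x))"
    if "a \<in> loops" "b \<in> loops" for a b :: "real \<Rightarrow> real"
  proof -
    have "integral {0..1} (\<lambda>x. a x * Dx \<omega> x + \<omega> x * b x)
        = integral {0..1} (\<lambda>x. a x * Dx \<omega> x) + integral {0..1} (\<lambda>x. \<omega> x * b x)"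
      by (intro integral_add loops_integrable lps that)
    also have "integral {0..1} (\<lambda>x. a x * Dx \<omega> x) = - integral {0..1} (\<lambda>x. \<omega> x * Dx a x)"
      by (simp add: integral_by_parts[OF that(1) \<omega>] mult.commute)
    also have "- integral {0..1} (\<lambda>x. \<omega> x * Dx a x) + integral {0..1} (\<lambda>x. \<omega> x * b x)
        = integral {0..1} (\<lambda>x. \<omega> x * b x - \<omega> x * Dx a x)"
      by (subst integral_diff, (intro loops_integrable lps that)+) simp
    finally show ?thesis by (simp add: algebra_simps)
  qed
  \<comment> \<open>Here \<omega> is differentiated twice, so one partial integration is needed
    before \<open>parts\<close> applies.\<close>
  have "?I1 = integral {0..1} (\<lambda>x. E x * Dx (\<lambda>x. gm x * Dx \<omega> x + cm x * h x * \<omega> x) x)"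
    by (simp add: E_def)
  also have "\<dots> = - integral {0..1} (\<lambda>x. Dx E x * (gm x * Dx \<omega> x + cm x * h x * \<omega> x))"
    by (intro integral_by_parts lps E)
  also have "\<dots> = integral {0..1} (\<lambda>x. - (Dx E x * gm x) * Dx \<omega> x + \<omega> x * - (Dx E x * cm x * h x))"
    by (simp add: algebra_simps flip: integral_neg)
  also have "\<dots> = integral {0..1} (\<lambda>x. \<omega> x * (- (Dx E x * cm x * h x) - Dx (\<lambda>x. - (Dx E x * gm x)) x))"
    by (rule parts) (intro lps E)+
  finally have I1: "?I1 = \<dots>" .
  have "?I2 = integral {0..1} (\<lambda>x. - (e2 x * \<psi> x * Y x) * Dx \<omega> x + \<omega> x * (e1 x * Dx \<psi> x * Y x - d2 x * h x * \<psi> x * Y x))"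
    by (simp add: algebra_simps)
  also have "\<dots> = integral {0..1} (\<lambda>x. \<omega> x * ((e1 x * Dx \<psi> x * Y x - d2 x * h x * \<psi> x * Y x) - Dx (\<lambda>x. - (e2 x * \<psi> x * Y x)) x))"
    by (rule parts) (intro lps)+
  finally have I2: "?I2 = \<dots>" .
  have "?I3 = integral {0..1} (\<lambda>x. (f1 x * \<phi> x * Z x) * Dx \<omega> x + \<omega> x * (- (f2 x * Dx \<phi> x * Z x) - d3 x * h x * \<phi> x * Z x))"
    by (simp add: algebra_simps)
  also have "\<dots> = integral {0..1} (\<lambda>x. \<omega> x * ((- (f2 x * Dx \<phi> x * Z x) - d3 x * h x * \<phi> x * Z x) - Dx (\<lambda>x. f1 x * \<phi> x * Z x) x))"
    by (rule parts) (intro lps)+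
  finally have I3: "?I3 = \<dots>" .
  have Dminus: "Dx (\<lambda>x. - a x) = (\<lambda>x. - Dx a x)" if "a \<in> loops" for a :: "real \<Rightarrow> real"
    using Dx_diff[OF loops_const[of 0] that] Dx_eqI[of "\<lambda>x. 0::real" "\<lambda>x. 0"] by simp
  have D1: "Dx (\<lambda>x. - (Dx E x * gm x)) = (\<lambda>x. - Dx (\<lambda>x. Dx E x * gm x) x)"
    and D2: "Dx (\<lambda>x. - (e2 x * \<psi> x * Y x)) = (\<lambda>x. - Dx (\<lambda>x. e2 x * \<psi> x * Y x) x)"
    by (intro Dminus lps E)+
  have jd: "jacobi_density c1 c2 d1 gm cm e1 e2 d2 f1 f2 d3 Y Z h \<phi> \<psi> = (\<lambda>x.
     Dx (\<lambda>x. Dx E x * gm x) x - Dx E x * cm x * h x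
     + (e1 x * Dx \<psi> x * Y x + Dx (\<lambda>x. e2 x * \<psi> x * Y x) x - d2 x * h x * \<psi> x * Y x)
     - (Dx (\<lambda>x. f1 x * \<phi> x * Z x) x + f2 x * Dx \<phi> x * Z x + d3 x * h x * \<phi> x * Z x))"
    unfolding jacobi_density_def E_def ..
  show ?thesis
    unfolding I1 I2 I3 D1 D2 jd
    by (subst integral_add[symmetric], (intro loops_integrable lps E)+)+
      (simp add: algebra_simps)
qed

context
  fixes gi ci gj cj :: "real \<Rightarrow> real" and x :: real
  assumes loops': "gi \<in> loops" "ci \<in> loops" "gj \<in> loops" "cj \<in> loops"
begin

lemmas calculus = Dx_mult Dx_add Dx_diff loops loops' loops_mult loops_add loops_diff Dx_loops

text \<open>Every term of the density contains \<phi> or one of its derivatives of order at most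
  three as a factor; the third order comes from \<open>Dx\<close> of \<open>Y\<close> and from the
  two outer derivatives of the first summand.\<close>

lemma jacobi_density_flat:
  assumes "\<phi> x = 0" "Dx \<phi> x = 0" "Dx (Dx \<phi>) x = 0" "Dx (Dx (Dx \<phi>)) x = 0"
  shows "jacobi_density c1 c2 d1 gm cm e1 e2 d2 f1 f2 d3
    (Dx (\<lambda>x. gi x * Dx \<phi> x + ci x * h x * \<phi> x)) (Dx (\<lambda>x. gj x * Dx \<psi> x + cj x * h x * \<psi> x)) h \<phi> \<psi> x = 0"
  using assms by (simp add: jacobi_density_def calculus)

text \<open>The hypotheses are parity conditions at \<open>x\<close>: \<phi> and \<open>h\<close>
  behave like odd functions there and \<psi> like an even one. Of all products of derivatives only
  three survive. The coefficients \<open>c1\<close> and \<open>gi\<close> are differentiated twice,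
  which is why their derivatives are given as functions \<open>c1' x * h x\<close> and
  \<open>gi' x * h x\<close> and contribute \<open>Dx h x\<close>.\<close>

lemma jacobi_density_value:
  assumes "c1' \<in> loops" "gi' \<in> loops" "Dx c1 = (\<lambda>x. c1' x * h x)" "Dx gi = (\<lambda>x. gi' x * h x)"
    "Dx gm x = 0" "Dx gj x = 0" "Dx c2 x = 0"
    "\<phi> x = 0" "Dx (Dx \<phi>) x = 0" "Dx \<psi> x = 0" "Dx (Dx (Dx \<psi>)) x = 0" "h x = 0" "Dx (Dx h) x = 0"
  shows "jacobi_density c1 c2 d1 gm cm e1 e2 d2 f1 f2 d3
    (Dx (\<lambda>x. gi x * Dx \<phi> x + ci x * h x * \<phi> x)) (Dx (\<lambda>x. gj x * Dx \<psi> x + cj x * h x * \<psi> x)) h \<phi> \<psi> x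
    = Dx (Dx (Dx \<phi>)) x * \<psi> x * (gm x * c1 x + e2 x * gi x)
    + Dx \<phi> x * Dx (Dx \<psi>) x * (gm x * c1 x - 2 * gm x * c2 x - (f1 x + f2 x) * gj x)
    + Dx h x * Dx \<phi> x * \<psi> x * (gm x * c1' x - 2 * gm x * d1 x + e2 x * (gi' x + 2 * ci x) - (f1 x + f2 x) * cj x)"
  using assms by (simp add: jacobi_density_def calculus) (simp add: algebra_simps)

end

end

section \<open>The Hamiltonian conditions\<close>

context hamiltonian_operator
begin

text \<open>Fields that oscillate along one coordinate line suffice: their velocity singles out the
  index \<kappa>, so sums over velocity components collapse to one term.\<close>

lemma line_fields:
  assumes "u0 \<in> U" "v \<in> loops"
  obtains \<epsilon> where "\<epsilon> > 0" "(\<lambda>x. u0 + (\<epsilon> * v x) *\<^sub>R axis \<kappa> 1) \<in> fields U"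
proof -
  have "(\<lambda>x. u0) \<in> fields U" using assms by (auto simp: fields_def)
  then obtain \<delta> where \<delta>: "\<delta> > 0" "\<And>\<epsilon>. \<bar>\<epsilon>\<bar> < \<delta> \<Longrightarrow> (\<lambda>x. u0 + \<epsilon> *\<^sub>R (v x *\<^sub>R axis \<kappa> 1)) \<in> fields U"
    using fields_perturb[OF open_U _ loops_scaleR_const[OF assms(2)]] by blast
  have "(\<lambda>x. u0 + (\<delta> / 2) *\<^sub>R (v x *\<^sub>R axis \<kappa> 1)) \<in> fields U"
    by (rule \<delta>(2)) (use \<delta>(1) in simp)
  then show ?thesis
    using that[of "\<delta> / 2"] \<delta>(1) by (simp only: scaleR_scaleR half_gt_zero)
qed

lemma Dx_line:
  assumes "v \<in> loops"
  shows "Dx (\<lambda>x. u0 + (\<epsilon> * v x) *\<^sub>R axis \<kappa> 1 :: real^'n) = (\<lambda>x. (\<epsilon> * Dx v x) *\<^sub>R axis \<kappa> 1)"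
proof (rule Dx_eqI)
  fix x
  have "((\<lambda>x. u0 + (\<epsilon> * v x) *\<^sub>R axis \<kappa> 1 :: real^'n) has_vector_derivative 0 + (\<epsilon> * Dx v x) *\<^sub>R axis \<kappa> 1) (at x)"
    by (intro has_vector_derivative_add has_vector_derivative_const
        bounded_linear.has_vector_derivative[OF bounded_linear_scaleR_left]
        bounded_linear.has_vector_derivative[OF bounded_linear_mult_right] loops_has_vector_derivative assms)
  then show "((\<lambda>x. u0 + (\<epsilon> * v x) *\<^sub>R axis \<kappa> 1 :: real^'n) has_vector_derivative (\<epsilon> * Dx v x) *\<^sub>R axis \<kappa> 1) (at x)"
    by simp
qed

text \<open>Skew-symmetry is tested on a field that passes through \<open>u0\<close> at
  \<open>x = 0\<close> with nonzero velocity in direction \<open>k\<close>. The defect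
  \<open>f\<close> of the asserted relation, contracted with the velocity, must vanish
  there.\<close>

lemma partial_G:
  assumes "u0 \<in> U"
  shows "partial k (G i j) u0 = C i j k u0 + C j i k u0"
proof -
  obtain \<epsilon> where \<epsilon>: "\<epsilon> > 0" and u: "(\<lambda>x. u0 + (\<epsilon> * osc 1 0 1 x) *\<^sub>R axis k 1) \<in> fields U"
    using line_fields[OF assms osc_loops] by blast
  define u where "u = (\<lambda>x. u0 + (\<epsilon> * osc 1 0 1 x) *\<^sub>R (axis k 1 :: real^'n))"
  note uf = u[folded u_def] and ul = fields_loops[OF u[folded u_def]]
  define f where "f = (\<lambda>x. \<Sum>k\<in>UNIV. (C i j k (u x) + C j i k (u x) - partial k (G i j) (u x)) * Dx u x $ k)"
  have f: "f \<in> loops"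
    unfolding f_def by (intro loops_intros loops_C loops_DG uf ul)
  define q where "q = osc 1 0 1"
  have q: "q \<in> loops" by (simp add: q_def osc_loops)
  note lps = loops_intros loops_G loops_C loops_DG uf ul q
  have "integral {0..1} (\<lambda>x. Dx p x * (Dx q x * f x)) = 0" if p: "p \<in> loops" for p
  proof -
    \<comment> \<open>The derivative of \<open>G i j (u x) * (Dx p x * Dx q x)\<close> absorbs both
      second-derivative terms of the fluxes, by the symmetry of \<open>G\<close>; only the defect
      remains.\<close>
    have "Dx p x * (Dx q x * f x) = Dx p x * flux i j q u x + Dx q x * flux j i p u x
        - Dx (\<lambda>x. G i j (u x) * (Dx p x * Dx q x)) x" for x
      by (simp add: f_def flux_def Dx_mult Dx_smooth_comp[OF uf smooth_G] lps p
            G_sym[OF fields_mem[OF uf], of j i] algebra_simps sum.distrib sum_subtractf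
            sum_distrib_left sum_distrib_right)
    then have "integral {0..1} (\<lambda>x. Dx p x * (Dx q x * f x))
        = integral {0..1} (\<lambda>x. Dx p x * flux i j q u x + Dx q x * flux j i p u x
        - Dx (\<lambda>x. G i j (u x) * (Dx p x * Dx q x)) x)"
      by simp
    also have "\<dots> = integral {0..1} (\<lambda>x. Dx p x * flux i j q u x) + integral {0..1} (\<lambda>x. Dx q x * flux j i p u x)
        - integral {0..1} (Dx (\<lambda>x. G i j (u x) * (Dx p x * Dx q x)))"
      by (subst integral_diff, (intro loops_integrable lps p flux_loops)+,
          subst integral_add, (intro loops_integrable lps p flux_loops)+) simp
    also have "\<dots> = 0"
      using flux_skew[OF uf p q] integral_Dx[of "\<lambda>x. G i j (u x) * (Dx p x * Dx q x)"]
      by (simp add: lps p)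
    finally show ?thesis .
  qed
  \<comment> \<open>The integral identity shows only that \<open>Dx q x * f x\<close> is constant;
    the constant is found at \<open>1/4\<close>, a zero of \<open>Dx q\<close>.\<close>
  then have "Dx q 0 * f 0 = Dx q (1/4) * f (1/4)"
    by (intro du_Bois_Reymond[of "\<lambda>x. Dx q x * f x"] lps f)
  moreover have "Dx q 0 = 2 * pi" "Dx q (1/4) = 0"
    unfolding q_def Dx_osc by (simp_all add: osc_def)
  ultimately have "f 0 = 0" by simp
  moreover have "u 0 = u0" by (simp add: u_def osc_0)
  moreover have "Dx u 0 $ l = (if l = k then \<epsilon> * (2 * pi) else 0)" for l
    unfolding u_def Dx_line[OF osc_loops] by (simp add: Dx_osc osc_0 axis_def)
  ultimately show ?thesis
    using \<epsilon> by (simp add: f_def if_distrib cong: if_cong)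
qed

section \<open>The Jacobi identity along a coordinate line\<close>

lemma var_bracket_line:
  assumes u: "u \<in> fields U" and p: "p \<in> loops" and q: "q \<in> loops" and Du: "Dx u = (\<lambda>x. h x *\<^sub>R axis \<kappa> 1)"
    and h: "h \<in> loops"
  shows "var_bracket i j p q u l = (\<lambda>x. C i j l (u x) * Dx (Dx p) x * Dx q x - C j i l (u x) * Dx p x * Dx (Dx q) x
    - (partial l (C i j \<kappa>) (u x) - partial \<kappa> (C i j l) (u x)) * h x * Dx p x * Dx q x)"
  \<comment> \<open>By \<open>partial_G\<close> the derivative of the metric splits into two
    coefficients; one of them cancels the term in which the product rule differentiates
    \<open>Dx q\<close>.\<close>
  by (simp add: fun_eq_iff var_bracket_def Dx_mult loops_mult Dx_loops p q loops_C[OF u] Du axis_def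
      Dx_smooth_comp[OF u smooth_C] partial_G[OF fields_mem[OF u]] algebra_simps if_distrib cong: if_cong)

lemma flux_line:
  assumes "Dx u = (\<lambda>x. h x *\<^sub>R axis \<kappa> 1)"
  shows "flux i j q u = (\<lambda>x. G i j (u x) * Dx (Dx q) x + C i j \<kappa> (u x) * h x * Dx q x)"
  by (simp add: fun_eq_iff flux_def assms axis_def if_distrib cong: if_cong)

lemma jacobi_single:
  assumes u: "u \<in> fields U" and p: "p \<in> loops" and q: "q \<in> loops" and r: "r \<in> loops"
  shows "(\<Sum>l\<in>UNIV. integral {0..1} (\<lambda>x. var_bracket i j p q u l x * Dx (flux l m r u) x)
      + integral {0..1} (\<lambda>x. var_bracket j m q r u l x * Dx (flux l i p u) x)
      + integral {0..1} (\<lambda>x. var_bracket m i r p u l x * Dx (flux l j q u) x)) = 0"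
proof -
  have *: "bracket gu cu (bracket gu cu (lin_fun (single p i)) (lin_fun (single q j))) (lin_fun (single r m)) u
      = (\<Sum>l\<in>UNIV. integral {0..1} (\<lambda>x. var_bracket i j p q u l x * Dx (flux l m r u) x))"
    if "p \<in> loops" "q \<in> loops" "r \<in> loops" for p q r i j m
  proof -
    have "(\<lambda>x. \<chi> l. var_bracket i j p q u l x) \<in> loops"
      by (rule loops_vecI) (simp add: var_bracket_loops[OF u that(1,2)] eta_contract_eq)
    from bracket_single[OF u that(3) var_deriv_bracket[OF u that(1,2)] this] show ?thesis by simp
  qed
  show ?thesis
    using ham_jacobi[OF local_functional_lin_fun local_functional_lin_fun local_functional_lin_fun u,
        of "single p i" "single q j" "single r m"] p q r
    by (simp add: * sum.distrib loops_scaleR_const)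
qed

text \<open>The total factor of \<open>Dx r\<close> after partial integration in the Jacobi identity
  for components \<open>i\<close>, \<open>j\<close>, \<open>m\<close>, with \<phi>, \<psi>, \<omega>
  specialised to \<open>Dx p\<close>, \<open>Dx q\<close>, \<open>Dx r\<close>.\<close>

definition jacobi_sum where
  "jacobi_sum i j m \<kappa> u h p q = (\<lambda>x. \<Sum>l\<in>UNIV. jacobi_density
     (\<lambda>x. C i j l (u x)) (\<lambda>x. C j i l (u x)) (\<lambda>x. partial l (C i j \<kappa>) (u x) - partial \<kappa> (C i j l) (u x))
     (\<lambda>x. G l m (u x)) (\<lambda>x. C l m \<kappa> (u x))
     (\<lambda>x. C j m l (u x)) (\<lambda>x. C m j l (u x)) (\<lambda>x. partial l (C j m \<kappa>) (u x) - partial \<kappa> (C j m l) (u x))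
     (\<lambda>x. C m i l (u x)) (\<lambda>x. C i m l (u x)) (\<lambda>x. partial l (C m i \<kappa>) (u x) - partial \<kappa> (C m i l) (u x))
     (Dx (\<lambda>x. G l i (u x) * Dx (Dx p) x + C l i \<kappa> (u x) * h x * Dx p x))
     (Dx (\<lambda>x. G l j (u x) * Dx (Dx q) x + C l j \<kappa> (u x) * h x * Dx q x)) h (Dx p) (Dx q) x)"

context
  fixes u and h p q :: "real \<Rightarrow> real" and \<kappa>
  assumes u: "u \<in> fields U" and Du: "Dx u = (\<lambda>x. h x *\<^sub>R axis \<kappa> 1)" and h: "h \<in> loops"
    and p: "p \<in> loops" and q: "q \<in> loops"
begin

lemmas line_loops = loops_intros loops_G[OF u] loops_C[OF u] loops_DG[OF u] loops_DC[OF u] h p q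

text \<open>The third functional enters only through \<open>Dx r\<close>, with \<open>r\<close> an
  arbitrary loop, so \<open>du_Bois_Reymond\<close> applies to the remaining factor.\<close>

lemma jacobi_sum_const: "jacobi_sum i j m \<kappa> u h p q x = jacobi_sum i j m \<kappa> u h p q y"
proof (rule du_Bois_Reymond[where f="jacobi_sum i j m \<kappa> u h p q"])
  show "jacobi_sum i j m \<kappa> u h p q \<in> loops"
    unfolding jacobi_sum_def by (intro loops_sum finite jacobi_density_loops line_loops)
  fix r :: "real \<Rightarrow> real" assume r: "r \<in> loops"
  have "integral {0..1} (\<lambda>x. Dx r x * jacobi_sum i j m \<kappa> u h p q x)
    = (\<Sum>l\<in>UNIV. integral {0..1} (\<lambda>x. var_bracket i j p q u l x * Dx (flux l m r u) x)
      + integral {0..1} (\<lambda>x. var_bracket j m q r u l x * Dx (flux l i p u) x)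
      + integral {0..1} (\<lambda>x. var_bracket m i r p u l x * Dx (flux l j q u) x))"
    unfolding var_bracket_line[OF u p q Du h] var_bracket_line[OF u q r Du h] var_bracket_line[OF u r p Du h]
      flux_line[OF Du]
    by (subst integral_jacobi_density, (intro line_loops r)+)
      (simp add: jacobi_sum_def sum_distrib_left, intro integral_sum finite loops_integrable jacobi_density_loops line_loops r)
  then show "integral {0..1} (\<lambda>x. Dx r x * jacobi_sum i j m \<kappa> u h p q x) = 0"
    using jacobi_single[OF u p q r] by simp
qed

lemma jacobi_sum_flat:
  assumes "Dx p x = 0" "Dx (Dx p) x = 0" "Dx (Dx (Dx p)) x = 0" "Dx (Dx (Dx (Dx p))) x = 0"
  shows "jacobi_sum i j m \<kappa> u h p q x = 0"
  unfolding jacobi_sum_def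
  by (rule sum.neutral, rule ballI, rule jacobi_density_flat) (intro line_loops assms)+

lemma Dx_line_comp: "smooth_on U f \<Longrightarrow> Dx (\<lambda>x. f (u x)) = (\<lambda>x. partial \<kappa> f (u x) * h x)"
  by (simp add: Dx_smooth_comp[OF u] Du axis_def if_distrib cong: if_cong)

lemma jacobi_sum_value:
  assumes "Dx p x = 0" "Dx (Dx (Dx p)) x = 0" "Dx (Dx q) x = 0" "Dx (Dx (Dx (Dx q))) x = 0" "h x = 0" "Dx (Dx h) x = 0"
  shows "jacobi_sum i j m \<kappa> u h p q x
    = Dx (Dx (Dx (Dx p))) x * Dx q x
        * (\<Sum>l\<in>UNIV. G l m (u x) * C i j l (u x) + C m j l (u x) * G l i (u x))
    + Dx (Dx p) x * Dx (Dx (Dx q)) x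
        * (\<Sum>l\<in>UNIV. G l m (u x) * C i j l (u x) - 2 * G l m (u x) * C j i l (u x) - (C m i l (u x) + C i m l (u x)) * G l j (u x))
    + Dx h x * Dx (Dx p) x * Dx q x
        * (\<Sum>l\<in>UNIV. G l m (u x) * partial \<kappa> (C i j l) (u x)
            - 2 * G l m (u x) * (partial l (C i j \<kappa>) (u x) - partial \<kappa> (C i j l) (u x))
            + C m j l (u x) * (partial \<kappa> (G l i) (u x) + 2 * C l i \<kappa> (u x))
            - (C m i l (u x) + C i m l (u x)) * C l j \<kappa> (u x))"
  unfolding jacobi_sum_def sum_distrib_left sum.distrib[symmetric]
  by (intro sum.cong refl jacobi_density_value line_loops Dx_line_comp smooth_C smooth_G)
    (simp_all add: Dx_line_comp smooth_C smooth_G assms)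

end

lemma jacobi_relation:
  assumes u0: "u0 \<in> U"
  obtains \<epsilon> where "\<epsilon> > 0"
    "\<And>n \<delta>. \<delta> = 0 \<or> \<delta> = \<epsilon> \<Longrightarrow> - 10240 * pi^4 * (2 * pi * real n)
        * (\<Sum>l\<in>UNIV. G l m u0 * C i j l u0 + C m j l u0 * G l i u0)
    - 256 * pi^2 * (2 * pi * real n)^3
        * (\<Sum>l\<in>UNIV. G l m u0 * C i j l u0 - 2 * G l m u0 * C j i l u0 - (C m i l u0 + C i m l u0) * G l j u0)
    + \<delta> * (2 * pi)^2 * (256 * pi^2) * (2 * pi * real n)
        * (\<Sum>l\<in>UNIV. G l m u0 * partial \<kappa> (C i j l) u0
            - 2 * G l m u0 * (partial l (C i j \<kappa>) u0 - partial \<kappa> (C i j l) u0)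
            + C m j l u0 * (partial \<kappa> (G l i) u0 + 2 * C l i \<kappa> u0)
            - (C m i l u0 + C i m l u0) * C l j \<kappa> u0) = 0"
proof -
  \<comment> \<open>This is 1 - cos(2 pi x): even, with value zero at \<open>0\<close> and nonzero
    second derivative there. The field thus passes through \<open>u0\<close> at rest; its velocity
    \<open>h\<close> and \<open>Dx (Dx h)\<close> vanish at \<open>0\<close>, while
    \<open>Dx h\<close> does not if \<delta> is nonzero.\<close>
  define v where "v x = 1 + osc 1 (-1) 0 x" for x
  have v: "v \<in> loops" unfolding v_def by (intro loops_add loops_const osc_loops)
  have Dv: "Dx v = osc 1 0 (2 * pi)"
    unfolding v_def using Dx_eqI[of "\<lambda>x. 1::real" "\<lambda>x. 0"] by (simp add: Dx_add osc_loops Dx_osc)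
  obtain \<epsilon> where \<epsilon>: "\<epsilon> > 0" "(\<lambda>x. u0 + (\<epsilon> * v x) *\<^sub>R axis \<kappa> 1) \<in> fields U"
    using line_fields[OF u0 v] by blast
  show ?thesis
  proof (rule that[OF \<epsilon>(1)])
    fix n :: nat and \<delta> :: real assume \<delta>: "\<delta> = 0 \<or> \<delta> = \<epsilon>"
    define u where "u x = u0 + (\<delta> * v x) *\<^sub>R (axis \<kappa> 1 :: real^'n)" for x
    have u: "u \<in> fields U"
      using \<delta> \<epsilon>(2) u0 by (auto simp: u_def[abs_def] fields_def)
    define h where "h x = \<delta> * Dx v x" for x
    have h: "h \<in> loops" unfolding h_def by (intro loops_intros v)
    have Du: "Dx u = (\<lambda>x. h x *\<^sub>R axis \<kappa> 1)"
      unfolding u_def[abs_def] h_def by (rule Dx_line[OF v])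
    have Dh: "Dx h = osc 1 (\<delta> * (2 * pi)^2) 0"
    proof -
      have "Dx h = (\<lambda>x. \<delta> * Dx (Dx v) x)"
        unfolding h_def by (intro loops_linear(2)[OF bounded_linear_mult_right] Dx_loops v)
      also have "\<dots> = osc 1 (\<delta> * (2 * pi)^2) 0"
        unfolding Dv Dx_osc by (simp add: fun_eq_iff osc_def power2_eq_square)
      finally show ?thesis .
    qed
    have h0: "h 0 = 0" "Dx h 0 = \<delta> * (2 * pi)^2" "Dx (Dx h) 0 = 0"
      unfolding Dh by (simp_all add: h_def Dv osc_0 Dx_osc)
    \<comment> \<open>An odd function: its second and fourth derivatives vanish at \<open>0\<close>,
      and its first and third scale like \<open>n\<close> and \<open>n^3\<close>, which later
      separates the tensors.\<close>
    define q where "q = osc n 0 1"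
    have q: "q \<in> loops" by (simp add: q_def osc_loops)
    have q0: "Dx q 0 = 2 * pi * n" "Dx (Dx q) 0 = 0" "Dx (Dx (Dx q)) 0 = - ((2 * pi * n)^3)"
      "Dx (Dx (Dx (Dx q))) 0 = 0"
      by (simp_all add: q_def Dx_osc osc_0 power3_eq_cube algebra_simps)
    have u_0: "u 0 = u0" by (simp add: u_def v_def osc_0)
    have "jacobi_sum i j m \<kappa> u h flat_test q 0 = jacobi_sum i j m \<kappa> u h flat_test q (1/2)"
      by (rule jacobi_sum_const[OF u Du h flat_test_loops q])
    also have "\<dots> = 0"
      by (rule jacobi_sum_flat[OF u Du h flat_test_loops q]) (fact flat_test_derivs)+
    finally show "- 10240 * pi^4 * (2 * pi * real n)
        * (\<Sum>l\<in>UNIV. G l m u0 * C i j l u0 + C m j l u0 * G l i u0)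
    - 256 * pi^2 * (2 * pi * real n)^3
        * (\<Sum>l\<in>UNIV. G l m u0 * C i j l u0 - 2 * G l m u0 * C j i l u0 - (C m i l u0 + C i m l u0) * G l j u0)
    + \<delta> * (2 * pi)^2 * (256 * pi^2) * (2 * pi * real n)
        * (\<Sum>l\<in>UNIV. G l m u0 * partial \<kappa> (C i j l) u0
            - 2 * G l m u0 * (partial l (C i j \<kappa>) u0 - partial \<kappa> (C i j l) u0)
            + C m j l u0 * (partial \<kappa> (G l i) u0 + 2 * C l i \<kappa> u0)
            - (C m i l u0 + C i m l u0) * C l j \<kappa> u0) = 0"
      using jacobi_sum_value[OF u Du h flat_test_loops q flat_test_derivs(1,2) q0(2,4) h0(1,3), of i j m]
      unfolding q0 h0 u_0 flat_test_derivs by (simp only: mult_minus_left mult_minus_right)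
  qed
qed

text \<open>For \<delta> = 0 the relation involves two tensors, with coefficients proportional to
  \<open>n\<close> and \<open>n^3\<close>; the frequencies 1 and 2 separate them. A nonzero \<delta>
  then isolates the third.\<close>

lemma jacobi_conditions:
  assumes u0: "u0 \<in> U"
  shows "(\<Sum>l\<in>UNIV. G l m u0 * C i j l u0 + C m j l u0 * G l i u0) = 0" (is "?A = 0")
    and "(\<Sum>l\<in>UNIV. G l m u0 * C i j l u0 - 2 * G l m u0 * C j i l u0 - (C m i l u0 + C i m l u0) * G l j u0) = 0" (is "?B = 0")
    and "(\<Sum>l\<in>UNIV. G l m u0 * partial \<kappa> (C i j l) u0
            - 2 * G l m u0 * (partial l (C i j \<kappa>) u0 - partial \<kappa> (C i j l) u0)
            + C m j l u0 * (partial \<kappa> (G l i) u0 + 2 * C l i \<kappa> u0)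
            - (C m i l u0 + C i m l u0) * C l j \<kappa> u0) = 0" (is "?D = 0")
proof -
  obtain \<epsilon> where \<epsilon>: "\<epsilon> > 0" "\<And>n \<delta>. \<delta> = 0 \<or> \<delta> = \<epsilon> \<Longrightarrow> - 10240 * pi^4 * (2 * pi * real n) * ?A
    - 256 * pi^2 * (2 * pi * real n)^3 * ?B
    + \<delta> * (2 * pi)^2 * (256 * pi^2) * (2 * pi * real n) * ?D = 0"
    using jacobi_relation[OF u0, of m i j \<kappa>] by blast
  \<comment> \<open>After division by the fifth power of pi this is a linear system with nonzero
    determinant.\<close>
  have solve: "a = 0 \<and> b = 0"
    if "- 10240 * pi^4 * (2 * pi * real 1) * a - 256 * pi^2 * (2 * pi * real 1)^3 * b = 0"
      and "- 10240 * pi^4 * (2 * pi * real 2) * a - 256 * pi^2 * (2 * pi * real 2)^3 * b = 0" for a b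
  proof -
    have "pi^5 * (- 20480 * a - 2048 * b) = 0" "pi^5 * (- 40960 * a - 16384 * b) = 0"
      using that by (simp_all add: power_numeral_reduce algebra_simps)
    then have "- 20480 * a - 2048 * b = 0" "- 40960 * a - 16384 * b = 0" by simp_all
    then show ?thesis by linarith
  qed
  have "?A = 0 \<and> ?B = 0"
    using \<epsilon>(2)[OF disjI1[OF refl], of 1] \<epsilon>(2)[OF disjI1[OF refl], of 2]
    by (intro solve) (simp_all only: mult_zero_left add_0_right)
  then show A: "?A = 0" and B: "?B = 0" by blast+
  show "?D = 0"
    using \<epsilon>(2)[OF disjI2[OF refl], of 1] \<epsilon>(1) unfolding A B
    by (simp only: mult_zero_right mult_eq_0_iff) simp
qed

end

section \<open>Partial derivatives\<close>

lemma partial_add: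
  assumes "f differentiable (at u)" "g differentiable (at u)"
  shows "partial l (\<lambda>w. f w + g w) u = partial l f u + partial l g u"
  by (subst partial_eqI[OF has_derivative_add[OF partial_has_derivative[OF assms(1)] partial_has_derivative[OF assms(2)]]])
    (simp add: axis_def if_distrib cong: if_cong)

lemma partial_mult:
  assumes "f differentiable (at u)" "g differentiable (at u)"
  shows "partial l (\<lambda>w. f w * g w) u = partial l f u * g u + f u * partial l g u"
  by (subst partial_eqI[OF has_derivative_mult[OF partial_has_derivative[OF assms(1)] partial_has_derivative[OF assms(2)]]])
    (simp add: axis_def if_distrib cong: if_cong)

lemma partial_const: "partial l (\<lambda>w. c) u = 0"
  using partial_eqI[OF has_derivative_const] .

lemma partial_sum:
  assumes "finite I" "\<And>i. i \<in> I \<Longrightarrow> f i differentiable (at u)"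
  shows "partial l (\<lambda>w. \<Sum>i\<in>I. f i w) u = (\<Sum>i\<in>I. partial l (f i) u)"
  using assms by (induction I rule: finite_induct) (auto simp: partial_const partial_add differentiable_sum)

lemma partial_cong_open:
  assumes "open U" "u \<in> U" "f differentiable (at u)" "\<And>w. w \<in> U \<Longrightarrow> f w = g w"
  shows "partial l g u = partial l f u"
  using partial_eqI[OF has_derivative_transform_within_open[OF partial_has_derivative[OF assms(3)] assms(1,2,4)], of l]
    partial_eqI[OF partial_has_derivative[OF assms(3)], of l] by simp

lemma differentiable_prod:
  fixes f :: "'i \<Rightarrow> 'a::real_normed_vector \<Rightarrow> real"
  assumes "finite I" "\<And>i. i \<in> I \<Longrightarrow> f i differentiable (at u)"
  shows "(\<lambda>w. \<Prod>i\<in>I. f i w) differentiable (at u)"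
  using assms by (induction I rule: finite_induct) (auto intro: differentiable_mult)

lemma differentiable_det:
  fixes M :: "'a::real_normed_vector \<Rightarrow> real^'n^'n"
  assumes "\<And>i j. (\<lambda>w. M w $ i $ j) differentiable (at u)"
  shows "(\<lambda>w. det (M w)) differentiable (at u)"
  unfolding det_def
  by (intro differentiable_sum ballI differentiable_mult differentiable_prod assms differentiable_const
      finite finite_permutations)

lemma matrix_inv_mult:
  fixes A :: "real^'n^'n"
  assumes "det A \<noteq> 0"
  shows "A ** matrix_inv A = mat 1" and "matrix_inv A ** A = mat 1"
proof -
  have "\<exists>B. A ** B = mat 1 \<and> B ** A = mat 1"
    using assms by (simp add: invertible_det_nz[symmetric] invertible_def)
  from someI_ex[OF this] show "A ** matrix_inv A = mat 1" "matrix_inv A ** A = mat 1"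
    by (simp_all add: matrix_inv_def)
qed

lemma sum3_rev:
  fixes f :: "'i::finite \<Rightarrow> 'i \<Rightarrow> 'i \<Rightarrow> real"
  shows "(\<Sum>i\<in>UNIV. \<Sum>j\<in>UNIV. \<Sum>k\<in>UNIV. f i j k) = (\<Sum>k\<in>UNIV. \<Sum>j\<in>UNIV. \<Sum>i\<in>UNIV. f i j k)"
proof -
  have "(\<Sum>i\<in>UNIV. \<Sum>j\<in>UNIV. \<Sum>k\<in>UNIV. f i j k) = (\<Sum>i\<in>UNIV. \<Sum>k\<in>UNIV. \<Sum>j\<in>UNIV. f i j k)"
    by (rule sum.cong[OF refl], rule sum.swap)
  also have "\<dots> = (\<Sum>k\<in>UNIV. \<Sum>i\<in>UNIV. \<Sum>j\<in>UNIV. f i j k)"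
    by (rule sum.swap)
  also have "\<dots> = (\<Sum>k\<in>UNIV. \<Sum>j\<in>UNIV. \<Sum>i\<in>UNIV. f i j k)"
    by (rule sum.cong[OF refl], rule sum.swap)
  finally show ?thesis .
qed

section \<open>The conditions in lower indices\<close>

context hamiltonian_operator
begin

definition h :: "'n \<Rightarrow> 'n \<Rightarrow> real^'n \<Rightarrow> real" where "h i j u = g_low gu u i j"

lemma G_h:
  assumes "u \<in> U"
  shows "(\<Sum>s\<in>UNIV. G i s u * h s j u) = (if i = j then 1 else 0)"
    and "(\<Sum>s\<in>UNIV. h i s u * G s j u) = (if i = j then 1 else 0)"
proof -
  have "(gu u ** matrix_inv (gu u)) $ i $ j = mat 1 $ i $ j" "(matrix_inv (gu u) ** gu u) $ i $ j = mat 1 $ i $ j"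
    by (simp_all only: matrix_inv_mult[OF det_gu[OF assms]])
  then show "(\<Sum>s\<in>UNIV. G i s u * h s j u) = (if i = j then 1 else 0)"
    and "(\<Sum>s\<in>UNIV. h i s u * G s j u) = (if i = j then 1 else 0)"
    by (auto simp: G_def h_def g_low_def matrix_matrix_mult_def mat_def)
qed

lemma h_sym:
  assumes "u \<in> U" shows "h i j u = h j i u"
proof -
  have "transpose (gu u) = gu u"
    using assms nondegenerate by (simp add: nondegenerate_hamiltonian_def)
  then have "transpose (matrix_inv (gu u)) = matrix_inv (gu u)"
    using matrix_inv_mult[OF det_gu[OF assms]]
    by (metis matrix_transpose_mul transpose_mat matrix_mul_assoc matrix_mul_lid matrix_mul_rid)
  then show ?thesis
    unfolding h_def g_low_def transpose_def by (metis (no_types, lifting) vec_lambda_beta)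
qed

text \<open>Cramer's rule writes an entry of the inverse as a quotient of determinants of
  differentiable matrices. It holds on all of the open set \<open>U\<close>, so differentiability
  transfers.\<close>

lemma h_differentiable:
  assumes u: "u \<in> U"
  shows "h i j differentiable (at u)"
proof -
  \<comment> \<open>The numerator in Cramer's rule: column \<open>i\<close> of the matrix is
    replaced by the \<open>j\<close>-th unit vector.\<close>
  define M where "M w = (\<chi> a b. if b = i then axis j 1 $ a else gu w $ a $ b)" for w
  have eq: "det (M w) / det (gu w) = h i j w" if w: "w \<in> U" for w
  proof -
    have "gu w *v (matrix_inv (gu w) *v axis j 1) = axis j 1"
      by (simp add: matrix_vector_mul_assoc matrix_inv_mult[OF det_gu[OF w]])
    then have "matrix_inv (gu w) *v axis j 1 = (\<chi> k. det (\<chi> a b. if b = k then axis j 1 $ a else gu w $ a $ b) / det (gu w))"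
      using cramer[OF det_gu[OF w]] by blast
    then have "(matrix_inv (gu w) *v axis j 1) $ i = det (M w) / det (gu w)"
      by (simp add: M_def)
    then show ?thesis
      by (simp add: h_def g_low_def matrix_vector_mul_component inner_axis)
  qed
  have g: "(\<lambda>w. gu w $ a $ b) differentiable (at u)" for a b
    using smooth_on_differentiable[OF smooth_G u, of a b] by (simp add: G_def[abs_def])
  have "(\<lambda>w. M w $ a $ b) differentiable (at u)" for a b
    using g by (cases "b = i") (simp_all add: M_def)
  then have "(\<lambda>w. det (M w) / det (gu w)) differentiable (at u)"
    by (intro differentiable_divide differentiable_det g det_gu[OF u])
  then obtain D where "((\<lambda>w. det (M w) / det (gu w)) has_derivative D) (at u)"
    unfolding differentiable_def by blast
  from has_derivative_transform_within_open[OF this open_U u eq]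
  show ?thesis unfolding differentiable_def by blast
qed

lemmas G_differentiable = smooth_on_differentiable[OF smooth_G]
  and C_differentiable = smooth_on_differentiable[OF smooth_C]

lemma G_h_cancel:
  assumes "u \<in> U"
  shows "(\<Sum>m\<in>UNIV. \<Sum>l\<in>UNIV. h n m u * (G l m u * x l)) = x n"
proof -
  have "(\<Sum>m\<in>UNIV. \<Sum>l\<in>UNIV. h n m u * (G l m u * x l)) = (\<Sum>l\<in>UNIV. (\<Sum>m\<in>UNIV. h n m u * G m l u) * x l)"
    unfolding sum_distrib_right G_sym[OF assms, of _ _]
    by (subst sum.swap) (simp add: G_sym[OF assms] mult_ac)
  then show ?thesis by (simp add: G_h(2)[OF assms] if_distrib[where f="\<lambda>z. z * _"] cong: if_cong)
qed

text \<open>Nondegeneracy makes raising an index injective. Tensor identities in lower indices are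
  therefore proved after raising, one index at a time.\<close>

lemma raise_cancel:
  assumes u: "u \<in> U" and eq: "\<And>m. (\<Sum>l\<in>UNIV. G l m u * x l) = (\<Sum>l\<in>UNIV. G l m u * y l)"
  shows "x n = y n"
proof -
  have "(\<Sum>m\<in>UNIV. h n m u * (\<Sum>l\<in>UNIV. G l m u * x l)) = (\<Sum>m\<in>UNIV. h n m u * (\<Sum>l\<in>UNIV. G l m u * y l))"
    by (simp add: eq)
  then show ?thesis by (simp add: sum_distrib_left G_h_cancel[OF u])
qed

section \<open>The tensor with all indices raised and its contractions\<close>

definition CC :: "'n \<Rightarrow> 'n \<Rightarrow> 'n \<Rightarrow> real^'n \<Rightarrow> real" where
  "CC a b s u = (\<Sum>l\<in>UNIV. G l s u * C a b l u)"

text \<open>Two copies of the tensor contracted over their last indices with the metric. All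
  quadratic terms are reduced to this form, whose only general symmetry is the exchange of the two
  copies.\<close>

definition PP :: "'n \<Rightarrow> 'n \<Rightarrow> 'n \<Rightarrow> 'n \<Rightarrow> real^'n \<Rightarrow> real" where
  "PP a b c d u = (\<Sum>l\<in>UNIV. C a b l u * CC c d l u)"

lemma PP_sym:
  assumes "u \<in> U" shows "PP a b c d u = PP c d a b u"
  unfolding PP_def CC_def sum_distrib_left
  by (subst sum.swap) (simp add: mult_ac G_sym[OF assms])

context
  fixes u assumes u: "u \<in> U"
begin

lemma CC_skew: "CC a b c u = - CC c b a u"
  using jacobi_conditions(1)[OF u, of c a b]
  by (simp add: CC_def sum.distrib G_sym[OF u] mult_ac)

text \<open>The second condition of \<open>jacobi_conditions\<close> has coefficients 1, -2, -1, -1;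
  exchanging outer indices by \<open>CC_skew\<close> in two of its terms turns it into the cyclic
  sum.\<close>

lemma CC_cyclic: "CC a b c u + CC b c a u + CC c a b u = 0"
proof -
  have "CC a b c u - 2 * CC b a c u - (CC c a b u + CC a c b u) = 0"
    using jacobi_conditions(2)[OF u, of c a b]
    by (simp add: CC_def sum.distrib sum_subtractf sum_distrib_left algebra_simps)
  then show ?thesis using CC_skew[of b a c] CC_skew[of a c b] by simp
qed

text \<open>The two rules move a contracted index from the first or middle place to the last one,
  where \<open>PP\<close> contracts.\<close>

lemma CC_first: "CC l a b u = - CC b a l u"
  and CC_middle: "CC a l b u = CC a b l u - CC b a l u"
  using CC_skew[of l a b] CC_skew[of l b a] CC_cyclic[of a l b] by simp_all

lemma sum_C_CC_first: "(\<Sum>l\<in>UNIV. C m j l u * CC l a b u) = - PP m j b a u"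
  and sum_C_CC_middle: "(\<Sum>l\<in>UNIV. C m j l u * CC a l b u) = PP m j a b u - PP m j b a u"
  unfolding PP_def CC_first[of _ a b] CC_middle[of a _ b]
  by (simp_all add: sum_negf sum_subtractf algebra_simps)

text \<open>The first derivatives of \<open>C\<close>, with the last index raised to
  \<open>m\<close> and the derivative index raised to \<open>n\<close>.\<close>

definition TT where
  "TT i j m n = (\<Sum>k\<in>UNIV. G k n u * (\<Sum>l\<in>UNIV. G l m u * partial k (C i j l) u))"

lemma TT_relation:
  "3 * TT i j m n - 2 * TT i j n m - 4 * PP m j n i u + PP m j i n u + PP m i n j u + PP i m n j u = 0"
proof -
  have swap: "TT i j n m = (\<Sum>k\<in>UNIV. G k n u * (\<Sum>l\<in>UNIV. G l m u * partial l (C i j k) u))"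
    unfolding TT_def sum_distrib_left by (subst sum.swap) (simp add: mult_ac)
  have contract: "(\<Sum>k\<in>UNIV. G k n u * (\<Sum>l\<in>UNIV. x l * C (a l) (b l) k u)) = (\<Sum>l\<in>UNIV. x l * CC (a l) (b l) n u)"
    for a b and x :: "'n \<Rightarrow> real"
    unfolding CC_def sum_distrib_left by (subst sum.swap) (simp add: mult_ac)
  have "0 = (\<Sum>k\<in>UNIV. G k n u * (\<Sum>l\<in>UNIV. G l m u * partial k (C i j l) u
            - 2 * G l m u * (partial l (C i j k) u - partial k (C i j l) u)
            + C m j l u * (partial k (G l i) u + 2 * C l i k u)
            - (C m i l u + C i m l u) * C l j k u))"
    by (simp add: jacobi_conditions(3)[OF u])
  also have "\<dots> = (\<Sum>k\<in>UNIV. G k n u * (3 * (\<Sum>l\<in>UNIV. G l m u * partial k (C i j l) u)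
            - 2 * (\<Sum>l\<in>UNIV. G l m u * partial l (C i j k) u)
            + 3 * (\<Sum>l\<in>UNIV. C m j l u * C l i k u) + (\<Sum>l\<in>UNIV. C m j l u * C i l k u)
            - (\<Sum>l\<in>UNIV. C m i l u * C l j k u) - (\<Sum>l\<in>UNIV. C i m l u * C l j k u)))"
    by (intro sum.cong refl arg_cong2[where f="(*)"])
      (simp add: partial_G[OF u] algebra_simps sum.distrib sum_subtractf sum_distrib_left)
  also have "\<dots> = 3 * TT i j m n - 2 * TT i j n m
      + 3 * (\<Sum>l\<in>UNIV. C m j l u * CC l i n u) + (\<Sum>l\<in>UNIV. C m j l u * CC i l n u)
      - (\<Sum>l\<in>UNIV. C m i l u * CC l j n u) - (\<Sum>l\<in>UNIV. C i m l u * CC l j n u)"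
    unfolding contract[symmetric] swap unfolding TT_def
    by (simp add: right_diff_distrib distrib_left sum.distrib sum_subtractf sum_distrib_left mult.left_commute)
  finally show ?thesis unfolding sum_C_CC_first sum_C_CC_middle by simp
qed

text \<open>The relation and its copy with \<open>m\<close> and \<open>n\<close> exchanged are two
  linear equations for \<open>TT i j m n\<close> and \<open>TT i j n m\<close>. The coefficient
  matrix with rows (3, -2) and (-2, 3) is invertible, so the derivatives are expressed by the
  contractions.\<close>

lemma TT_value: "TT i j m n = 2 * PP m j n i u - PP m j i n u + PP m i n j u - PP i m n j u"
  using TT_relation[of i j m n] TT_relation[of i j n m]
  by (simp add: PP_sym[OF u, of n j] PP_sym[OF u, of n i] PP_sym[OF u, of i n])

end

section \<open>The mixed tensor g^{ps} c_{smj} and the algebraic relations in lower indices\<close>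

definition N :: "'n \<Rightarrow> 'n \<Rightarrow> 'n \<Rightarrow> real^'n \<Rightarrow> real" where
  "N p m j u = (\<Sum>r\<in>UNIV. h m r u * C r p j u)"

abbreviation c :: "'n \<Rightarrow> 'n \<Rightarrow> 'n \<Rightarrow> real^'n \<Rightarrow> real" where
  "c i j k \<equiv> (\<lambda>u. c_low gu cu u i j k)"

lemma N_differentiable: "u \<in> U \<Longrightarrow> N p m j differentiable (at u)"
  unfolding N_def by (intro differentiable_sum finite ballI differentiable_mult h_differentiable C_differentiable)

lemma c_eq: "c i j k u = (\<Sum>q\<in>UNIV. h i q u * N q j k u)"
  unfolding c_low_def N_def h_def C_def sum_distrib_left
  by (subst sum.swap) (simp add: mult_ac)

context
  fixes u assumes u: "u \<in> U"
begin

lemma G_h_collapse: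
  "(\<Sum>s\<in>UNIV. \<Sum>q\<in>UNIV. G p s u * (h s q u * x q)) = x p"
  "(\<Sum>s\<in>UNIV. \<Sum>q\<in>UNIV. h p s u * (G s q u * x q)) = x p"
proof -
  have "(\<Sum>s\<in>UNIV. \<Sum>q\<in>UNIV. G p s u * (h s q u * x q)) = (\<Sum>q\<in>UNIV. (\<Sum>s\<in>UNIV. G p s u * h s q u) * x q)"
    unfolding sum_distrib_right by (subst sum.swap) (simp add: mult_ac)
  then show "(\<Sum>s\<in>UNIV. \<Sum>q\<in>UNIV. G p s u * (h s q u * x q)) = x p"
    by (simp add: G_h(1)[OF u] if_distrib[where f="\<lambda>z. z * _"] cong: if_cong)
  have "(\<Sum>s\<in>UNIV. \<Sum>q\<in>UNIV. h p s u * (G s q u * x q)) = (\<Sum>q\<in>UNIV. (\<Sum>s\<in>UNIV. h p s u * G s q u) * x q)"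
    unfolding sum_distrib_right by (subst sum.swap) (simp add: mult_ac)
  then show "(\<Sum>s\<in>UNIV. \<Sum>q\<in>UNIV. h p s u * (G s q u * x q)) = x p"
    by (simp add: G_h(2)[OF u] if_distrib[where f="\<lambda>z. z * _"] cong: if_cong)
qed

lemma N_eq: "N p m j u = (\<Sum>s\<in>UNIV. G p s u * c s m j u)"
  unfolding c_eq sum_distrib_left by (simp add: G_h_collapse)

lemma C_eq: "(\<Sum>m\<in>UNIV. G a m u * N p m j u) = C a p j u"
  unfolding N_def sum_distrib_left by (simp add: G_h_collapse)

lemma raise_N: "(\<Sum>j\<in>UNIV. G j b u * N p m j u) = - C b p m u"
proof -
  have "(\<Sum>j\<in>UNIV. G j b u * N p m j u) = (\<Sum>r\<in>UNIV. h m r u * CC r p b u)"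
    unfolding N_def CC_def sum_distrib_left by (subst sum.swap) (simp add: mult_ac)
  also have "\<dots> = - (\<Sum>r\<in>UNIV. \<Sum>l\<in>UNIV. h m r u * (G r l u * C b p l u))"
    unfolding CC_skew[OF u, of _ p b]
    by (simp add: CC_def sum_negf sum_distrib_left mult_ac G_sym[OF u, of _ r for r])
  finally show ?thesis by (simp add: G_h_collapse)
qed

text \<open>Raising \<open>j\<close> gives the same result on both sides: on the left by
  \<open>raise_N\<close>, which rests on \<open>CC_skew\<close>, and on the right by
  \<open>C_eq\<close>, which merely undoes the definition.\<close>

lemma N_skew: "N p m j u = - N p j m u"
proof (rule raise_cancel[OF u, where x="\<lambda>j. N p m j u" and y="\<lambda>j. - N p j m u"])
  fix b
  show "(\<Sum>j\<in>UNIV. G j b u * N p m j u) = (\<Sum>j\<in>UNIV. G j b u * - N p j m u)"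
    using C_eq[of b p m] by (simp add: raise_N sum_negf G_sym[OF u])
qed

lemma c_skew: "c i j k u = - c i k j u"
  unfolding c_eq by (simp add: sum_negf[symmetric] N_skew[of _ j k])

text \<open>The first two indices of \<open>CC\<close> appear interchanged because the first lower
  index of \<open>c_low\<close> comes from the second upper one.\<close>

lemma raise3_c:
  "(\<Sum>k\<in>UNIV. G k b u * (\<Sum>j\<in>UNIV. G j a u * (\<Sum>i\<in>UNIV. G i p u * c i j k u))) = CC a p b u"
  by (simp add: N_eq[symmetric] C_eq CC_def G_sym[OF u, of _ p] G_sym[OF u, of _ a])

lemma c_cyclic: "c i j k u + c j k i u + c k i j u = 0"
proof -
  \<comment> \<open>The three nested applications of \<open>raise_cancel\<close> strip one free
    index each; the fully raised cyclic sum is an instance of \<open>CC_cyclic\<close>.\<close>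
  have "(\<lambda>k. c i j k u + c j k i u + c k i j u) k = (\<lambda>k. 0) k"
  proof (rule raise_cancel[OF u, where x="\<lambda>k. c i j k u + c j k i u + c k i j u" and y="\<lambda>k. 0"])
    fix b
    have "(\<lambda>j. \<Sum>k\<in>UNIV. G k b u * (c i j k u + c j k i u + c k i j u)) j = (\<lambda>j. 0) j"
    proof (rule raise_cancel[OF u, where x="\<lambda>j. \<Sum>k\<in>UNIV. G k b u * (c i j k u + c j k i u + c k i j u)" and y="\<lambda>j. 0"])
      fix a
      have "(\<lambda>i. \<Sum>j\<in>UNIV. G j a u * (\<Sum>k\<in>UNIV. G k b u * (c i j k u + c j k i u + c k i j u))) i = (\<lambda>i. 0) i"
      proof (rule raise_cancel[OF u, where x="\<lambda>i. \<Sum>j\<in>UNIV. G j a u * (\<Sum>k\<in>UNIV. G k b u * (c i j k u + c j k i u + c k i j u))" and y="\<lambda>i. 0"])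
        fix p
        have "(\<Sum>i\<in>UNIV. G i p u * (\<Sum>j\<in>UNIV. G j a u * (\<Sum>k\<in>UNIV. G k b u * (c i j k u + c j k i u + c k i j u))))
          = (\<Sum>i\<in>UNIV. G i p u * (\<Sum>j\<in>UNIV. G j a u * (\<Sum>k\<in>UNIV. G k b u * c i j k u)))
          + (\<Sum>i\<in>UNIV. G i p u * (\<Sum>j\<in>UNIV. G j a u * (\<Sum>k\<in>UNIV. G k b u * c j k i u)))
          + (\<Sum>i\<in>UNIV. G i p u * (\<Sum>j\<in>UNIV. G j a u * (\<Sum>k\<in>UNIV. G k b u * c k i j u)))"
          by (simp add: distrib_left sum.distrib)
        also have "(\<Sum>i\<in>UNIV. G i p u * (\<Sum>j\<in>UNIV. G j a u * (\<Sum>k\<in>UNIV. G k b u * c i j k u))) = CC a p b u"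
          unfolding raise3_c[of b a p, symmetric] sum_distrib_left
          by (subst sum3_rev) (simp add: mult_ac)
        also have "(\<Sum>i\<in>UNIV. G i p u * (\<Sum>j\<in>UNIV. G j a u * (\<Sum>k\<in>UNIV. G k b u * c j k i u))) = CC b a p u"
          unfolding raise3_c[of p b a, symmetric] sum_distrib_left
          by (rule sum.cong[OF refl], subst sum.swap) (simp add: mult_ac)
        also have "(\<Sum>i\<in>UNIV. G i p u * (\<Sum>j\<in>UNIV. G j a u * (\<Sum>k\<in>UNIV. G k b u * c k i j u))) = CC p b a u"
          unfolding raise3_c[of a p b, symmetric] sum_distrib_left
          by (subst sum.swap) (simp add: mult_ac)
        finally show "(\<Sum>i\<in>UNIV. G i p u * (\<Sum>j\<in>UNIV. G j a u * (\<Sum>k\<in>UNIV. G k b u * (c i j k u + c j k i u + c k i j u))))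
          = (\<Sum>i\<in>UNIV. G i p u * 0)"
          using CC_cyclic[OF u, of a p b] by simp
      qed
      then show "(\<Sum>j\<in>UNIV. G j a u * (\<Sum>k\<in>UNIV. G k b u * (c i j k u + c j k i u + c k i j u)))
        = (\<Sum>j\<in>UNIV. G j a u * 0)" by simp
    qed
    then show "(\<Sum>k\<in>UNIV. G k b u * (c i j k u + c j k i u + c k i j u)) = (\<Sum>k\<in>UNIV. G k b u * 0)" by simp
  qed
  then show ?thesis by simp
qed

end

section \<open>First derivatives of the coefficient tensors\<close>

lemma partial_C:
  assumes u: "u \<in> U"
  shows "partial k (C a p j) u
    = (\<Sum>m\<in>UNIV. (C a m k u + C m a k u) * N p m j u + G a m u * partial k (N p m j) u)"
proof -
  have "partial k (\<lambda>w. \<Sum>m\<in>UNIV. G a m w * N p m j w) u = partial k (C a p j) u"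
    by (rule partial_cong_open[OF open_U u C_differentiable[OF u]]) (simp add: C_eq)
  then show ?thesis
    by (simp add: partial_sum partial_mult G_differentiable N_differentiable u differentiable_mult partial_G)
qed

text \<open>All lower indices are raised, which leaves an identity for the contractions \<^term>\<open>PP\<close>.\<close>

lemma partial_N:
  assumes u: "u \<in> U"
  shows "partial k (N p m j) u = (\<Sum>b\<in>UNIV. N p b k u * N b m j u)"
proof -
  \<comment> \<open>By \<open>partial_C\<close> and \<open>C_eq\<close> this is the difference of
    the two sides of the claim with the index \<open>m\<close> raised to \<open>a\<close>.\<close>
  define E where "E a j k = partial k (C a p j) u - (\<Sum>m\<in>UNIV. (C a m k u + C m a k u) * N p m j u)
      - (\<Sum>b\<in>UNIV. N p b k u * C a b j u)" for a j k
  have E_j: "(\<Sum>j\<in>UNIV. G j b u * E a j k) = (\<Sum>j\<in>UNIV. G j b u * partial k (C a p j) u)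
      + (\<Sum>m\<in>UNIV. C b p m u * (C a m k u + C m a k u)) - (\<Sum>m\<in>UNIV. CC a m b u * N p m k u)" for a b k
  proof -
    have "(\<Sum>j\<in>UNIV. G j b u * (\<Sum>m\<in>UNIV. (C a m k u + C m a k u) * N p m j u))
        = (\<Sum>m\<in>UNIV. (C a m k u + C m a k u) * (\<Sum>j\<in>UNIV. G j b u * N p m j u))"
      unfolding sum_distrib_left by (subst sum.swap) (simp add: mult_ac)
    also have "\<dots> = - (\<Sum>m\<in>UNIV. C b p m u * (C a m k u + C m a k u))"
      by (simp add: raise_N[OF u] sum_negf mult_ac)
    finally have 1: "(\<Sum>j\<in>UNIV. G j b u * (\<Sum>m\<in>UNIV. (C a m k u + C m a k u) * N p m j u)) = \<dots>" .
    have 2: "(\<Sum>j\<in>UNIV. G j b u * (\<Sum>m\<in>UNIV. N p m k u * C a m j u)) = (\<Sum>m\<in>UNIV. CC a m b u * N p m k u)"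
      unfolding CC_def sum_distrib_left sum_distrib_right by (subst sum.swap) (simp add: mult_ac)
    show ?thesis
      unfolding E_def by (simp add: right_diff_distrib sum_subtractf 1 2)
  qed
  \<comment> \<open>With \<open>j\<close> and \<open>k\<close> raised as well, the derivative
    becomes \<open>TT u a p b d\<close> and all products become contractions \<open>PP\<close>; the
    value of \<open>TT\<close> cancels them exactly.\<close>
  have E_jk: "(\<Sum>k\<in>UNIV. G k d u * (\<Sum>j\<in>UNIV. G j b u * E a j k)) = 0" for a b d
  proof -
    have 1: "(\<Sum>k\<in>UNIV. G k d u * (\<Sum>m\<in>UNIV. C b p m u * (C a m k u + C m a k u)))
        = (\<Sum>m\<in>UNIV. C b p m u * CC a m d u) + (\<Sum>m\<in>UNIV. C b p m u * CC m a d u)"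
      unfolding CC_def sum_distrib_left sum.distrib[symmetric] by (subst sum.swap) (simp add: algebra_simps)
    have "(\<Sum>k\<in>UNIV. G k d u * (\<Sum>m\<in>UNIV. CC a m b u * N p m k u))
       = (\<Sum>m\<in>UNIV. CC a m b u * (\<Sum>k\<in>UNIV. G k d u * N p m k u))"
      unfolding sum_distrib_left by (subst sum.swap) (simp add: mult_ac)
    then have 2: "(\<Sum>k\<in>UNIV. G k d u * (\<Sum>m\<in>UNIV. CC a m b u * N p m k u)) = - (\<Sum>m\<in>UNIV. C d p m u * CC a m b u)"
      by (simp add: raise_N[OF u] sum_negf mult_ac)
    have "(\<Sum>k\<in>UNIV. G k d u * (\<Sum>j\<in>UNIV. G j b u * E a j k))
        = TT u a p b d + ((\<Sum>m\<in>UNIV. C b p m u * CC a m d u) + (\<Sum>m\<in>UNIV. C b p m u * CC m a d u))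
          + (\<Sum>m\<in>UNIV. C d p m u * CC a m b u)"
      unfolding E_j by (simp only: right_diff_distrib distrib_left[of "G _ _ _"] sum_subtractf sum.distrib TT_def[OF u] 1 2)
    then show ?thesis
      unfolding TT_value[OF u] sum_C_CC_first[OF u] sum_C_CC_middle[OF u]
      by (simp add: PP_sym[OF u, of d p])
  qed
  have E: "E a j k = 0" for a j k
  proof -
    have "(\<lambda>k. E a j k) k = (\<lambda>k. 0) k"
    proof (rule raise_cancel[OF u, where x="\<lambda>k. E a j k" and y="\<lambda>k. 0"])
      fix d
      have "(\<lambda>j. \<Sum>k\<in>UNIV. G k d u * E a j k) j = (\<lambda>j. 0) j"
      proof (rule raise_cancel[OF u, where x="\<lambda>j. \<Sum>k\<in>UNIV. G k d u * E a j k" and y="\<lambda>j. 0"])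
        fix b
        have "(\<Sum>j\<in>UNIV. G j b u * (\<Sum>k\<in>UNIV. G k d u * E a j k)) = (\<Sum>k\<in>UNIV. G k d u * (\<Sum>j\<in>UNIV. G j b u * E a j k))"
          unfolding sum_distrib_left by (subst sum.swap) (simp add: mult_ac)
        then show "(\<Sum>j\<in>UNIV. G j b u * (\<Sum>k\<in>UNIV. G k d u * E a j k)) = (\<Sum>j\<in>UNIV. G j b u * 0)"
          by (simp add: E_jk)
      qed
      then show "(\<Sum>k\<in>UNIV. G k d u * E a j k) = (\<Sum>k\<in>UNIV. G k d u * 0)" by simp
    qed
    then show ?thesis by simp
  qed
  have "(\<lambda>m. partial k (N p m j) u) m = (\<lambda>m. \<Sum>b\<in>UNIV. N p b k u * N b m j u) m"
  proof (rule raise_cancel[OF u, where x="\<lambda>m. partial k (N p m j) u" and y="\<lambda>m. \<Sum>b\<in>UNIV. N p b k u * N b m j u"])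
    fix a
    have "(\<Sum>m\<in>UNIV. G a m u * partial k (N p m j) u) = (\<Sum>b\<in>UNIV. N p b k u * C a b j u)"
      using E[of a j k] by (simp add: E_def partial_C[OF u] sum.distrib)
    also have "\<dots> = (\<Sum>b\<in>UNIV. N p b k u * (\<Sum>m\<in>UNIV. G a m u * N b m j u))"
      by (simp add: C_eq[OF u])
    also have "\<dots> = (\<Sum>m\<in>UNIV. G a m u * (\<Sum>b\<in>UNIV. N p b k u * N b m j u))"
      unfolding sum_distrib_left by (subst sum.swap) (simp add: mult_ac)
    finally show "(\<Sum>m\<in>UNIV. G m a u * partial k (N p m j) u) = (\<Sum>m\<in>UNIV. G m a u * (\<Sum>b\<in>UNIV. N p b k u * N b m j u))"
      by (simp only: G_sym[OF u, of a])
  qed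
  then show ?thesis by simp
qed

text \<open>The product of \<open>h\<close> and \<open>G\<close> is the identity on
  \<open>U\<close>; differentiating it and inserting \<open>partial_G\<close> determines the
  derivative of \<open>h\<close> after raising an index.\<close>

lemma partial_h:
  assumes u: "u \<in> U"
  shows "partial l (h i m) u = - c i m l u - c m i l u"
proof -
  have "(\<lambda>s. partial l (h i s) u) m = (\<lambda>s. - c i s l u - c s i l u) m"
  proof (rule raise_cancel[OF u, where x="\<lambda>s. partial l (h i s) u" and y="\<lambda>s. - c i s l u - c s i l u"])
    fix a
    have "partial l (\<lambda>w. \<Sum>s\<in>UNIV. h i s w * G s a w) u = partial l (\<lambda>w. if i = a then 1 else 0) u"
      by (rule partial_cong_open[OF open_U u]) (simp_all add: G_h)
    then have "(\<Sum>s\<in>UNIV. partial l (h i s) u * G s a u + h i s u * (C s a l u + C a s l u)) = 0"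
      by (simp add: partial_const partial_sum partial_mult partial_G differentiable_mult G_differentiable h_differentiable u)
    moreover have "(\<Sum>s\<in>UNIV. G s a u * c i s l u) = (\<Sum>s\<in>UNIV. h i s u * C a s l u)"
    proof -
      have "(\<Sum>s\<in>UNIV. G s a u * c i s l u) = (\<Sum>q\<in>UNIV. h i q u * (\<Sum>s\<in>UNIV. G a s u * N q s l u))"
        unfolding c_eq sum_distrib_left by (subst sum.swap) (simp add: mult_ac G_sym[OF u, of a])
      then show ?thesis by (simp add: C_eq[OF u])
    qed
    moreover have "(\<Sum>s\<in>UNIV. G s a u * c s i l u) = (\<Sum>s\<in>UNIV. h i s u * C s a l u)"
      using N_eq[OF u, of a i l] by (simp add: N_def G_sym[OF u, of a])
    ultimately show "(\<Sum>s\<in>UNIV. G s a u * partial l (h i s) u) = (\<Sum>s\<in>UNIV. G s a u * (- c i s l u - c s i l u))"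
      by (simp add: sum.distrib distrib_left right_diff_distrib sum_subtractf sum_negf mult_ac)
  qed
  then show ?thesis by simp
qed

lemma c_differentiable: "u \<in> U \<Longrightarrow> c i j k differentiable (at u)"
  unfolding c_eq by (intro differentiable_sum finite ballI differentiable_mult h_differentiable N_differentiable)

text \<open>In the product rule for \<open>c\<close> as \<open>h\<close> times \<open>N\<close>, the
  contribution of \<open>partial_N\<close> cancels the first of the two terms from
  \<open>partial_h\<close>.\<close>

lemma partial_c:
  assumes u: "u \<in> U"
  shows "partial l (c m j k) u = - (\<Sum>s\<in>UNIV. c s m l u * N s j k u)"
proof -
  have "partial l (c m j k) u = (\<Sum>s\<in>UNIV. (- c m s l u - c s m l u) * N s j k u + h m s u * (\<Sum>b\<in>UNIV. N s b l u * N b j k u))"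
    unfolding c_eq[where i=m and j=j]
    by (simp add: partial_sum partial_mult differentiable_mult h_differentiable N_differentiable u partial_N partial_h)
  moreover have "(\<Sum>s\<in>UNIV. h m s u * (\<Sum>b\<in>UNIV. N s b l u * N b j k u)) = (\<Sum>b\<in>UNIV. c m b l u * N b j k u)"
    unfolding c_eq[where i=m and k=l] sum_distrib_left sum_distrib_right by (subst sum.swap) (simp add: mult_ac)
  ultimately show ?thesis
    by (simp add: sum.distrib left_diff_distrib sum_subtractf sum_negf)
qed

text \<open>The cyclic relation holds throughout \<open>U\<close> and may be differentiated;
  \<open>partial_c\<close> turns the derivatives into products.\<close>

lemma c_quadratic:
  assumes u: "u \<in> U"
  shows "(\<Sum>s\<in>UNIV. c s i l u * N s j k u) + (\<Sum>s\<in>UNIV. c s j l u * N s k i u) + (\<Sum>s\<in>UNIV. c s k l u * N s i j u) = 0"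
proof -
  have "partial l (\<lambda>w. c i j k w + c j k i w + c k i j w) u = partial l (\<lambda>w. 0) u"
    by (rule partial_cong_open[OF open_U u]) (simp_all add: c_cyclic)
  then show ?thesis
    by (simp add: partial_add differentiable_add c_differentiable u partial_const partial_c)
qed

end

section \<open>Involution\<close>

text \<open>A function linear in the Jacobi matrix is its own derivative, so eliminating second
  derivatives amounts to evaluating it at the matrix that \<Phi> prescribes for the derivative of
  the Jacobi matrix along \<open>l\<close>.\<close>

lemma total_deriv_linear:
  fixes F :: "real^'n \<Rightarrow> real^'n^'n \<Rightarrow> real"
  assumes "linear (F u)"
  shows "total_deriv \<Phi> l F u A = partial l (\<lambda>w. F w A) u + F u (\<chi> m i. \<Phi> u A m i l)"
proof -
  have "frechet_derivative (F u) (at A) = F u"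
    using bounded_linear_imp_has_derivative[OF linear_conv_bounded_linear[THEN iffD1, OF assms]]
    by (metis frechet_derivative_at)
  moreover have "F u (\<chi> m i. \<Phi> u A m i l) = (\<Sum>m\<in>UNIV. \<Sum>i\<in>UNIV. F u (axis m (axis i 1)) * \<Phi> u A m i l)"
  proof -
    have "(\<Sum>x\<in>UNIV. \<Sum>y\<in>UNIV. if i = x then if j = y then f x y else 0 else 0) = f i j"
      for i j :: 'n and f :: "'n \<Rightarrow> 'n \<Rightarrow> real"
    proof -
      have "(\<Sum>y\<in>UNIV. if i = x then if j = y then f x y else 0 else 0) = (if i = x then f x j else 0)" for x
        by simp
      then show ?thesis by simp
    qed
    then have "(\<chi> m i. \<Phi> u A m i l) = (\<Sum>m\<in>UNIV. \<Sum>i\<in>UNIV. \<Phi> u A m i l *\<^sub>R axis m (axis i 1))"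
      by (simp add: vec_eq_iff axis_def if_distrib[where f="\<lambda>z. z $ _"] if_distrib[where f="\<lambda>z. _ * z"] cong: if_cong)
    then show ?thesis
      by (simp add: linear_sum[OF assms] linear_cmul[OF assms] mult.commute)
  qed
  ultimately show ?thesis by (simp add: total_deriv_def)
qed

lemma partial_diff:
  assumes "f differentiable (at u)" "g differentiable (at u)"
  shows "partial l (\<lambda>w. f w - g w) u = partial l f u - partial l g u"
  by (subst partial_eqI[OF has_derivative_diff[OF partial_has_derivative[OF assms(1)] partial_has_derivative[OF assms(2)]]])
    (simp add: axis_def if_distrib cong: if_cong)

lemma partial_coefficients:
  fixes f :: "'m::finite \<Rightarrow> real^'n \<Rightarrow> real"
  assumes "\<And>m. f m differentiable (at u)"
  shows "partial l (\<lambda>w. \<Sum>m\<in>UNIV. f m w * x m) u = (\<Sum>m\<in>UNIV. partial l (f m) u * x m)"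
  by (subst partial_sum) (simp_all add: assms partial_mult differentiable_mult partial_const)

context hamiltonian_operator
begin

lemma first_order_eq:
  "first_order gu cu (Symm i j) u A = (\<Sum>m\<in>UNIV. h i m u * A $ m $ j) - (\<Sum>m\<in>UNIV. h j m u * A $ m $ i)"
  "first_order gu cu (Cyc i k l) u A =
    (\<Sum>m\<in>UNIV. c m k l u * A $ m $ i) + (\<Sum>m\<in>UNIV. c m i k u * A $ m $ l) + (\<Sum>m\<in>UNIV. c m l i u * A $ m $ k)"
  by (simp_all add: h_def sum.distrib)

lemma second_order_eq:
  assumes "u \<in> U"
  shows "second_order gu cu u A k i j = (\<Sum>m\<in>UNIV. N k m j u * A $ m $ i) + (\<Sum>m\<in>UNIV. N k m i u * A $ m $ j)"
  unfolding second_order_def N_eq[OF assms] sum_distrib_right sum.distrib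
  by (intro arg_cong2[where f="(+)"]; subst sum.swap) (simp_all add: G_def)

lemma linear_first_order: "linear (first_order gu cu r u)"
  by (cases r; intro linearI)
    (simp_all add: first_order_eq algebra_simps sum.distrib sum_distrib_left del: first_order.simps)

lemma linear_second_order: "linear (\<lambda>A. second_order gu cu u A k i j)"
  by (intro linearI) (simp_all add: second_order_def algebra_simps sum.distrib sum_distrib_left)

context
  fixes u assumes u: "u \<in> U"
begin

lemma h_second_order:
  "(\<Sum>m\<in>UNIV. h i m u * second_order gu cu u A m j l) = (\<Sum>a\<in>UNIV. c i a l u * A $ a $ j) + (\<Sum>a\<in>UNIV. c i a j u * A $ a $ l)"
proof -
  have "(\<Sum>m\<in>UNIV. h i m u * (\<Sum>a\<in>UNIV. N m a l u * x a)) = (\<Sum>a\<in>UNIV. c i a l u * x a)" for l x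
    unfolding c_eq sum_distrib_left sum_distrib_right by (subst sum.swap) (simp add: mult_ac)
  then show ?thesis by (simp add: second_order_eq[OF u] distrib_left sum.distrib)
qed

lemma total_deriv_Symm:
  "total_deriv (second_order gu cu) l (first_order gu cu (Symm i j)) u A = first_order gu cu (Cyc i j l) u A"
proof -
  have "partial l (\<lambda>w. first_order gu cu (Symm i j) w A) u
      = (\<Sum>m\<in>UNIV. (- c i m l u - c m i l u) * A $ m $ j) - (\<Sum>m\<in>UNIV. (- c j m l u - c m j l u) * A $ m $ i)"
  proof -
    have "partial l (\<lambda>w. first_order gu cu (Symm i j) w A) u
        = (\<Sum>m\<in>UNIV. partial l (h i m) u * A $ m $ j) - (\<Sum>m\<in>UNIV. partial l (h j m) u * A $ m $ i)"
      unfolding first_order_eq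
      by (subst partial_diff)
        (simp_all add: partial_coefficients h_differentiable u differentiable_sum differentiable_mult)
    then show ?thesis by (simp add: partial_h u)
  qed
  moreover have "(- c i m l u - c m i l u) * A $ m $ j - (- c j m l u - c m j l u) * A $ m $ i
      + ((c i m l u * A $ m $ j + c i m j u * A $ m $ l) - (c j m l u * A $ m $ i + c j m i u * A $ m $ l))
    = c m j l u * A $ m $ i + c m i j u * A $ m $ l + c m l i u * A $ m $ j" for m
  proof -
    \<comment> \<open>The coefficients of the entries \<open>A $ m $ j\<close> and
      \<open>A $ m $ i\<close> match after cancellation and one use of skew-symmetry; that of
      \<open>A $ m $ l\<close> needs the cyclic relation.\<close>
    have "c i m j u = c m i j u + c j m i u" "c m i l u = - c m l i u"
      using c_cyclic[OF u, where i=i and j=m and k=j] c_skew[OF u, where i=m and j=j and k=i]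
        c_skew[OF u, where i=j and j=i and k=m] c_skew[OF u, where i=m and j=i and k=l] by simp_all
    then show ?thesis by (simp only:) (simp add: algebra_simps)
  qed
  ultimately show ?thesis
    unfolding total_deriv_linear[of "first_order gu cu (Symm i j)", OF linear_first_order]
    unfolding first_order_eq
    by (simp only: vec_lambda_beta h_second_order sum.distrib[symmetric] sum_subtractf[symmetric])
qed

text \<open>Both sides are the contraction of two copies of \<open>N\<close> with the symmetric
  matrix \<open>h\<close>.\<close>

lemma c_N_commute: "(\<Sum>s\<in>UNIV. c s k l u * N s a p u) = (\<Sum>s\<in>UNIV. c s a p u * N s k l u)"
  unfolding c_eq sum_distrib_right by (subst sum.swap) (simp add: mult_ac h_sym[OF u])

lemma c_second_order:
  "(\<Sum>m\<in>UNIV. c m k l u * second_order gu cu u A m i p)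
    = (\<Sum>a\<in>UNIV. (\<Sum>s\<in>UNIV. c s a p u * N s k l u) * A $ a $ i)
    + (\<Sum>a\<in>UNIV. (\<Sum>s\<in>UNIV. c s a i u * N s k l u) * A $ a $ p)"
proof -
  have "(\<Sum>m\<in>UNIV. c m k l u * (\<Sum>a\<in>UNIV. N m a p u * x a)) = (\<Sum>a\<in>UNIV. (\<Sum>s\<in>UNIV. c s a p u * N s k l u) * x a)" for p x
  proof -
    have "(\<Sum>m\<in>UNIV. c m k l u * (\<Sum>a\<in>UNIV. N m a p u * x a)) = (\<Sum>a\<in>UNIV. (\<Sum>s\<in>UNIV. c s k l u * N s a p u) * x a)"
      unfolding sum_distrib_left sum_distrib_right by (subst sum.swap) (simp add: mult_ac)
    then show ?thesis by (simp only: c_N_commute)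
  qed
  then show ?thesis by (simp add: second_order_eq[OF u] distrib_left sum.distrib)
qed

text \<open>Differentiating the coefficients cancels those substituted terms in which the direction
  \<open>p\<close> falls on a coefficient. The rest multiplies the entries \<open>A $ a $ p\<close>,
  and its coefficients vanish by \<open>c_quadratic\<close>.\<close>

lemma total_deriv_Cyc: "total_deriv (second_order gu cu) p (first_order gu cu (Cyc i k l)) u A = 0"
proof -
  have d: "partial p (\<lambda>w. \<Sum>m\<in>UNIV. c m k l w * A $ m $ i) u = - (\<Sum>m\<in>UNIV. (\<Sum>s\<in>UNIV. c s m p u * N s k l u) * A $ m $ i)" for i k l
    by (subst partial_coefficients) (simp_all add: c_differentiable u partial_c sum_negf)
  have diff: "(\<lambda>w. \<Sum>m\<in>UNIV. c m k l w * A $ m $ i) differentiable (at u)" for i k l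
    by (intro differentiable_sum finite ballI differentiable_mult differentiable_const c_differentiable u)
  have "partial p (\<lambda>w. first_order gu cu (Cyc i k l) w A) u
      = - (\<Sum>m\<in>UNIV. (\<Sum>s\<in>UNIV. c s m p u * N s k l u) * A $ m $ i)
        - (\<Sum>m\<in>UNIV. (\<Sum>s\<in>UNIV. c s m p u * N s i k u) * A $ m $ l)
        - (\<Sum>m\<in>UNIV. (\<Sum>s\<in>UNIV. c s m p u * N s l i u) * A $ m $ k)"
    unfolding first_order_eq by (simp add: partial_add differentiable_add diff d)
  moreover have "(\<Sum>a\<in>UNIV. (\<Sum>s\<in>UNIV. c s a i u * N s k l u) * A $ a $ p)
      + (\<Sum>a\<in>UNIV. (\<Sum>s\<in>UNIV. c s a l u * N s i k u) * A $ a $ p)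
      + (\<Sum>a\<in>UNIV. (\<Sum>s\<in>UNIV. c s a k u * N s l i u) * A $ a $ p) = 0"
  proof -
    have "(\<Sum>s\<in>UNIV. c s a i u * N s k l u) + (\<Sum>s\<in>UNIV. c s a l u * N s i k u) + (\<Sum>s\<in>UNIV. c s a k u * N s l i u) = 0" for a
      using c_quadratic[OF u, where i=i and l=a and j=k and k=l] c_skew[OF u, where j=a]
      by (simp add: sum_negf)
    then show ?thesis
      by (simp only: sum.distrib[symmetric] distrib_right[symmetric] mult_zero_left sum.neutral_const)
  qed
  ultimately show ?thesis
    unfolding total_deriv_linear[of "first_order gu cu (Cyc i k l)", OF linear_first_order]
    unfolding first_order_eq
    by (simp add: c_second_order)
qed

lemma total_deriv_second_order:
  "total_deriv (second_order gu cu) k (\<lambda>w B. second_order gu cu w B p i j) u A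
    = total_deriv (second_order gu cu) i (\<lambda>w B. second_order gu cu w B p k j) u A"
proof -
  \<comment> \<open>By \<open>partial_N\<close>, both the derivatives of the coefficients and the
    substituted second derivatives are sums of such double products. All six permutations of
    \<open>i\<close>, \<open>j\<close>, \<open>k\<close> occur once, so the result is
    symmetric.\<close>
  define Q where "Q x y z = (\<Sum>b\<in>UNIV. N p b x u * (\<Sum>m\<in>UNIV. N b m y u * A $ m $ z))" for x y z
  have "total_deriv (second_order gu cu) k (\<lambda>w B. second_order gu cu w B p i j) u A
      = Q k j i + Q k i j + Q j k i + Q j i k + Q i k j + Q i j k" for i j k
  proof -
    have diff: "(\<lambda>w. \<Sum>m\<in>UNIV. N p m j w * A $ m $ i) differentiable (at u)" for i j
      by (intro differentiable_sum finite ballI differentiable_mult differentiable_const N_differentiable u)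
    have d: "partial k (\<lambda>w. \<Sum>m\<in>UNIV. N p m j w * A $ m $ i) u = Q k j i" for i j
      by (subst partial_coefficients)
        (simp_all add: N_differentiable u partial_N Q_def sum_distrib_left sum_distrib_right mult.assoc, rule sum.swap)
    have "partial k (\<lambda>w. second_order gu cu w A p i j) u
      = partial k (\<lambda>w. (\<Sum>m\<in>UNIV. N p m j w * A $ m $ i) + (\<Sum>m\<in>UNIV. N p m i w * A $ m $ j)) u"
      by (rule partial_cong_open[OF open_U u]) (simp_all add: differentiable_add diff second_order_eq)
    also have "\<dots> = Q k j i + Q k i j"
      by (simp add: partial_add diff d)
    finally have 1: "partial k (\<lambda>w. second_order gu cu w A p i j) u = \<dots>" .
    show ?thesis
      unfolding total_deriv_linear[of "\<lambda>w B. second_order gu cu w B p i j", OF linear_second_order] 1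
      by (simp add: second_order_eq[OF u] Q_def distrib_left sum.distrib)
  qed
  then show ?thesis by simp
qed

end

lemma in_involution: "in_involution U (first_order gu cu) (second_order gu cu)"
  unfolding in_involution_def
proof (intro ballI allI impI conjI)
  fix u A r l
  assume u: "u \<in> U" and R: "\<forall>r. first_order gu cu r u A = 0"
  show "total_deriv (second_order gu cu) l (first_order gu cu r) u A = 0"
    by (cases r) (simp_all only: total_deriv_Symm[OF u] total_deriv_Cyc[OF u] R)
qed (rule total_deriv_second_order)

end

section \<open>The dimension of the solution space\<close>

text \<open>The function \<open>y t * exp (- K * t)\<close> is nonincreasing and starts at zero,
  hence is at most zero at \<open>1\<close>.\<close>

lemma gronwall_zero:
  fixes y :: "real \<Rightarrow> real"
  assumes "\<And>t. t \<in> {0..1} \<Longrightarrow> (y has_real_derivative y' t) (at t)"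
    and "\<And>t. t \<in> {0..1} \<Longrightarrow> y' t \<le> K * y t" and "y 0 = 0" and "y 1 \<ge> 0"
  shows "y 1 = 0"
proof -
  have "y 1 * exp (- K * 1) \<le> y 0 * exp (- K * 0)"
  proof (rule DERIV_nonpos_imp_nonincreasing[of 0 1 "\<lambda>t. y t * exp (- K * t)"])
    fix t :: real assume "0 \<le> t" "t \<le> 1"
    then have t: "t \<in> {0..1}" by simp
    have "((\<lambda>t. y t * exp (- K * t)) has_real_derivative (y' t - K * y t) * exp (- K * t)) (at t)"
      by (auto intro!: derivative_eq_intros assms(1)[OF t] simp: algebra_simps)
    moreover have "(y' t - K * y t) * exp (- K * t) \<le> 0"
      using assms(2)[OF t] by (simp add: mult_le_0_iff)
    ultimately show "\<exists>d. ((\<lambda>t. y t * exp (- K * t)) has_real_derivative d) (at t) \<and> d \<le> 0" by blast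
  qed simp
  then show ?thesis using assms(3,4) by (simp add: mult_le_0_iff)
qed

lemma solutionsD:
  assumes "V \<in> solutions W R \<Phi>" "u \<in> W"
  shows "(\<lambda>w. V w $ m) differentiable (at u)" "partial i (\<lambda>w. V w $ m) differentiable (at u)"
    "R r u (jacobi_matrix V u) = 0" "partial j (partial i (\<lambda>w. V w $ k)) u = \<Phi> u (jacobi_matrix V u) k i j"
  using assms unfolding solutions_def by blast+

lemma jacobi_matrix_component: "jacobi_matrix V u $ m $ i = partial i (\<lambda>w. V w $ m) u"
  by (simp add: jacobi_matrix_def)

lemma partial_cmul:
  assumes "f differentiable (at u)"
  shows "partial l (\<lambda>w. a * f w) u = a * partial l f u"
  using partial_mult[OF differentiable_const assms, of l a] by (simp add: partial_const)

text \<open>Linearity of the relations and of \<Phi> in the Jacobi matrix makes solutions closed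
  under \<open>V + a V'\<close>, the step of the induction over finite sums. Openness of
  \<open>W\<close> allows the formula for the first partial derivatives to be differentiated
  again.\<close>

lemma solutions_combine:
  fixes V V' :: "real^'n \<Rightarrow> real^'n"
  assumes W: "open W" and V: "V \<in> solutions W R \<Phi>" and V': "V' \<in> solutions W R \<Phi>"
    and R: "\<And>r u. linear (R r u)" and \<Phi>: "\<And>u k i j. linear (\<lambda>A. \<Phi> u A k i j)"
  shows "(\<lambda>w. V w + a *\<^sub>R V' w) \<in> solutions W R \<Phi>"
    and "u \<in> W \<Longrightarrow> jacobi_matrix (\<lambda>w. V w + a *\<^sub>R V' w) u = jacobi_matrix V u + a *\<^sub>R jacobi_matrix V' u"
proof -
  note D = solutionsD[OF V] and D' = solutionsD[OF V']
  have p: "partial i (\<lambda>w. (V w + a *\<^sub>R V' w) $ m) u = partial i (\<lambda>w. V w $ m) u + a * partial i (\<lambda>w. V' w $ m) u"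
    if "u \<in> W" for u m i
    using D(1)[OF that] D'(1)[OF that]
    by (simp add: partial_add partial_cmul differentiable_mult)
  show J: "jacobi_matrix (\<lambda>w. V w + a *\<^sub>R V' w) u = jacobi_matrix V u + a *\<^sub>R jacobi_matrix V' u" if "u \<in> W" for u
    by (simp add: vec_eq_iff jacobi_matrix_component p[OF that] del: vector_add_component vector_scaleR_component)
      (simp add: jacobi_matrix_component)
  have diff: "(\<lambda>w. partial i (\<lambda>w. V w $ m) w + a * partial i (\<lambda>w. V' w $ m) w) differentiable (at u)" if "u \<in> W" for u m i
    using D(2)[OF that] D'(2)[OF that] by (intro differentiable_add differentiable_mult differentiable_const)
  show "(\<lambda>w. V w + a *\<^sub>R V' w) \<in> solutions W R \<Phi>"
    unfolding solutions_def mem_Collect_eq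
  proof (intro ballI conjI allI)
    fix u m i r k j assume u: "u \<in> W"
    show "(\<lambda>w. (V w + a *\<^sub>R V' w) $ m) differentiable (at u)"
      using D(1)[OF u] D'(1)[OF u] by (simp add: differentiable_add differentiable_mult)
    obtain T where "((\<lambda>w. partial i (\<lambda>w. V w $ m) w + a * partial i (\<lambda>w. V' w $ m) w) has_derivative T) (at u)"
      using diff[OF u] unfolding differentiable_def by blast
    from has_derivative_transform_within_open[OF this W u p[symmetric]]
    show "partial i (\<lambda>w. (V w + a *\<^sub>R V' w) $ m) differentiable (at u)"
      unfolding differentiable_def by blast
    show "R r u (jacobi_matrix (\<lambda>w. V w + a *\<^sub>R V' w) u) = 0"
      using D(3)[OF u] D'(3)[OF u] by (simp add: J[OF u] linear_add[OF R] linear_cmul[OF R])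
    have "partial j (partial i (\<lambda>w. (V w + a *\<^sub>R V' w) $ k)) u
        = partial j (\<lambda>w. partial i (\<lambda>w. V w $ k) w + a * partial i (\<lambda>w. V' w $ k) w) u"
      by (rule partial_cong_open[OF W u diff[OF u]]) (simp only: p)
    also have "\<dots> = \<Phi> u (jacobi_matrix V u) k i j + a * \<Phi> u (jacobi_matrix V' u) k i j"
      using D(2)[OF u] D'(2)[OF u]
      by (simp add: partial_add partial_cmul differentiable_mult D(4)[OF u] D'(4)[OF u])
    finally show "partial j (partial i (\<lambda>w. (V w + a *\<^sub>R V' w) $ k)) u
        = \<Phi> u (jacobi_matrix (\<lambda>w. V w + a *\<^sub>R V' w) u) k i j"
      by (simp add: J[OF u] linear_add[OF \<Phi>] linear_cmul[OF \<Phi>])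
  qed
qed

lemma solutions_sum:
  fixes V :: "real^'n \<Rightarrow> real^'n"
  assumes W: "open W" and V: "V \<in> solutions W R \<Phi>"
    and R: "\<And>r u. linear (R r u)" and \<Phi>: "\<And>u k i j. linear (\<lambda>A. \<Phi> u A k i j)"
    and "finite B" "B \<subseteq> solutions W R \<Phi>"
  shows "(\<lambda>w. V w + (\<Sum>b\<in>B. a b *\<^sub>R b w)) \<in> solutions W R \<Phi> \<and>
    (\<forall>u\<in>W. jacobi_matrix (\<lambda>w. V w + (\<Sum>b\<in>B. a b *\<^sub>R b w)) u
      = jacobi_matrix V u + (\<Sum>b\<in>B. a b *\<^sub>R jacobi_matrix b u))"
  using assms(5,6)
proof (induction B rule: finite_induct)
  case empty
  then show ?case using V by simp
next
  case (insert b B)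
  let ?V = "\<lambda>w. V w + (\<Sum>b\<in>B. a b *\<^sub>R b w)"
  have IH: "?V \<in> solutions W R \<Phi>"
    "\<And>u. u \<in> W \<Longrightarrow> jacobi_matrix ?V u = jacobi_matrix V u + (\<Sum>b\<in>B. a b *\<^sub>R jacobi_matrix b u)"
    using insert by auto
  have b: "b \<in> solutions W R \<Phi>" using insert.prems by simp
  have eq: "(\<lambda>w. V w + (\<Sum>b\<in>insert b B. a b *\<^sub>R b w)) = (\<lambda>w. ?V w + a b *\<^sub>R b w)"
    using insert.hyps by (simp add: fun_eq_iff algebra_simps)
  show ?case
    unfolding eq
    using solutions_combine[OF W IH(1) b R \<Phi>, where a="a b"] IH(2) insert.hyps
    by (simp add: algebra_simps)
qed

context hamiltonian_operator
begin

abbreviation sols :: "(real^'n) set \<Rightarrow> (real^'n \<Rightarrow> real^'n) set" where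
  "sols W \<equiv> solutions W (first_order gu cu) (second_order gu cu)"

lemma N_bounded:
  assumes "cball u0 r \<subseteq> U"
  obtains M where "M \<ge> 0" "\<And>u k m j. u \<in> cball u0 r \<Longrightarrow> \<bar>N k m j u\<bar> \<le> M"
proof -
  define f where "f u = (\<Sum>k\<in>UNIV. \<Sum>m\<in>UNIV. \<Sum>j\<in>UNIV. \<bar>N k m j u\<bar>)" for u
  have "continuous_on (cball u0 r) (N k m j)" for k m j
    using assms N_differentiable differentiable_imp_continuous_within
    by (meson continuous_at_imp_continuous_on subsetD)
  then have "continuous_on (cball u0 r) f"
    unfolding f_def by (intro continuous_intros)
  then have "bounded (f ` cball u0 r)"
    by (intro compact_imp_bounded compact_continuous_image compact_cball)
  then obtain M where M: "M > 0" "\<And>u. u \<in> cball u0 r \<Longrightarrow> \<bar>f u\<bar> \<le> M"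
    unfolding bounded_pos by auto
  have "\<bar>N k m j u\<bar> \<le> M" if "u \<in> cball u0 r" for u k m j
  proof -
    have "\<bar>N k m j u\<bar> \<le> (\<Sum>j\<in>UNIV. \<bar>N k m j u\<bar>)" by (rule member_le_sum) auto
    also have "\<dots> \<le> (\<Sum>m\<in>UNIV. \<Sum>j\<in>UNIV. \<bar>N k m j u\<bar>)"
      by (rule member_le_sum[where f="\<lambda>m. \<Sum>j\<in>UNIV. \<bar>N k m j u\<bar>"]) (auto intro: sum_nonneg)
    also have "\<dots> \<le> f u"
      unfolding f_def
      by (rule member_le_sum[where f="\<lambda>k. \<Sum>m\<in>UNIV. \<Sum>j\<in>UNIV. \<bar>N k m j u\<bar>"]) (auto intro: sum_nonneg)
    finally show ?thesis using M(2)[OF that] by linarith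
  qed
  with M(1) that show ?thesis by (meson less_imp_le)
qed

text \<open>Along the segment from \<open>u0\<close> to \<open>u\<close> the third family is a
  homogeneous linear system for the entries of the Jacobi matrix, with coefficients bounded on the
  ball. The sum \<open>y\<close> of their squares satisfies the inequality of
  \<open>gronwall_zero\<close>.\<close>

lemma jacobi_matrix_zero_ball:
  assumes WU: "W \<subseteq> U" and V: "V \<in> sols W" and r: "cball u0 r \<subseteq> W" and u: "u \<in> cball u0 r"
    and J0: "jacobi_matrix V u0 = 0"
  shows "jacobi_matrix V u = 0"
proof -
  obtain M where M: "M \<ge> 0" "\<And>u k m j. u \<in> cball u0 r \<Longrightarrow> \<bar>N k m j u\<bar> \<le> M"
    using N_bounded[of u0 r] r WU by blast
  define d where "d = u - u0"
  define \<gamma> where "\<gamma> t = u0 + t *\<^sub>R d" for t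
  define n where "n = real CARD('n)"
  have \<gamma>: "\<gamma> t \<in> cball u0 r" if "t \<in> {0..1}" for t
  proof -
    have "\<bar>t\<bar> * norm d \<le> 1 * norm d" by (rule mult_right_mono) (use that in auto)
    then show ?thesis using u by (simp add: \<gamma>_def d_def dist_norm norm_minus_commute)
  qed
  define a where "a k i t = partial i (\<lambda>w. V w $ k) (\<gamma> t)" for k i t
  define a' where "a' k i t = (\<Sum>j\<in>UNIV. second_order gu cu (\<gamma> t) (jacobi_matrix V (\<gamma> t)) k i j * d $ j)" for k i t
  have a: "(a k i has_real_derivative a' k i t) (at t)" if "t \<in> {0..1}" for k i t
  proof -
    have W: "\<gamma> t \<in> W" using \<gamma>[OF that] r by blast
    have "(\<gamma> has_vector_derivative d) (at t)"
      unfolding \<gamma>_def by (auto intro!: derivative_eq_intros)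
    from has_real_derivative_compose_field[OF solutionsD(2)[OF V W] this] show ?thesis
      by (simp add: a_def[abs_def] a'_def solutionsD(4)[OF V W])
  qed
  define y where "y t = (\<Sum>k\<in>UNIV. \<Sum>i\<in>UNIV. (a k i t)^2)" for t
  \<comment> \<open>Each second derivative is at most \<open>2 * n * M\<close> times the root of
    \<open>y\<close>; summing over the \<open>n\<close> components of \<open>d\<close>, each bounded
    by \<open>norm d\<close>, gives this constant.\<close>
  define L where "L = n * (2 * n * M * norm d)"
  have y_nonneg: "y t \<ge> 0" for t unfolding y_def by (intro sum_nonneg) auto
  have a_le: "\<bar>a k i t\<bar> \<le> sqrt (y t)" for k i t
  proof -
    have "(a k i t)^2 \<le> (\<Sum>i\<in>UNIV. (a k i t)^2)" by (rule member_le_sum) auto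
    also have "\<dots> \<le> y t"
      unfolding y_def by (rule member_le_sum[where f="\<lambda>k. \<Sum>i\<in>UNIV. (a k i t)^2"]) (auto intro: sum_nonneg)
    finally show ?thesis by (simp add: real_le_rsqrt)
  qed
  have a'_le: "\<bar>a' k i t\<bar> \<le> L * sqrt (y t)" if t: "t \<in> {0..1}" for k i t
  proof -
    have sum_le: "\<bar>\<Sum>m\<in>UNIV. N k m j (\<gamma> t) * a m i t\<bar> \<le> n * (M * sqrt (y t))" for i j
    proof -
      have "\<bar>\<Sum>m\<in>UNIV. N k m j (\<gamma> t) * a m i t\<bar> \<le> (\<Sum>m\<in>(UNIV::'n set). M * sqrt (y t))"
        by (intro order_trans[OF sum_abs] sum_mono)
          (simp add: abs_mult mult_mono' M(2)[OF \<gamma>[OF t]] a_le)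
      then show ?thesis by (simp add: n_def)
    qed
    have so: "\<bar>second_order gu cu (\<gamma> t) (jacobi_matrix V (\<gamma> t)) k i j\<bar> \<le> 2 * n * M * sqrt (y t)" for j
    proof -
      have "\<gamma> t \<in> U" using \<gamma>[OF t] r WU by blast
      then show ?thesis
        using sum_le[of j i] sum_le[of i j]
        by (simp add: second_order_eq jacobi_matrix_component flip: a_def)
    qed
    have "\<bar>a' k i t\<bar> \<le> (\<Sum>j\<in>(UNIV::'n set). (2 * n * M * sqrt (y t)) * norm d)"
      unfolding a'_def
      by (intro order_trans[OF sum_abs] sum_mono) (simp add: abs_mult mult_mono' so component_le_norm_cart)
    then show ?thesis by (simp add: L_def n_def mult_ac)
  qed
  have "y 1 = 0"
  proof (rule gronwall_zero)
    fix t :: real assume t: "t \<in> {0..1}"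
    show "(y has_real_derivative (\<Sum>k\<in>UNIV. \<Sum>i\<in>UNIV. 2 * (a k i t * a' k i t))) (at t)"
      unfolding y_def by (auto intro!: derivative_eq_intros a[OF t] simp: mult.commute)
    have "2 * (a k i t * a' k i t) \<le> 2 * (L * y t)" for k i
    proof -
      have "a k i t * a' k i t \<le> \<bar>a k i t\<bar> * \<bar>a' k i t\<bar>" by (simp flip: abs_mult)
      also have "\<dots> \<le> sqrt (y t) * (L * sqrt (y t))"
        by (intro mult_mono a_le a'_le[OF t]) (auto simp: y_nonneg)
      also have "\<dots> = L * y t" using y_nonneg[of t] by (simp add: mult_ac flip: power2_eq_square)
      finally show ?thesis by simp
    qed
    then have "(\<Sum>k\<in>UNIV. \<Sum>i\<in>UNIV. 2 * (a k i t * a' k i t)) \<le> (\<Sum>k\<in>(UNIV::'n set). \<Sum>i\<in>(UNIV::'n set). 2 * (L * y t))"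
      by (intro sum_mono)
    then show "(\<Sum>k\<in>UNIV. \<Sum>i\<in>UNIV. 2 * (a k i t * a' k i t)) \<le> n * n * 2 * L * y t"
      by (simp add: n_def mult_ac)
  next
    have "a k i 0 = 0" for k i
      using J0 jacobi_matrix_component[of V u0 k i] by (simp add: a_def \<gamma>_def)
    then show "y 0 = 0" by (simp add: y_def)
  qed (rule y_nonneg)
  then have "a k i 1 = 0" for k i
    using a_le[of k i 1] by simp
  then show ?thesis
    by (simp add: vec_eq_iff jacobi_matrix_component a_def \<gamma>_def d_def)
qed

text \<open>The points where both \<open>V\<close> and its Jacobi matrix vanish form a subset that
  is relatively closed by continuity and open by the local result, hence all of the connected set
  \<open>W\<close>.\<close>

lemma solution_unique:
  assumes W: "open W" "connected W" "W \<subseteq> U" and V: "V \<in> sols W" and u0: "u0 \<in> W"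
    and 0: "V u0 = 0" "jacobi_matrix V u0 = 0" and u: "u \<in> W"
  shows "V u = 0"
proof -
  define Z where "Z = {u \<in> W. V u = 0 \<and> jacobi_matrix V u = 0}"
  have cont: "continuous_on W (\<lambda>u. V u $ k)" "continuous_on W (\<lambda>u. jacobi_matrix V u $ k $ i)" for k i
    unfolding jacobi_matrix_component
    using solutionsD(1,2)[OF V] differentiable_imp_continuous_within
    by (meson continuous_at_imp_continuous_on)+
  have "continuous_on W (\<lambda>u. \<chi> k. V u $ k)" "continuous_on W (\<lambda>u. \<chi> k i. jacobi_matrix V u $ k $ i)"
    by (intro continuous_on_vec_lambda cont)+
  then have contV: "continuous_on W V" and contJ: "continuous_on W (jacobi_matrix V)"
    by (simp_all add: vec_lambda_eta)
  have "Z = W \<inter> V -` {0} \<inter> (W \<inter> jacobi_matrix V -` {0})" by (auto simp: Z_def)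
  then have closed: "closedin (top_of_set W) Z"
    by (auto intro!: closedin_Int continuous_closedin_preimage contV contJ)
  have "open Z"
    unfolding open_contains_ball
  proof
    fix z assume "z \<in> Z"
    then have z: "z \<in> W" "V z = 0" "jacobi_matrix V z = 0" by (auto simp: Z_def)
    obtain r where r: "r > 0" "cball z r \<subseteq> W"
      using open_contains_cball W(1) z(1) by blast
    have J: "jacobi_matrix V w = 0" if "w \<in> cball z r" for w
      by (rule jacobi_matrix_zero_ball[OF W(3) V r(2) that z(3)])
    \<comment> \<open>The vanishing Jacobi matrix makes \<open>V\<close> constant on the convex
      ball, and the constant is its value at the centre.\<close>
    have "V w $ k = 0" if w: "w \<in> cball z r" for w k
    proof -
      have "((\<lambda>w. V w $ k) has_derivative (\<lambda>h. 0)) (at w within cball z r)" if "w \<in> cball z r" for w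
      proof -
        have "w \<in> W" using that r(2) by blast
        from partial_has_derivative[OF solutionsD(1)[OF V this, of k]]
        have "((\<lambda>w. V w $ k) has_derivative (\<lambda>h. 0)) (at w)"
          using J[OF that] by (simp flip: jacobi_matrix_component)
        then show ?thesis by (rule has_derivative_at_withinI)
      qed
      from has_derivative_zero_constant[OF convex_cball this]
      obtain e where "\<forall>w\<in>cball z r. V w $ k = e" by blast
      then show ?thesis using w z(2) r(1) by (metis centre_in_cball less_imp_le zero_index)
    qed
    then have "ball z r \<subseteq> Z"
      using J r(2) by (auto simp: Z_def vec_eq_iff subset_iff)
    then show "\<exists>e>0. ball z e \<subseteq> Z" using r(1) by blast
  qed
  then have "openin (top_of_set W) Z" by (auto simp: Z_def intro: open_subset)
  with closed have "Z = {} \<or> Z = W" using W(2) by (auto simp: connected_clopen)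
  moreover have "u0 \<in> Z" using 0 u0 by (simp add: Z_def)
  ultimately show ?thesis using u by (auto simp: Z_def)
qed

end

section \<open>Counting constants\<close>

text \<open>The index type carries no order, so one is borrowed from the naturals through an
  injection. The pairs \<open>P\<close> and their converses cover all pairs and meet in the
  diagonal, which gives the count.\<close>

lemma ordered_index_pairs:
  obtains P :: "('n::finite \<times> 'n) set"
  where "2 * card P = CARD('n) * (CARD('n) + 1)" "\<And>i j. (i, j) \<in> P \<or> (j, i) \<in> P"
proof -
  obtain f :: "'n \<Rightarrow> nat" where f: "inj f"
    using finite_imp_inj_to_nat_seg[of "UNIV :: 'n set"] by auto
  define P where "P = {(i, j). f i \<le> f j}"
  have "P \<union> P\<inverse> = UNIV" "P \<inter> P\<inverse> = Id"
    using f by (auto simp: P_def inj_def)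
  then have "card P + card (P\<inverse>) = CARD('n \<times> 'n) + card (Id :: ('n \<times> 'n) set)"
    by (metis card_Un_Int finite)
  moreover have "card (Id :: ('n \<times> 'n) set) = CARD('n)"
  proof -
    have "(Id :: ('n \<times> 'n) set) = (\<lambda>x. (x, x)) ` UNIV" by auto
    also have "card \<dots> = CARD('n)" by (rule card_image) (simp add: inj_on_def)
    finally show ?thesis .
  qed
  ultimately have "2 * card P = CARD('n) * (CARD('n) + 1)"
    by (simp add: card_prod algebra_simps)
  moreover have "(i, j) \<in> P \<or> (j, i) \<in> P" for i j
    by (auto simp: P_def)
  ultimately show ?thesis by (rule that)
qed

text \<open>As \<open>M\<close> is invertible, a pair is determined by \<open>v\<close> and by the
  entries of the symmetric product on and above the diagonal. Recording these is injective and lands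
  in a span of \<open>CARD('n) + card P\<close> vectors.\<close>

lemma dim_symmetric_pairs:
  fixes M :: "real^'n^'n" and S :: "((real^'n) \<times> (real^'n^'n)) set"
  assumes M: "det M \<noteq> 0" and sym: "\<And>v A. (v, A) \<in> S \<Longrightarrow> transpose (M ** A) = M ** A"
  shows "dim S \<le> CARD('n) * (CARD('n) + 3) div 2"
proof -
  obtain P :: "('n \<times> 'n) set" where P: "2 * card P = CARD('n) * (CARD('n) + 1)" "\<And>i j. (i, j) \<in> P \<or> (j, i) \<in> P"
    using ordered_index_pairs by blast
  \<comment> \<open>The set \<open>S\<close> need not be a subspace. Passing to the subspace of all
    symmetric pairs yields injectivity on the span of \<open>S\<close>, as preservation of dimension
    requires.\<close>
  define Sym where "Sym = {z :: (real^'n) \<times> (real^'n^'n). transpose (M ** snd z) = M ** snd z}"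
  have entry: "(M ** A) $ i $ j = (\<Sum>k\<in>UNIV. M $ i $ k * A $ k $ j)" for A :: "real^'n^'n" and i j
    by (simp add: matrix_matrix_mult_def)
  have Sym_iff: "z \<in> Sym \<longleftrightarrow> (\<forall>i j. (M ** snd z) $ i $ j = (M ** snd z) $ j $ i)" for z
    by (auto simp: Sym_def vec_eq_iff transpose_def)
  have lin: "(M ** (A + B)) $ i $ j = (M ** A) $ i $ j + (M ** B) $ i $ j"
    "(M ** (a *\<^sub>R A)) $ i $ j = a * (M ** A) $ i $ j" for A B :: "real^'n^'n" and a i j
    by (simp_all add: entry algebra_simps sum.distrib sum_distrib_left)
  have "subspace Sym"
    unfolding subspace_def by (auto simp: Sym_iff lin)
  moreover have "S \<subseteq> Sym" using sym by (auto simp: Sym_def)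
  ultimately have span: "span S \<subseteq> Sym" by (simp add: span_minimal)
  define \<Psi> where "\<Psi> z = (fst z, \<chi> i j. if (i, j) \<in> P then (M ** snd z) $ i $ j else 0)"
    for z :: "(real^'n) \<times> (real^'n^'n)"
  have "linear \<Psi>"
    by (intro linearI) (auto simp: \<Psi>_def vec_eq_iff lin)
  moreover have "inj_on \<Psi> (span S)"
  proof (rule inj_onI)
    fix z z' assume z: "z \<in> span S" "z' \<in> span S" and eq: "\<Psi> z = \<Psi> z'"
    have on_P: "(M ** snd z) $ i $ j = (M ** snd z') $ i $ j" if "(i, j) \<in> P" for i j
    proof -
      have "snd (\<Psi> z) $ i $ j = snd (\<Psi> z') $ i $ j" using eq by simp
      then show ?thesis using that by (simp add: \<Psi>_def)
    qed
    have "(M ** snd z) $ i $ j = (M ** snd z') $ i $ j" for i j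
      using P(2)[of i j] on_P[of i j] on_P[of j i] z span Sym_iff by (metis subsetD)
    then have "M ** snd z = M ** snd z'" by (simp add: vec_eq_iff)
    then have "snd z = snd z'"
      using matrix_inv_mult(2)[OF M] by (metis matrix_mul_assoc matrix_mul_lid)
    moreover have "fst z = fst z'" using eq by (simp add: \<Psi>_def)
    ultimately show "z = z'" by (simp add: prod_eq_iff)
  qed
  ultimately have "dim S = dim (\<Psi> ` S)" by (simp add: dim_image_eq)
  also have "\<dots> \<le> card ((\<lambda>i. (axis i 1, 0)) ` UNIV \<union> (\<lambda>(i, j). (0, axis i (axis j 1))) ` P :: ((real^'n) \<times> (real^'n^'n)) set)"
    (is "_ \<le> card (?B1 \<union> ?B2)")
  proof (rule dim_le_card)
    show "\<Psi> ` S \<subseteq> span (?B1 \<union> ?B2)"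
    proof
      fix w assume "w \<in> \<Psi> ` S"
      then obtain z where z: "w = \<Psi> z" by blast
      have "w = (\<Sum>i\<in>UNIV. (fst z $ i) *\<^sub>R (axis i 1, 0)) + (\<Sum>(i, j)\<in>P. ((M ** snd z) $ i $ j) *\<^sub>R (0, axis i (axis j 1)))"
        (is "_ = ?s1 + ?s2")
      proof (rule prod_eqI)
        have s1: "fst ?s1 = fst z" "snd ?s1 = 0"
          by (simp_all add: fst_sum snd_sum basis_expansion flip: scalar_mult_eq_scaleR)
        have "fst ?s2 = 0" by (simp add: fst_sum split_beta)
        with s1 show "fst w = fst (?s1 + ?s2)" by (simp add: z \<Psi>_def)
        have "snd ?s2 $ a $ b = (if (a, b) \<in> P then (M ** snd z) $ a $ b else 0)" for a b
        proof -
          have "snd ?s2 $ a $ b = (\<Sum>p\<in>P. if p = (a, b) then (M ** snd z) $ a $ b else 0)"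
            unfolding snd_sum sum_component
            by (rule sum.cong) (auto simp: axis_def split: if_splits)
          then show ?thesis by simp
        qed
        with s1 show "snd w = snd (?s1 + ?s2)" by (simp add: z \<Psi>_def vec_eq_iff)
      qed
      also have "\<dots> \<in> span (?B1 \<union> ?B2)"
      proof (intro span_add span_sum)
        fix i
        show "(fst z $ i) *\<^sub>R (axis i 1, 0) \<in> span (?B1 \<union> ?B2)"
          by (intro span_scale span_base) simp
      next
        fix p assume "p \<in> P"
        then have "(0, axis (fst p) (axis (snd p) 1)) \<in> ?B1 \<union> ?B2" by force
        then show "(case p of (i, j) \<Rightarrow> ((M ** snd z) $ i $ j) *\<^sub>R (0, axis i (axis j 1))) \<in> span (?B1 \<union> ?B2)"
          unfolding split_beta by (intro span_scale span_base)
      qed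
      finally show "w \<in> span (?B1 \<union> ?B2)" .
    qed
  qed simp
  also have "\<dots> \<le> CARD('n) + card P"
    by (intro order_trans[OF card_Un_le] add_mono card_image_le) simp_all
  also have "\<dots> \<le> CARD('n) * (CARD('n) + 3) div 2"
    using P(1) by (simp add: algebra_simps)
  finally show ?thesis .
qed

text \<open>The values of a solution and of its Jacobi matrix at one point determine it. A basis of
  the span of these initial data, chosen among them and lifted to solutions, therefore generates all
  solutions on \<open>W\<close>.\<close>

lemma (in hamiltonian_operator) solutions_basis:
  assumes W: "open W" "connected W" "W \<subseteq> U"
  shows "\<exists>B. finite B \<and> card B \<le> CARD('n) * (CARD('n) + 3) div 2 \<and> B \<subseteq> sols W \<and>
        (\<forall>V \<in> sols W. \<exists>a. \<forall>u\<in>W. V u = (\<Sum>b\<in>B. a b *\<^sub>R b u))"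
proof (cases "W = {}")
  case True
  then show ?thesis by (intro exI[of _ "{}"]) auto
next
  case False
  then obtain u0 where u0: "u0 \<in> W" by blast
  define L where "L V = (V u0, jacobi_matrix V u0)" for V :: "real^'n \<Rightarrow> real^'n"
  have "dim (L ` sols W) \<le> CARD('n) * (CARD('n) + 3) div 2"
  proof (rule dim_symmetric_pairs)
    have det: "det (gu u0) \<noteq> 0" using u0 W(3) det_gu by blast
    have "det (gu u0) * det (matrix_inv (gu u0)) = 1"
      using matrix_inv_mult(1)[OF det] by (metis det_mul det_I)
    then show "det (matrix_inv (gu u0)) \<noteq> 0" by auto
    fix v A assume "(v, A) \<in> L ` sols W"
    then obtain V where V: "V \<in> sols W" "A = jacobi_matrix V u0" by (auto simp: L_def)
    have "first_order gu cu (Symm i j) u0 A = 0" for i j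
      unfolding V(2) by (rule solutionsD(3)[OF V(1) u0])
    then show "transpose (matrix_inv (gu u0) ** A) = matrix_inv (gu u0) ** A"
      by (simp add: g_low_def vec_eq_iff transpose_def matrix_matrix_mult_def)
  qed
  then obtain B' where B': "B' \<subseteq> L ` sols W" "independent B'" "L ` sols W \<subseteq> span B'"
    "card B' \<le> CARD('n) * (CARD('n) + 3) div 2"
    by (metis basis_exists)
  have fin: "finite B'" using B'(2) by (rule independent_imp_finite)
  \<comment> \<open>One solution is chosen for each basis vector of initial data; \<open>L\<close>
    maps it back to that vector.\<close>
  define B where "B = inv_into (sols W) L ` B'"
  have L_inv: "L (inv_into (sols W) L b) = b" if "b \<in> B'" for b
    using that B'(1) f_inv_into_f[of b L "sols W"] by blast
  have B: "finite B" "card B \<le> card B'" "B \<subseteq> sols W"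
    using fin B'(1) by (auto simp: B_def intro: card_image_le inv_into_into)
  have "\<exists>a. \<forall>u\<in>W. V u = (\<Sum>b\<in>B. a b *\<^sub>R b u)" if V: "V \<in> sols W" for V
  proof -
    have "L V \<in> span B'" using B'(3) V by blast
    then obtain a' where a': "L V = (\<Sum>b\<in>B'. a' b *\<^sub>R b)"
      by (auto simp: span_finite[OF fin])
    have LV: "L V = (\<Sum>b\<in>B. a' (L b) *\<^sub>R L b)"
    proof -
      have "inj_on (inv_into (sols W) L) B'" using L_inv by (metis inj_onI)
      then show ?thesis unfolding a' B_def by (simp add: sum.reindex L_inv)
    qed
    \<comment> \<open>The difference between \<open>V\<close> and the combination with the same
      initial data is a solution with zero data at \<open>u0\<close>, hence zero on
      \<open>W\<close>.\<close>
    let ?D = "\<lambda>w. V w + (\<Sum>b\<in>B. - a' (L b) *\<^sub>R b w)"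
    have D: "?D \<in> sols W"
      and J: "jacobi_matrix ?D u0 = jacobi_matrix V u0 + (\<Sum>b\<in>B. - a' (L b) *\<^sub>R jacobi_matrix b u0)"
      using solutions_sum[OF W(1) V linear_first_order linear_second_order B(1,3), where a="\<lambda>b. - a' (L b)"] u0 by auto
    have "V u0 = (\<Sum>b\<in>B. a' (L b) *\<^sub>R b u0)" "jacobi_matrix V u0 = (\<Sum>b\<in>B. a' (L b) *\<^sub>R jacobi_matrix b u0)"
      using arg_cong[OF LV, of fst] arg_cong[OF LV, of snd] by (simp_all add: L_def fst_sum snd_sum)
    then have "?D u0 = 0" "jacobi_matrix ?D u0 = 0"
      unfolding J by (simp_all add: sum_negf)
    then have "?D u = 0" if "u \<in> W" for u
      using solution_unique[OF W D u0 _ _ that] by simp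
    then have "\<forall>u\<in>W. V u = (\<Sum>b\<in>B. a' (L b) *\<^sub>R b u)"
      by (simp add: sum_negf)
    then show ?thesis by (intro exI[of _ "\<lambda>b. a' (L b)"])
  qed
  then show ?thesis using B B'(4) by (intro exI[of _ B]) auto
qed

theorem theorem2:
  fixes U :: "(real^'n) set"
    and gu :: "real^'n \<Rightarrow> real^'n^'n"
    and cu :: "real^'n \<Rightarrow> 'n \<Rightarrow> 'n \<Rightarrow> 'n \<Rightarrow> real"
  assumes "nondegenerate_hamiltonian U gu cu"
  shows "in_involution U (first_order gu cu) (second_order gu cu) \<and>
    (\<forall>W. open W \<and> connected W \<and> W \<subseteq> U \<longrightarrow>
      (\<exists>B. finite B \<and> card B \<le> CARD('n) * (CARD('n) + 3) div 2 \<and>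
        B \<subseteq> solutions W (first_order gu cu) (second_order gu cu) \<and>
        (\<forall>V \<in> solutions W (first_order gu cu) (second_order gu cu).
          \<exists>a. \<forall>u\<in>W. V u = (\<Sum>b\<in>B. a b *\<^sub>R b u))))"
proof -
  interpret hamiltonian_operator U gu cu by (unfold_locales) (rule assms)
  show ?thesis using in_involution solutions_basis by blast
qed

end
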